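(* Let $\mathcal N,\mathcal M\in\mathrm{CPTP}(A\to B)$ be two quantum channels and $\mathcal I\in\mathrm{CPTP}(A\to A)$ the identity channel. The exponentially strong converse property holds under coherent strategies for the channels $\mathcal I\otimes\mathcal N$ and $\mathcal I\otimes\mathcal M$ if and only if it holds under sequential strategies for the channels $\mathcal I\otimes\mathcal N$ and $\mathcal I\otimes\mathcal M$.
   Context: All Hilbert spaces are finite-dimensional; $\mathfrak{D}(A)$ is the set of density operators on $A$, $\mathrm{CPTP}(A\to B)$ the set of quantum channels, $\log$ is base two. $D(\rho\|\sigma)=\operatorname{Tr}[\rho(\log\rho-\log\sigma)]$ if $\operatorname{supp}\rho\subseteq\operatorname{supp}\sigma$, else $+\infty$. For channels $\mathcal E,\mathcal F\in\mathrm{CPTP}(C\to G)$, $d(\mathcal E\|\mathcal F)=\sup_{\rho\in\mathfrak{D}(C)}D(\mathcal E(\rho)\|\mathcal F(\rho))$ and $d^{\mathrm{reg}}(\mathcal E\|\mathcal F)=\sup_n\frac1n d(\mathcal E^{\otimes n}\|\mathcal F^{\otimes n})$. Strategies for discriminating $\mathcal E$ from $\mathcal F$ with $n$ channel uses consist of a way of producing a testing state, $\rho_n$ if the channel is $\mathcal E$ and $\sigma_n$ if it is $\mathcal F$, and a test $0\le\Pi_n\le I$; the errors are $\alpha_n=\operatorname{Tr}[(I-\Pi_n)\rho_n]$ (Type-I) and $\beta_n=\operatorname{Tr}[\Pi_n\sigma_n]$ (Type-II). - Coherent strategy (without quantum memory): choose $\psi_n\in\mathfrak{D}(C^n)$;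 $\rho_n=\mathcal E^{\otimes n}(\psi_n)$, $\sigma_n=\mathcal F^{\otimes n}(\psi_n)$. - Sequential strategy: choose memory systems $R_1,\dots,R_n$ of arbitrary finite dimension, an initial state $\psi_n\in\mathfrak{D}(R_1C_1)$ and update channels $\mathcal P_i\in\mathrm{CPTP}(R_iG_i\to R_{i+1}C_{i+1})$ for $i=1,\dots,n-1$ ($C_i\cong C$, $G_i\cong G$); $\rho_n=\mathcal E\circ\mathcal P_{n-1}\circ\cdots\circ\mathcal P_2\circ\mathcal E\circ\mathcal P_1\circ\mathcal E(\psi_n)$ and $\sigma_n=\mathcal F\circ\mathcal P_{n-1}\circ\cdots\circ\mathcal P_2\circ\mathcal F\circ\mathcal P_1\circ\mathcal F(\psi_n)$, where each $\mathcal E$ (or $\mathcal F$) acts as the identity on the memory. The exponentially strong converse property for $\mathcal E,\mathcal F$ under a class of strategies: for any sequence of strategies in the class ($n\in\mathbb N$) with $\liminf_{n\to\infty}-\frac1n\log\beta_n>d^{\mathrm{reg}}(\mathcal E\|\mathcal F)$, there exist a constant $c>0$ and a subsequence of Type-I errors $\alpha_{n_k}$ such that $1-\alpha_{n_k}\le2^{-cn_k}$ for all sufficiently large $n_k$. *)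

theory Defs
  imports
    "Jordan_Normal_Form.Schur_Decomposition"
    "Jordan_Normal_Form.Matrix_Kernel"
    "HOL-Library.Extended_Real"
    "HOL-Library.Liminf_Limsup"
begin

text \<open>
  A finite-dimensional Hilbert space of dimension \<open>d\<close> is the space of complex vectors of
  length \<open>d\<close>, and operators are matrices.  A tensor product of spaces of dimensions \<open>d\<close> and
  \<open>d'\<close> has dimension \<open>d * d'\<close>, the basis vector with index \<open>i * d' + k\<close> being the tensor product
  of the \<open>i\<close>-th and the \<open>k\<close>-th basis vectors.
\<close>

subsection \<open>States and tests\<close>

definition mtrace :: "complex mat \<Rightarrow> complex" where
  "mtrace X = (\<Sum>i<dim_row X. X $$ (i, i))"

text \<open>The order is that of \<open>Complex_Order\<close>, so the condition includes that the quadratic form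
  is real, that is, that the matrix is Hermitian.\<close>

definition psd :: "nat \<Rightarrow> complex mat \<Rightarrow> bool" where
  "psd d X \<longleftrightarrow> X \<in> carrier_mat d d \<and> (\<forall>v\<in>carrier_vec d. 0 \<le> (X *\<^sub>v v) \<bullet>c v)"

definition density :: "nat \<Rightarrow> complex mat set" where
  "density d = {\<rho>. psd d \<rho> \<and> mtrace \<rho> = 1}"

definition tests :: "nat \<Rightarrow> complex mat set" where
  "tests d = {T. psd d T \<and> psd d (1\<^sub>m d - T)}"

subsection \<open>Quantum channels\<close>

definition kron :: "complex mat \<Rightarrow> complex mat \<Rightarrow> complex mat" where
  "kron X Y = mat (dim_row X * dim_row Y) (dim_col X * dim_col Y)
     (\<lambda>(i, j). X $$ (i div dim_row Y, j div dim_col Y) * Y $$ (i mod dim_row Y, j mod dim_col Y))"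

definition matrix_unit :: "nat \<Rightarrow> nat \<Rightarrow> nat \<Rightarrow> complex mat" where
  "matrix_unit d i j = mat d d (\<lambda>(p, q). if p = i \<and> q = j then 1 else 0)"

text \<open>The tensor product of linear maps
  \<open>\<Phi> : carrier_mat dA dA \<rightarrow> carrier_mat dB dB\<close> and \<open>\<Psi> : carrier_mat dA' dA' \<rightarrow> carrier_mat dB' dB'\<close>:
  the linear map that sends each product \<open>kron E E'\<close> of matrix units to \<open>kron (\<Phi> E) (\<Psi> E')\<close>.
  The sum is written entrywise because matrices of varying size do not form an additive monoid.\<close>

definition tensor_map ::
  "nat \<Rightarrow> nat \<Rightarrow> nat \<Rightarrow> nat \<Rightarrow> (complex mat \<Rightarrow> complex mat) \<Rightarrow> (complex mat \<Rightarrow> complex mat)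
     \<Rightarrow> complex mat \<Rightarrow> complex mat" where
  "tensor_map dA dB dA' dB' \<Phi> \<Psi> X = mat (dB * dB') (dB * dB')
     (\<lambda>(p, q). \<Sum>i<dA. \<Sum>j<dA. \<Sum>k<dA'. \<Sum>l<dA'.
        X $$ (i * dA' + k, j * dA' + l) *
        kron (\<Phi> (matrix_unit dA i j)) (\<Psi> (matrix_unit dA' k l)) $$ (p, q))"

definition id_tensor ::
  "nat \<Rightarrow> nat \<Rightarrow> nat \<Rightarrow> (complex mat \<Rightarrow> complex mat) \<Rightarrow> complex mat \<Rightarrow> complex mat" where
  "id_tensor r dA dB \<Phi> = tensor_map r r dA dB (\<lambda>X. X) \<Phi>"

primrec tensor_power ::
  "nat \<Rightarrow> nat \<Rightarrow> (complex mat \<Rightarrow> complex mat) \<Rightarrow> nat \<Rightarrow> complex mat \<Rightarrow> complex mat" where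
  "tensor_power dA dB \<Phi> 0 = (\<lambda>X. X)"
| "tensor_power dA dB \<Phi> (Suc n) =
     tensor_map dA dB (dA ^ n) (dB ^ n) \<Phi> (tensor_power dA dB \<Phi> n)"

definition linear_map :: "nat \<Rightarrow> nat \<Rightarrow> (complex mat \<Rightarrow> complex mat) \<Rightarrow> bool" where
  "linear_map dA dB \<Phi> \<longleftrightarrow>
     (\<forall>X\<in>carrier_mat dA dA. \<Phi> X \<in> carrier_mat dB dB) \<and>
     (\<forall>X\<in>carrier_mat dA dA. \<forall>Y\<in>carrier_mat dA dA. \<Phi> (X + Y) = \<Phi> X + \<Phi> Y) \<and>
     (\<forall>X\<in>carrier_mat dA dA. \<forall>c. \<Phi> (c \<cdot>\<^sub>m X) = c \<cdot>\<^sub>m \<Phi> X)"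

definition completely_positive :: "nat \<Rightarrow> nat \<Rightarrow> (complex mat \<Rightarrow> complex mat) \<Rightarrow> bool" where
  "completely_positive dA dB \<Phi> \<longleftrightarrow>
     (\<forall>r X. psd (r * dA) X \<longrightarrow> psd (r * dB) (id_tensor r dA dB \<Phi> X))"

definition trace_preserving :: "nat \<Rightarrow> (complex mat \<Rightarrow> complex mat) \<Rightarrow> bool" where
  "trace_preserving dA \<Phi> \<longleftrightarrow> (\<forall>X\<in>carrier_mat dA dA. mtrace (\<Phi> X) = mtrace X)"

definition CPTP :: "nat \<Rightarrow> nat \<Rightarrow> (complex mat \<Rightarrow> complex mat) set" where
  "CPTP dA dB =
     {\<Phi>. linear_map dA dB \<Phi> \<and> completely_positive dA dB \<Phi> \<and> trace_preserving dA \<Phi>}"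

subsection \<open>Relative entropy and channel divergences\<close>

definition unitary :: "nat \<Rightarrow> complex mat \<Rightarrow> bool" where
  "unitary d U \<longleftrightarrow> U \<in> carrier_mat d d \<and> U * mat_adjoint U = 1\<^sub>m d \<and> mat_adjoint U * U = 1\<^sub>m d"

text \<open>Functional calculus for a Hermitian matrix \<open>X\<close>: \<open>f\<close> is applied to the eigenvalues in a
  unitary diagonalisation of \<open>X\<close>.  The result does not depend on the diagonalisation, so the
  choice operator picks the only candidate.\<close>

definition herm_fun :: "(real \<Rightarrow> real) \<Rightarrow> complex mat \<Rightarrow> complex mat" where
  "herm_fun f X = (SOME Y. \<exists>U l. unitary (dim_row X) U \<and>
     X = U * mat_diag (dim_row X) (\<lambda>i. complex_of_real (l i)) * mat_adjoint U \<and>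
     Y = U * mat_diag (dim_row X) (\<lambda>i. complex_of_real (f (l i))) * mat_adjoint U)"

text \<open>Since \<open>log 2 0 = 0\<close>, the logarithm of a positive semidefinite matrix is taken on its support
  and is zero on its kernel, as is the convention in the relative entropy.\<close>

definition mlog :: "complex mat \<Rightarrow> complex mat" where
  "mlog X = herm_fun (log 2) X"

definition msupp :: "complex mat \<Rightarrow> complex vec set" where
  "msupp X = {v \<in> carrier_vec (dim_col X). \<forall>w\<in>mat_kernel X. v \<bullet>c w = 0}"

definition rel_entropy :: "complex mat \<Rightarrow> complex mat \<Rightarrow> ereal" where
  "rel_entropy \<rho> \<sigma> =
     (if msupp \<rho> \<subseteq> msupp \<sigma> then ereal (Re (mtrace (\<rho> * (mlog \<rho> - mlog \<sigma>)))) else \<infinity>)"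

definition channel_div ::
  "nat \<Rightarrow> (complex mat \<Rightarrow> complex mat) \<Rightarrow> (complex mat \<Rightarrow> complex mat) \<Rightarrow> ereal" where
  "channel_div dC E F = (SUP \<rho>\<in>density dC. rel_entropy (E \<rho>) (F \<rho>))"

definition channel_div_reg ::
  "nat \<Rightarrow> nat \<Rightarrow> (complex mat \<Rightarrow> complex mat) \<Rightarrow> (complex mat \<Rightarrow> complex mat) \<Rightarrow> ereal" where
  "channel_div_reg dC dG E F =
     (SUP n\<in>{1..}. ereal (1 / real n) *
        channel_div (dC ^ n) (tensor_power dC dG E n) (tensor_power dC dG F n))"

subsection \<open>Discrimination strategies\<close>

text \<open>A strategy enters the errors only through the triple \<open>(\<rho>, \<sigma>, T)\<close> of the testing states for
  the two channels and the test; a class of strategies with \<open>n\<close> channel uses is given by the set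
  of its triples.\<close>

type_synonym strategy = "complex mat \<times> complex mat \<times> complex mat"

definition type_I_error :: "strategy \<Rightarrow> real" where
  "type_I_error = (\<lambda>(\<rho>, \<sigma>, T). Re (mtrace ((1\<^sub>m (dim_row T) - T) * \<rho>)))"

definition type_II_error :: "strategy \<Rightarrow> real" where
  "type_II_error = (\<lambda>(\<rho>, \<sigma>, T). Re (mtrace (T * \<sigma>)))"

definition coherent_strategies ::
  "nat \<Rightarrow> nat \<Rightarrow> (complex mat \<Rightarrow> complex mat) \<Rightarrow> (complex mat \<Rightarrow> complex mat) \<Rightarrow> nat
     \<Rightarrow> strategy set" where
  "coherent_strategies dC dG E F n =
     {(tensor_power dC dG E n \<psi>, tensor_power dC dG F n \<psi>, T) | \<psi> T.
        \<psi> \<in> density (dC ^ n) \<and> T \<in> tests (dG ^ n)}"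

text \<open>The state after \<open>i + 1\<close> uses of the channel \<open>E\<close>.  Memory systems and update channels are
  numbered from \<open>0\<close>: the memory at the \<open>(i + 1)\<close>-st use has dimension \<open>r i\<close>, and \<open>P i\<close> acts between
  the \<open>(i + 1)\<close>-st and the \<open>(i + 2)\<close>-nd use.\<close>

primrec seq_state ::
  "nat \<Rightarrow> nat \<Rightarrow> (complex mat \<Rightarrow> complex mat) \<Rightarrow> (nat \<Rightarrow> nat) \<Rightarrow> complex mat
     \<Rightarrow> (nat \<Rightarrow> complex mat \<Rightarrow> complex mat) \<Rightarrow> nat \<Rightarrow> complex mat" where
  "seq_state dC dG E r \<psi> P 0 = id_tensor (r 0) dC dG E \<psi>"
| "seq_state dC dG E r \<psi> P (Suc i) =
     id_tensor (r (Suc i)) dC dG E (P i (seq_state dC dG E r \<psi> P i))"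

text \<open>Only meaningful for \<open>n \<ge> 1\<close>.\<close>

definition sequential_strategies ::
  "nat \<Rightarrow> nat \<Rightarrow> (complex mat \<Rightarrow> complex mat) \<Rightarrow> (complex mat \<Rightarrow> complex mat) \<Rightarrow> nat
     \<Rightarrow> strategy set" where
  "sequential_strategies dC dG E F n =
     {(seq_state dC dG E r \<psi> P (n - 1), seq_state dC dG F r \<psi> P (n - 1), T) | r \<psi> P T.
        (\<forall>i<n. 0 < r i) \<and>
        \<psi> \<in> density (r 0 * dC) \<and>
        (\<forall>i<n - 1. P i \<in> CPTP (r i * dG) (r (Suc i) * dC)) \<and>
        T \<in> tests (r (n - 1) * dG)}"

subsection \<open>The exponentially strong converse property\<close>

text \<open>An error probability equal to zero has exponent \<open>\<infinity>\<close>.\<close>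

definition neg_log2 :: "real \<Rightarrow> ereal" where
  "neg_log2 x = (if x \<le> 0 then \<infinity> else ereal (- log 2 x))"

definition exp_strong_converse ::
  "(nat \<Rightarrow> nat \<Rightarrow> (complex mat \<Rightarrow> complex mat) \<Rightarrow> (complex mat \<Rightarrow> complex mat) \<Rightarrow> nat
      \<Rightarrow> strategy set)
     \<Rightarrow> nat \<Rightarrow> nat \<Rightarrow> (complex mat \<Rightarrow> complex mat) \<Rightarrow> (complex mat \<Rightarrow> complex mat) \<Rightarrow> bool" where
  "exp_strong_converse S dC dG E F \<longleftrightarrow>
     (\<forall>s. (\<forall>n\<ge>1. s n \<in> S dC dG E F n) \<longrightarrow>
        liminf (\<lambda>n. ereal (1 / real n) * neg_log2 (type_II_error (s n)))
          > channel_div_reg dC dG E F \<longrightarrow>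
        (\<exists>c>0. \<exists>m. strict_mono m \<and>
           (\<forall>\<^sub>F k in sequentially.
              1 - type_I_error (s (m k)) \<le> 2 powr (- c * real (m k)))))"

end

theory Submission
  imports Defs
begin

text \<open>
  A coherent strategy is the sequential one that keeps the unused systems in the memory, so the
  point is the converse.  Let \<open>E\<close> and \<open>F\<close> be the two channels, let \<open>l\<close> exceed their regularised
  divergence, and run near-optimal coherent strategies for the functional
  \<open>Tr T E\<^sup>m(\<psi>) - 2\<^sup>m\<^sup>l Tr T F\<^sup>m(\<psi>)\<close>: the coherent property makes it at most \<open>2\<^sup>-\<^sup>c\<^sup>m\<close> for infinitely many
  \<open>m\<close>.  As the channels carry an identity factor of the input dimension, the same bound
  holds in the presence of any further reference.  Moreover a finite divergence on the maximally
  entangled state forces \<open>E \<le> L F\<close> in the completely positive order.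

  Fix such an \<open>m\<close> and run \<open>m\<close> copies of a sequential strategy with \<open>n\<close> uses in parallel.
  At each of the \<open>n\<close> steps the output of \<open>E\<^sup>m\<close> is, up to a constant factor, at most \<open>A + B\<close> with
  \<open>A \<le> 2\<^sup>m\<^sup>l F\<^sup>m\<close>, with \<open>B\<close> of relative trace \<open>2\<^sup>-\<^sup>c\<^sup>m\<close> and with \<open>B \<le> L\<^sup>m F\<^sup>m\<close>, again up to constants.  Among the
  \<open>2\<^sup>n\<close> resulting histories, those with few \<open>B\<close>-steps are controlled by the Type-II error and
  those with many by their trace.  The constants contribute a factor \<open>C\<^sup>n\<close> to a bound on
  the \<open>m\<close>-th power of the success probability, hence only \<open>C\<^sup>n\<^sup>/\<^sup>m\<close> to the success probability itself,
  which is negligible for large \<open>m\<close>.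
\<close>

section \<open>Matrix analysis: spectral theorem, positivity and an operator version of Riesz
  decomposition\<close>

section \<open>Adjoints and quadratic forms\<close>

text \<open>The obstacle is noncommutativity: an operator below S + D need not be a sum of positive
  parts below S and below D, and the split has to be repeated after every use, on inputs produced by
  earlier splits. It is therefore made for one operator at a time, never for the channel itself, and
  only up to factors of 2. The total price is at most 16^n, whatever the strategy and whatever m.
  Since it is to be compared with exponents of order m n, a large but fixed m makes it harmless. One
  m from the subsequence is enough, so the decay finally obtained holds for all large n.

  Domination by L F is indispensable for a second reason: a B-step, though of small trace, has no
  other bound in terms of F, and a history containing one could not be compared with the Type-II
  error. With domination it costs L^m in place of 2^(m l). This is affordable for a small fraction
  \<epsilon> of the n uses, where the gap between the Type-II rate and l pays for it; beyond that
  fraction the traces alone give 2^(-c m \<epsilon> n). The rate of the strong converse comes from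
  balancing the two.\<close>

lemma mat_adjoint_dim [simp]:
  "dim_row (mat_adjoint A) = dim_col A" "dim_col (mat_adjoint A) = dim_row A"
  by (auto simp: mat_adjoint_def)

lemma mat_adjoint_carrier [simp, intro]:
  "A \<in> carrier_mat m n \<Longrightarrow> mat_adjoint A \<in> carrier_mat n m"
  by auto

lemma mat_adjoint_index [simp]:
  fixes A :: "complex mat"
  shows "i < dim_col A \<Longrightarrow> j < dim_row A \<Longrightarrow> mat_adjoint A $$ (i, j) = cnj (A $$ (j, i))"
  by (auto simp: mat_adjoint_def mat_of_rows_index)

lemma mat_adjoint_adjoint [simp]: "mat_adjoint (mat_adjoint A) = (A :: complex mat)"
  by (rule eq_matI) auto

lemma mat_adjoint_one [simp]: "mat_adjoint (1\<^sub>m n) = (1\<^sub>m n :: complex mat)"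
  by (rule eq_matI) auto

lemma mat_adjoint_add:
  fixes A :: "complex mat"
  assumes "A \<in> carrier_mat m n" "B \<in> carrier_mat m n"
  shows "mat_adjoint (A + B) = mat_adjoint A + mat_adjoint B"
  using assms by (intro eq_matI) auto

lemma mat_adjoint_minus:
  fixes A :: "complex mat"
  assumes "A \<in> carrier_mat m n" "B \<in> carrier_mat m n"
  shows "mat_adjoint (A - B) = mat_adjoint A - mat_adjoint B"
  using assms by (intro eq_matI) auto

lemma mat_adjoint_smult: "mat_adjoint (c \<cdot>\<^sub>m A) = cnj c \<cdot>\<^sub>m mat_adjoint (A :: complex mat)"
  by (rule eq_matI) auto

lemma mat_adjoint_mult:
  fixes A :: "complex mat"
  assumes "A \<in> carrier_mat m n" "B \<in> carrier_mat n k"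
  shows "mat_adjoint (A * B) = mat_adjoint B * mat_adjoint A"
  using assms by (intro eq_matI) (auto simp: scalar_prod_def mult.commute intro!: sum.cong)

text \<open>Unlike \<open>assoc_mult_mat\<close>, whose inner dimensions are schematic, this form is a reliable
  rewrite rule.\<close>

lemma assoc_mult_mat_dim:
  fixes A :: "complex mat"
  assumes "dim_col A = dim_row B" "dim_col B = dim_row C"
  shows "A * B * C = A * (B * C)"
  using assms by (intro assoc_mult_mat) auto

lemma mat_adjoint_mult_dim:
  fixes A :: "complex mat"
  shows "dim_col A = dim_row B \<Longrightarrow> mat_adjoint (A * B) = mat_adjoint B * mat_adjoint A"
  by (intro mat_adjoint_mult) auto

lemmas mat_assoc = assoc_mult_mat_dim mat_adjoint_mult_dim mat_adjoint_adjoint mat_adjoint_dim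
  index_mult_mat(2,3)

lemma mat_adjoint_diag:
  "mat_adjoint (mat_diag n (\<lambda>i. complex_of_real (l i))) = mat_diag n (\<lambda>i. complex_of_real (l i))"
  by (rule eq_matI) (auto simp: mat_diag_def)

lemma cscalar_adjoint:
  fixes A :: "complex mat"
  assumes "A \<in> carrier_mat m n" "v \<in> carrier_vec n" "w \<in> carrier_vec m"
  shows "(A *\<^sub>v v) \<bullet>c w = v \<bullet>c (mat_adjoint A *\<^sub>v w)"
proof -
  have "(A *\<^sub>v v) \<bullet>c w = (\<Sum>i<m. \<Sum>j<n. A $$ (i, j) * v $ j * cnj (w $ i))"
    using assms by (auto simp: scalar_prod_def sum_distrib_right atLeast0LessThan intro!: sum.cong)
  also have "\<dots> = (\<Sum>j<n. \<Sum>i<m. A $$ (i, j) * v $ j * cnj (w $ i))"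
    by (rule sum.swap)
  also have "\<dots> = v \<bullet>c (mat_adjoint A *\<^sub>v w)"
    using assms by (auto simp: scalar_prod_def sum_distrib_left atLeast0LessThan mult_ac
        intro!: sum.cong)
  finally show ?thesis .
qed

lemma cscalar_commute:
  fixes v w :: "complex vec"
  assumes "v \<in> carrier_vec n" "w \<in> carrier_vec n"
  shows "w \<bullet>c v = cnj (v \<bullet>c w)"
  using assms by (auto simp: scalar_prod_def mult.commute intro!: sum.cong)

lemma cscalar_self_ge_0: "0 \<le> v \<bullet>c (v :: complex vec)"
  by (auto simp: scalar_prod_def less_eq_complex_def intro!: sum_nonneg add_nonneg_nonneg)

lemma cscalar_add_left:
  fixes u :: "complex vec"
  assumes "u \<in> carrier_vec n" "v \<in> carrier_vec n" "w \<in> carrier_vec n"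
  shows "(u + v) \<bullet>c w = u \<bullet>c w + v \<bullet>c w"
  using assms by (simp add: add_scalar_prod_distrib[of _ n])

lemma cscalar_minus_left:
  fixes u :: "complex vec"
  assumes "u \<in> carrier_vec n" "v \<in> carrier_vec n" "w \<in> carrier_vec n"
  shows "(u - v) \<bullet>c w = u \<bullet>c w - v \<bullet>c w"
  using assms by (simp add: minus_scalar_prod_distrib[of _ n])

lemma cscalar_smult_left:
  fixes u :: "complex vec"
  assumes "u \<in> carrier_vec n" "w \<in> carrier_vec n"
  shows "(c \<cdot>\<^sub>v u) \<bullet>c w = c * (u \<bullet>c w)"
  using assms by simp

lemma cscalar_add_right:
  fixes u :: "complex vec"
  assumes "u \<in> carrier_vec n" "v \<in> carrier_vec n" "w \<in> carrier_vec n"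
  shows "w \<bullet>c (u + v) = w \<bullet>c u + w \<bullet>c v"
  using assms by (simp add: scalar_prod_def distrib_left sum.distrib)

lemma cscalar_minus_right:
  fixes u :: "complex vec"
  assumes "u \<in> carrier_vec n" "v \<in> carrier_vec n" "w \<in> carrier_vec n"
  shows "w \<bullet>c (u - v) = w \<bullet>c u - w \<bullet>c v"
  using assms by (simp add: scalar_prod_def right_diff_distrib sum_subtractf)

lemma cscalar_smult_right:
  fixes u :: "complex vec"
  assumes "u \<in> carrier_vec n" "w \<in> carrier_vec n"
  shows "w \<bullet>c (c \<cdot>\<^sub>v u) = cnj c * (w \<bullet>c u)"
  using assms by (simp add: scalar_prod_def sum_distrib_left mult_ac)

lemma cscalar_unit:
  fixes A :: "complex mat"
  assumes "A \<in> carrier_mat m n" "i < m" "j < n"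
  shows "(A *\<^sub>v unit_vec n j) \<bullet>c unit_vec m i = A $$ (i, j)"
proof -
  have "conjugate (unit_vec m i) = (unit_vec m i :: complex vec)"
    by (rule eq_vecI) (auto simp: unit_vec_def)
  moreover have "A *\<^sub>v unit_vec n j \<in> carrier_vec m" using assms by simp
  ultimately show ?thesis using assms by simp
qed

lemma smult_mult_mat_vec:
  fixes A :: "complex mat"
  assumes "A \<in> carrier_mat m n" "v \<in> carrier_vec n"
  shows "(c \<cdot>\<^sub>m A) *\<^sub>v v = c \<cdot>\<^sub>v (A *\<^sub>v v)"
  using assms by (intro eq_vecI) (auto simp: scalar_prod_def sum_distrib_left mult.assoc)

lemma minus_mult_mat_vec:
  fixes A :: "complex mat"
  assumes "A \<in> carrier_mat m n" "B \<in> carrier_mat m n" "v \<in> carrier_vec n"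
  shows "(A - B) *\<^sub>v v = A *\<^sub>v v - B *\<^sub>v v"
  using assms
  by (intro eq_vecI) (auto simp: scalar_prod_def left_diff_distrib sum_subtractf)

lemma minus_mult_mat_vec_right:
  fixes A :: "complex mat"
  assumes "A \<in> carrier_mat m n" "u \<in> carrier_vec n" "v \<in> carrier_vec n"
  shows "A *\<^sub>v (u - v) = A *\<^sub>v u - A *\<^sub>v v"
  using assms
  by (intro eq_vecI) (auto simp: scalar_prod_def right_diff_distrib sum_subtractf)

section \<open>The spectral theorem\<close>

lemma unitaryI:
  assumes "U \<in> carrier_mat d d" "mat_adjoint U * U = 1\<^sub>m d"
  shows "unitary d U"
  using assms mat_mult_left_right_inverse[of "mat_adjoint U" d U] by (auto simp: unitary_def)

lemma unitary_mult:
  assumes "unitary d U" "unitary d V"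
  shows "unitary d (U * V)"
proof (rule unitaryI)
  have c: "U \<in> carrier_mat d d" "V \<in> carrier_mat d d"
    using assms by (auto simp: unitary_def)
  show "U * V \<in> carrier_mat d d" using c by simp
  have "mat_adjoint (U * V) * (U * V) = mat_adjoint V * ((mat_adjoint U * U) * V)"
    using c by (simp add: mat_adjoint_mult[OF c] assoc_mult_mat[of _ d d _ d _ d])
  also have "\<dots> = 1\<^sub>m d" using assms c by (simp add: unitary_def del: assoc_mult_mat)
  finally show "mat_adjoint (U * V) * (U * V) = 1\<^sub>m d" .
qed

lemma unitary_col_cscalar:
  fixes U :: "complex mat"
  assumes "U \<in> carrier_mat d d"
    and "\<And>i j. i < d \<Longrightarrow> j < d \<Longrightarrow> col U i \<bullet>c col U j = (if i = j then 1 else 0)"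
  shows "unitary d U"
proof (rule unitaryI[OF assms(1)], rule eq_matI)
  fix i j assume "i < dim_row (1\<^sub>m d :: complex mat)" "j < dim_col (1\<^sub>m d :: complex mat)"
  hence ij: "i < d" "j < d" by auto
  have "(mat_adjoint U * U) $$ (i, j) = (\<Sum>k<d. cnj (U $$ (k, i)) * U $$ (k, j))"
    using assms(1) ij by (auto simp: scalar_prod_def atLeast0LessThan)
  also have "\<dots> = col U j \<bullet>c col U i"
    using assms(1) ij by (auto simp: scalar_prod_def atLeast0LessThan mult.commute)
  also have "\<dots> = (1\<^sub>m d :: complex mat) $$ (i, j)" using assms(2)[of j i] ij by auto
  finally show "(mat_adjoint U * U) $$ (i, j) = 1\<^sub>m d $$ (i, j)" .
qed (use assms in auto)

text \<open>Gram-Schmidt applied to a basis beginning with \<open>v\<close> keeps \<open>v\<close>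
  as its first vector and yields orthogonal vectors of arbitrary length. The factors
  \<open>s i\<close> normalise them, so the first column is only a multiple of
  \<open>v\<close>.\<close>

lemma unitary_extend:
  fixes v :: "complex vec"
  assumes v: "v \<in> carrier_vec n" "v \<noteq> 0\<^sub>v n"
  shows "\<exists>W c. unitary n W \<and> col W 0 = c \<cdot>\<^sub>v v"
proof -
  interpret cof_vec_space n "TYPE(complex)" .
  define ws where "ws = gram_schmidt n (basis_completion v)"
  note b = basis_completion[OF v]
  have ws: "set ws \<subseteq> carrier_vec n" "corthogonal ws" "length ws = n" "hd ws = v"
  proof -
    from gram_schmidt_result[OF b(2) b(4) b(5) ws_def] b(6)
    show "set ws \<subseteq> carrier_vec n" "corthogonal ws" "length ws = n" by auto
    show "hd ws = v"
      using b(2,7) v unfolding ws_def basis_completion_def Let_def by simp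
  qed
  have n0: "0 < n" using v by (cases n) auto
  define s where "s i = complex_of_real (1 / sqrt (Re (ws ! i \<bullet>c ws ! i)))" for i
  define W where "W = mat_of_cols n (map (\<lambda>i. s i \<cdot>\<^sub>v ws ! i) [0..<n])"
  have W: "W \<in> carrier_mat n n" by (simp add: W_def carrier_matI)
  have wsi: "i < n \<Longrightarrow> ws ! i \<in> carrier_vec n" for i using ws by auto
  have col: "i < n \<Longrightarrow> col W i = s i \<cdot>\<^sub>v ws ! i" for i
    using wsi[of i] by (simp add: W_def)
  have pos: "ws ! i \<bullet>c ws ! i = complex_of_real (Re (ws ! i \<bullet>c ws ! i)) \<and> 0 < Re (ws ! i \<bullet>c ws ! i)"
    if "i < n" for i
  proof -
    have "ws ! i \<bullet>c ws ! i \<noteq> 0" using ws(2,3) that by (auto simp: corthogonal_def)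
    moreover have "0 \<le> ws ! i \<bullet>c ws ! i" by (rule cscalar_self_ge_0)
    ultimately show ?thesis
      by (auto simp: less_eq_complex_def complex_eq_iff)
  qed
  have "unitary n W"
  proof (rule unitary_col_cscalar[OF W])
    fix i j assume ij: "i < n" "j < n"
    have e: "col W i \<bullet>c col W j = s i * (cnj (s j) * (ws ! i \<bullet>c ws ! j))"
      unfolding col[OF ij(1)] col[OF ij(2)] using wsi[OF ij(1)] wsi[OF ij(2)]
      by (simp only: cscalar_smult_right[of _ n] cscalar_smult_left[of _ n] smult_carrier_vec)
        (simp add: mult_ac)
    show "col W i \<bullet>c col W j = (if i = j then 1 else 0)"
    proof (cases "i = j")
      case True
      define x where "x = Re (ws ! i \<bullet>c ws ! i)"
      have x: "ws ! i \<bullet>c ws ! i = complex_of_real x" "0 < x" using pos[OF ij(1)] by (auto simp: x_def)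
      have "1 / sqrt x * (1 / sqrt x * x) = 1"
      proof -
        have "sqrt x * sqrt x = x" using x(2) by simp
        thus ?thesis using x(2) by (simp add: divide_simps)
      qed
      hence "complex_of_real (1 / sqrt x) * (complex_of_real (1 / sqrt x) * complex_of_real x) = 1"
        by (metis of_real_1 of_real_mult)
      moreover have "s i = complex_of_real (1 / sqrt x)" by (simp add: s_def x_def)
      ultimately have "s i * (cnj (s i) * (ws ! i \<bullet>c ws ! i)) = 1" unfolding x(1) by simp
      thus ?thesis using e True by simp
    next
      case False
      hence "ws ! i \<bullet>c ws ! j = 0" using ws ij by (auto simp: corthogonal_def)
      thus ?thesis using e False by simp
    qed
  qed
  moreover have "ws ! 0 = v" using ws(3,4) n0 by (cases ws) auto
  ultimately show ?thesis using col[OF n0] by auto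
qed

lemma unitary_carrier: "unitary d U \<Longrightarrow> U \<in> carrier_mat d d"
  by (simp add: unitary_def)

lemma unitary_adjoint: "unitary d U \<Longrightarrow> unitary d (mat_adjoint U)"
  by (auto simp: unitary_def)

lemma unitary_cancel:
  assumes "unitary d U" "X \<in> carrier_mat d n"
  shows "mat_adjoint U * (U * X) = X" "U * (mat_adjoint U * X) = X"
proof -
  have c: "U \<in> carrier_mat d d" using assms by (simp add: unitary_def)
  show "mat_adjoint U * (U * X) = X"
    using assms c by (subst assoc_mult_mat[symmetric, of _ d d _ d]) (auto simp: unitary_def)
  show "U * (mat_adjoint U * X) = X"
    using assms c by (subst assoc_mult_mat[symmetric, of _ d d _ d]) (auto simp: unitary_def)
qed

lemma unitary_conj_conj:
  assumes U: "unitary n U" and A: "A \<in> carrier_mat n n"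
  shows "A = U * (mat_adjoint U * A * U) * mat_adjoint U"
proof -
  have Uc: "U \<in> carrier_mat n n" and UU: "U * mat_adjoint U = 1\<^sub>m n"
    using U by (auto simp: unitary_def)
  have "U * (mat_adjoint U * A * U) * mat_adjoint U = U * (mat_adjoint U * (A * (U * mat_adjoint U)))"
    using carrier_matD[OF A] carrier_matD[OF Uc] by (simp only: mat_assoc)
  also have "\<dots> = A" unfolding UU right_mult_one_mat[OF A] by (rule unitary_cancel(2)[OF U A])
  finally show ?thesis by (rule sym)
qed

text \<open>Deflation: in a unitary basis whose first vector is an eigenvector, the first column is
  a multiple of the first basis vector, hermiticity gives the same for the first row, and the
  remaining block of size \<open>m\<close> is again Hermitian.\<close>

theorem hermitian_diagonalisation:
  fixes A :: "complex mat"
  assumes "A \<in> carrier_mat n n" "mat_adjoint A = A"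
  shows "\<exists>U l. unitary n U \<and> A = U * mat_diag n (\<lambda>i. complex_of_real (l i)) * mat_adjoint U"
  using assms
proof (induction n arbitrary: A)
  case 0
  show ?case
    by (intro exI[of _ "1\<^sub>m 0"] exI[of _ "\<lambda>_. 0"] conjI unitaryI eq_matI) (use 0 in auto)
next
  case (Suc m)
  let ?n = "Suc m"
  note A = Suc.prems(1) and herm = Suc.prems(2)
  obtain as where as: "char_poly A = (\<Prod>a\<leftarrow>as. [:- a, 1:])" "length as = ?n"
    using char_poly_factorized[OF A] by auto
  then obtain e bs where "as = e # bs" by (cases as) auto
  hence "poly (char_poly A) e = 0" using as by simp
  then obtain v where v: "v \<in> carrier_vec ?n" "v \<noteq> 0\<^sub>v ?n" "A *\<^sub>v v = e \<cdot>\<^sub>v v"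
    using eigenvalue_root_char_poly[OF A] A by (auto simp: eigenvalue_def eigenvector_def)
  obtain W c where W: "unitary ?n W" "col W 0 = c \<cdot>\<^sub>v v" using unitary_extend[OF v(1,2)] by auto
  have Wc: "W \<in> carrier_mat ?n ?n" using W by (simp add: unitary_def)
  define B where "B = mat_adjoint W * A * W"
  have B: "B \<in> carrier_mat ?n ?n" using A Wc by (intro carrier_matI) (auto simp: B_def)
  have BA: "A = W * B * mat_adjoint W"
    unfolding B_def by (rule unitary_conj_conj[OF W(1) A])
  have hB: "mat_adjoint B = B"
    unfolding B_def using carrier_matD[OF A] carrier_matD[OF Wc] by (simp only: mat_assoc herm)
  have hB': "B $$ (i, j) = cnj (B $$ (j, i))" if "i < ?n" "j < ?n" for i j
  proof -
    have "mat_adjoint B $$ (i, j) = cnj (B $$ (j, i))"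
      by (rule mat_adjoint_index) (use B that in auto)
    from this[unfolded hB] show ?thesis .
  qed
  have cW: "col W 0 \<in> carrier_vec ?n" using Wc by (intro carrier_vecI) auto
  have "col B 0 = (mat_adjoint W * A) *\<^sub>v col W 0"
    unfolding B_def by (rule col_mult2[OF mult_carrier_mat[OF mat_adjoint_carrier[OF Wc] A] Wc]) simp
  also have "\<dots> = mat_adjoint W *\<^sub>v (c \<cdot>\<^sub>v (e \<cdot>\<^sub>v v))"
    using assoc_mult_mat_vec[OF mat_adjoint_carrier[OF Wc] A, of "col W 0"] Wc
    by (simp add: W(2) mult_mat_vec[OF A v(1)] v)
  also have "c \<cdot>\<^sub>v (e \<cdot>\<^sub>v v) = e \<cdot>\<^sub>v col W 0" using W(2) by (simp add: smult_smult_assoc mult.commute)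
  also have "mat_adjoint W *\<^sub>v (e \<cdot>\<^sub>v col W 0) = e \<cdot>\<^sub>v col (mat_adjoint W * W) 0"
    using mult_mat_vec[OF mat_adjoint_carrier[OF Wc] cW, of e]
      col_mult2[OF mat_adjoint_carrier[OF Wc] Wc, of 0] Wc by simp
  also have "\<dots> = e \<cdot>\<^sub>v unit_vec ?n 0" using W by (simp add: unitary_def)
  finally have colB: "col B 0 = e \<cdot>\<^sub>v unit_vec ?n 0" .
  have B0: "B $$ (i, 0) = (if i = 0 then e else 0)" if "i < ?n" for i
    using arg_cong[OF colB, of "\<lambda>x. x $ i"] that B by (simp add: unit_vec_def)
  have B0': "B $$ (0, j) = (if j = 0 then cnj e else 0)" if "j < ?n" for j
  proof -
    have "B $$ (0, j) = cnj (B $$ (j, 0))" by (rule hB') (use that in auto)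
    also have "\<dots> = (if j = 0 then cnj e else 0)" by (simp add: B0[OF that])
    finally show ?thesis .
  qed
  \<comment> \<open>The corner entry is read off from both the first column and the first row, so
    the eigenvalue is real.\<close>
  have "cnj e = e" using B0[of 0] B0'[of 0] by simp
  then obtain r where r: "e = complex_of_real r" by (metis Reals_cnj_iff Reals_cases)
  define B' where "B' = mat m m (\<lambda>(i, j). B $$ (Suc i, Suc j))"
  have B': "B' \<in> carrier_mat m m" by (simp add: B'_def)
  have "mat_adjoint B' = B'"
  proof (rule eq_matI)
    fix i j assume "i < dim_row B'" "j < dim_col B'"
    hence "i < m" "j < m" by (auto simp: B'_def)
    thus "mat_adjoint B' $$ (i, j) = B' $$ (i, j)"
      by (simp add: B'_def hB'[of "Suc i" "Suc j"])
  qed (auto simp: B'_def)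
  from Suc.IH[OF B' this] obtain U l where
    U: "unitary m U" "B' = U * mat_diag m (\<lambda>i. complex_of_real (l i)) * mat_adjoint U"
    by auto
  have Uc: "U \<in> carrier_mat m m" using U by (simp add: unitary_def)
  define l' where "l' i = (case i of 0 \<Rightarrow> r | Suc j \<Rightarrow> l j)" for i
  let ?fb = "\<lambda>a X. four_block_mat (a :: complex mat) (0\<^sub>m 1 m) (0\<^sub>m m 1) X"
  have adj: "mat_adjoint (?fb (1\<^sub>m 1) U) = ?fb (1\<^sub>m 1) (mat_adjoint U)"
    using Uc by (intro eq_matI) auto
  have mul: "?fb a X * ?fb b Y = ?fb (a * b) (X * Y)"
    if "a \<in> carrier_mat 1 1" "b \<in> carrier_mat 1 1" "X \<in> carrier_mat m m" "Y \<in> carrier_mat m m"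
    for a b X Y
    using that by (subst mult_four_block_mat[of _ 1 1 _ m _ m _ _ 1 _ m]) auto
  let ?e = "mat 1 1 (\<lambda>_. e)"
  have D: "mat_diag ?n (\<lambda>i. complex_of_real (l' i)) = ?fb ?e (mat_diag m (\<lambda>i. complex_of_real (l i)))"
    by (rule eq_matI) (auto simp: mat_diag_def l'_def r split: nat.splits)
  have Bfb: "B = ?fb ?e B'"
    using B by (intro eq_matI) (auto simp: B0 B0' B'_def \<open>cnj e = e\<close>)
  have uV: "unitary ?n (?fb (1\<^sub>m 1) U)"
  proof (rule unitaryI)
    show "?fb (1\<^sub>m 1) U \<in> carrier_mat ?n ?n" using Uc by auto
    show "mat_adjoint (?fb (1\<^sub>m 1) U) * ?fb (1\<^sub>m 1) U = 1\<^sub>m ?n"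
    proof -
      have UU: "mat_adjoint U * U = 1\<^sub>m m" using U(1) by (simp add: unitary_def)
      show ?thesis
        unfolding adj mul[OF one_carrier_mat one_carrier_mat mat_adjoint_carrier[OF Uc] Uc] UU
        by (rule eq_matI) auto
    qed
  qed
  define V where "V = ?fb (1\<^sub>m 1) U"
  define D where "D = mat_diag ?n (\<lambda>i. complex_of_real (l' i))"
  have V: "V \<in> carrier_mat ?n ?n" and Dc: "D \<in> carrier_mat ?n ?n"
    using Uc by (auto simp: V_def D_def)
  have e1: "?e \<in> carrier_mat 1 1" by simp
  have "V * D * mat_adjoint V = ?fb (1\<^sub>m 1 * ?e * 1\<^sub>m 1) (U * mat_diag m (\<lambda>i. complex_of_real (l i)) * mat_adjoint U)"
    unfolding V_def D_def adj D mul[OF one_carrier_mat e1 Uc mat_diag_dim]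
    by (rule mul[OF mult_carrier_mat[OF one_carrier_mat e1] one_carrier_mat
          mult_carrier_mat[OF Uc mat_diag_dim] mat_adjoint_carrier[OF Uc]])
  also have "1\<^sub>m 1 * ?e * 1\<^sub>m 1 = ?e" by simp
  also have "?fb ?e (U * mat_diag m (\<lambda>i. complex_of_real (l i)) * mat_adjoint U) = B"
    unfolding U(2)[symmetric] Bfb ..
  finally have BV: "B = V * D * mat_adjoint V" by simp
  have "A = (W * V) * D * mat_adjoint (W * V)"
    unfolding BA BV using carrier_matD[OF Wc] carrier_matD[OF V] carrier_matD[OF Dc]
    by (simp only: mat_assoc)
  with unitary_mult[OF W(1)] uV show ?case unfolding V_def D_def by blast
qed

section \<open>Positive semidefinite matrices\<close>

text \<open>For a Hermitian matrix the form is real, so taking the real part loses nothing and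
  positivity becomes a linear inequality over the reals.\<close>

definition qform :: "complex mat \<Rightarrow> complex vec \<Rightarrow> real" where
  "qform X v = Re ((X *\<^sub>v v) \<bullet>c v)"

lemma qform_add:
  assumes "X \<in> carrier_mat d d" "Y \<in> carrier_mat d d" "v \<in> carrier_vec d"
  shows "qform (X + Y) v = qform X v + qform Y v"
  using assms by (simp add: qform_def add_mult_distrib_mat_vec[of _ d d] cscalar_add_left[of _ d])

lemma qform_minus:
  assumes "X \<in> carrier_mat d d" "Y \<in> carrier_mat d d" "v \<in> carrier_vec d"
  shows "qform (X - Y) v = qform X v - qform Y v"
  using assms by (simp add: qform_def minus_mult_mat_vec[of _ d d] cscalar_minus_left[of _ d])

lemma qform_smult:
  assumes "X \<in> carrier_mat d d" "v \<in> carrier_vec d"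
  shows "qform (complex_of_real c \<cdot>\<^sub>m X) v = c * qform X v"
  using assms by (simp add: qform_def smult_mult_mat_vec[of _ d d])

lemma qform_conj:
  assumes "X \<in> carrier_mat d d" "K \<in> carrier_mat n d" "v \<in> carrier_vec n"
  shows "qform (K * X * mat_adjoint K) v = qform X (mat_adjoint K *\<^sub>v v)"
proof -
  let ?w = "mat_adjoint K *\<^sub>v v"
  have w: "?w \<in> carrier_vec d" using assms by (intro carrier_vecI) auto
  have Xw: "X *\<^sub>v ?w \<in> carrier_vec d" using assms by (intro carrier_vecI) auto
  have "(K * X * mat_adjoint K) *\<^sub>v v = (K * X) *\<^sub>v ?w"
    by (rule assoc_mult_mat_vec[OF mult_carrier_mat[OF assms(2,1)] mat_adjoint_carrier[OF assms(2)]
          assms(3)])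
  also have "\<dots> = K *\<^sub>v (X *\<^sub>v ?w)" by (rule assoc_mult_mat_vec[OF assms(2,1) w])
  finally show ?thesis
    unfolding qform_def by (simp only: cscalar_adjoint[OF assms(2) Xw assms(3)])
qed

text \<open>For positive \<open>X\<close> either term on the left may be dropped; this is the origin
  of the factors 2 in the operator decomposition below.\<close>

lemma qform_parallelogram:
  assumes "X \<in> carrier_mat d d" "u \<in> carrier_vec d" "v \<in> carrier_vec d"
  shows "qform X (u + v) + qform X (u - v) = 2 * qform X u + 2 * qform X v"
proof -
  have c: "X *\<^sub>v u \<in> carrier_vec d" "X *\<^sub>v v \<in> carrier_vec d"
    using assms by (auto intro!: carrier_vecI)
  have "(X *\<^sub>v (u + v)) \<bullet>c (u + v) + (X *\<^sub>v (u - v)) \<bullet>c (u - v)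
      = 2 * ((X *\<^sub>v u) \<bullet>c u) + 2 * ((X *\<^sub>v v) \<bullet>c v)"
    unfolding mult_add_distrib_mat_vec[OF assms] minus_mult_mat_vec_right[OF assms]
    using assms c
    by (simp only: cscalar_add_left[of _ d] cscalar_minus_left[of _ d] cscalar_add_right[of _ d]
        cscalar_minus_right[of _ d] add_carrier_vec minus_carrier_vec) (simp add: algebra_simps)
  from arg_cong[OF this, of Re] show ?thesis by (simp add: qform_def)
qed

lemma qform_one: "v \<in> carrier_vec d \<Longrightarrow> qform (1\<^sub>m d) v = Re (v \<bullet>c v)"
  by (simp add: qform_def)

lemma qform_one_nonneg: "v \<in> carrier_vec d \<Longrightarrow> 0 \<le> qform (1\<^sub>m d) v"
  using cscalar_self_ge_0[of v] by (simp add: qform_one less_eq_complex_def)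

lemma hermitian_cscalar:
  assumes "X \<in> carrier_mat d d" "mat_adjoint X = X" "u \<in> carrier_vec d" "v \<in> carrier_vec d"
  shows "(X *\<^sub>v u) \<bullet>c v = cnj ((X *\<^sub>v v) \<bullet>c u)"
proof -
  have c: "X *\<^sub>v v \<in> carrier_vec d" using assms by (intro carrier_vecI) auto
  have "(X *\<^sub>v u) \<bullet>c v = u \<bullet>c (X *\<^sub>v v)"
    using cscalar_adjoint[OF assms(1,3,4)] by (simp add: assms(2))
  also have "\<dots> = cnj ((X *\<^sub>v v) \<bullet>c u)" by (rule cscalar_commute[OF c assms(3)])
  finally show ?thesis .
qed

text \<open>Polarisation: the form is real on \<open>e\<^sub>i + e\<^sub>j\<close> and on \<open>e\<^sub>i + \<i> e\<^sub>j\<close>.\<close>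

lemma psd_hermitian:
  assumes "psd d X"
  shows "mat_adjoint X = X"
proof -
  have X: "X \<in> carrier_mat d d" and re: "\<And>v. v \<in> carrier_vec d \<Longrightarrow> Im ((X *\<^sub>v v) \<bullet>c v) = 0"
    using assms by (auto simp: psd_def less_eq_complex_def)
  have entry: "X $$ (i, j) = cnj (X $$ (j, i))" if ij: "i < d" "j < d" for i j
  proof -
    let ?e = "\<lambda>i. unit_vec d i :: complex vec"
    have exp: "(X *\<^sub>v (?e i + c \<cdot>\<^sub>v ?e j)) \<bullet>c (?e i + c \<cdot>\<^sub>v ?e j)
      = X $$ (i, i) + cnj c * X $$ (j, i) + c * X $$ (i, j) + c * cnj c * X $$ (j, j)" for c
    proof -
      have cc: "X *\<^sub>v ?e i \<in> carrier_vec d" for i using X by (intro carrier_vecI) auto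
      have "X *\<^sub>v (?e i + c \<cdot>\<^sub>v ?e j) = X *\<^sub>v ?e i + c \<cdot>\<^sub>v (X *\<^sub>v ?e j)"
        using mult_add_distrib_mat_vec[OF X, of "?e i" "c \<cdot>\<^sub>v ?e j"] mult_mat_vec[OF X, of "?e j" c]
        by simp
      thus ?thesis
        using cc
        by (simp only: cscalar_add_left[of _ d] cscalar_add_right[of _ d] cscalar_smult_left[of _ d]
            cscalar_smult_right[of _ d] add_carrier_vec smult_carrier_vec unit_vec_carrier
            cscalar_unit[OF X] ij) (simp add: algebra_simps)
    qed
    have ii: "Im (X $$ (i, i)) = 0" if "i < d" for i
      using re[of "?e i"] cscalar_unit[OF X that that] by simp
    have "Im (X $$ (j, i) + X $$ (i, j)) = 0"
      using re[of "?e i + 1 \<cdot>\<^sub>v ?e j"] ii[OF ij(1)] ii[OF ij(2)] unfolding exp by simp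
    moreover have "Im (- \<i> * X $$ (j, i) + \<i> * X $$ (i, j)) = 0"
      using re[of "?e i + \<i> \<cdot>\<^sub>v ?e j"] ii[OF ij(1)] ii[OF ij(2)] unfolding exp by simp
    ultimately show ?thesis by (auto simp: complex_eq_iff)
  qed
  show ?thesis
  proof (rule eq_matI)
    fix i j assume "i < dim_row X" "j < dim_col X"
    hence ij: "i < d" "j < d" using X by auto
    have "mat_adjoint X $$ (i, j) = cnj (X $$ (j, i))"
      by (rule mat_adjoint_index) (use X ij in auto)
    also have "\<dots> = X $$ (i, j)" by (rule entry[OF ij, symmetric])
    finally show "mat_adjoint X $$ (i, j) = X $$ (i, j)" .
  qed (use X in auto)
qed

lemma psd_carrier: "psd d X \<Longrightarrow> X \<in> carrier_mat d d"
  by (simp add: psd_def)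

lemma psd_iff:
  "psd d X \<longleftrightarrow> X \<in> carrier_mat d d \<and> mat_adjoint X = X \<and> (\<forall>v\<in>carrier_vec d. 0 \<le> qform X v)"
    (is "_ = ?R")
proof
  assume "psd d X"
  thus ?R using psd_hermitian[of d X] by (auto simp: psd_def qform_def less_eq_complex_def)
next
  assume ?R
  hence X: "X \<in> carrier_mat d d" "mat_adjoint X = X" "\<And>v. v \<in> carrier_vec d \<Longrightarrow> 0 \<le> qform X v"
    by auto
  show "psd d X"
    unfolding psd_def
  proof (intro conjI ballI X)
    fix v :: "complex vec" assume v: "v \<in> carrier_vec d"
    have "Im ((X *\<^sub>v v) \<bullet>c v) = 0"
      using arg_cong[OF hermitian_cscalar[OF X(1,2) v v], of Im] by simp
    thus "0 \<le> (X *\<^sub>v v) \<bullet>c v" using X(3)[OF v] by (simp add: qform_def less_eq_complex_def)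
  qed
qed

lemma psd_qform: "psd d X \<Longrightarrow> v \<in> carrier_vec d \<Longrightarrow> 0 \<le> qform X v"
  by (simp add: psd_iff)

lemma psd_one: "psd d (1\<^sub>m d)"
  by (simp add: psd_iff qform_one_nonneg)

lemma psd_zero: "psd d (0\<^sub>m d d)"
proof -
  have "0\<^sub>m d d *\<^sub>v v = (0\<^sub>v d :: complex vec)" if "v \<in> carrier_vec d" for v
    using that by (intro eq_vecI) auto
  thus ?thesis by (auto simp: psd_iff qform_def)
qed

lemma psd_add: "psd d X \<Longrightarrow> psd d Y \<Longrightarrow> psd d (X + Y)"
  by (auto simp: psd_iff qform_add mat_adjoint_add[of _ d d])

lemma psd_smult: "psd d X \<Longrightarrow> 0 \<le> c \<Longrightarrow> psd d (complex_of_real c \<cdot>\<^sub>m X)"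
  by (auto simp: psd_iff qform_smult mat_adjoint_smult)

lemma psd_conj:
  assumes X: "psd d X" and K: "K \<in> carrier_mat n d"
  shows "psd n (K * X * mat_adjoint K)"
  unfolding psd_iff
proof (intro conjI ballI)
  note Xc = psd_carrier[OF X]
  show "K * X * mat_adjoint K \<in> carrier_mat n n" using K Xc by (intro carrier_matI) auto
  show "mat_adjoint (K * X * mat_adjoint K) = K * X * mat_adjoint K"
    using carrier_matD[OF K] carrier_matD[OF Xc] psd_hermitian[OF X] by (simp only: mat_assoc)
  show "0 \<le> qform (K * X * mat_adjoint K) v" if v: "v \<in> carrier_vec n" for v
    unfolding qform_conj[OF Xc K v]
    by (rule psd_qform[OF X]) (use K v in \<open>intro carrier_vecI; auto\<close>)
qed

lemma psd_gram:
  assumes "K \<in> carrier_mat n d"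
  shows "psd n (K * mat_adjoint K)"
  using psd_conj[OF psd_one assms] assms by simp

lemma diag_conj_index:
  fixes U :: "complex mat"
  assumes "U \<in> carrier_mat d n" "p < d" "q < d"
  shows "(U * mat_diag n f * mat_adjoint U) $$ (p, q) = (\<Sum>i<n. f i * (U $$ (p, i) * cnj (U $$ (q, i))))"
proof -
  have "U * mat_diag n f = mat d n (\<lambda>(i, j). U $$ (i, j) * f j)"
    by (rule mat_diag_mult_right[OF assms(1)])
  thus ?thesis
    using assms by (auto simp: scalar_prod_def atLeast0LessThan intro!: sum.cong)
qed

lemma psd_diag:
  assumes "\<And>i. i < d \<Longrightarrow> 0 \<le> l i"
  shows "psd d (mat_diag d (\<lambda>i. complex_of_real (l i)))"
proof -
  have "mat_diag d (\<lambda>i. complex_of_real (l i)) =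
      mat_diag d (\<lambda>i. complex_of_real (sqrt (l i))) * mat_adjoint (mat_diag d (\<lambda>i. complex_of_real (sqrt (l i))))"
    unfolding mat_adjoint_diag mat_diag_diag
    using assms by (intro eq_matI) (auto simp: mat_diag_def of_real_mult[symmetric] simp del: of_real_mult)
  thus ?thesis using psd_gram[OF mat_diag_dim] by metis
qed

lemma psd_diagonal_entry:
  assumes "psd d X" "i < d"
  shows "0 \<le> Re (X $$ (i, i))"
  using psd_qform[OF assms(1), of "unit_vec d i"] cscalar_unit[OF psd_carrier[OF assms(1)] assms(2,2)]
  by (simp add: qform_def)

lemma unitary_conj_diag:
  assumes U: "unitary d U" and D: "D \<in> carrier_mat d d"
  shows "mat_adjoint U * (U * D * mat_adjoint U) * U = D"
  using unitary_conj_conj[OF unitary_adjoint[OF U] D] by simp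

lemma psd_diagonalisation:
  assumes "psd d X"
  shows "\<exists>U l. unitary d U \<and> (\<forall>i<d. 0 \<le> l i) \<and>
    X = U * mat_diag d (\<lambda>i. complex_of_real (l i)) * mat_adjoint U"
proof -
  obtain U l where U: "unitary d U" "X = U * mat_diag d (\<lambda>i. complex_of_real (l i)) * mat_adjoint U"
    using hermitian_diagonalisation[OF psd_carrier[OF assms] psd_hermitian[OF assms]] by auto
  have "psd d (mat_adjoint U * X * mat_adjoint (mat_adjoint U))"
    by (rule psd_conj[OF assms]) (use U in \<open>auto simp: unitary_def\<close>)
  hence "psd d (mat_diag d (\<lambda>i. complex_of_real (l i)))"
    unfolding U(2) mat_adjoint_adjoint unitary_conj_diag[OF U(1) mat_diag_dim] .
  hence "0 \<le> l i" if "i < d" for i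
    using psd_diagonal_entry[of d _ i] that by (force simp: mat_diag_def)
  thus ?thesis using U by blast
qed

lemma psd_factor:
  assumes "psd d X"
  shows "\<exists>K\<in>carrier_mat d d. X = K * mat_adjoint K"
proof -
  obtain U l where U: "unitary d U" "\<forall>i<d. 0 \<le> l i"
      "X = U * mat_diag d (\<lambda>i. complex_of_real (l i)) * mat_adjoint U"
    using psd_diagonalisation[OF assms] by auto
  define R where "R = mat_diag d (\<lambda>i. complex_of_real (sqrt (l i)))"
  have R: "R \<in> carrier_mat d d" by (simp add: R_def)
  have Uc: "U \<in> carrier_mat d d" using U by (simp add: unitary_def)
  have "mat_diag d (\<lambda>i. complex_of_real (l i)) = R * mat_adjoint R"
    unfolding R_def mat_adjoint_diag mat_diag_diag
    using U(2) by (intro eq_matI) (auto simp: mat_diag_def of_real_mult[symmetric] simp del: of_real_mult)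
  hence "X = (U * R) * mat_adjoint (U * R)"
    unfolding U(3) using carrier_matD[OF Uc] carrier_matD[OF R] by (simp only: mat_assoc)
  thus ?thesis using Uc R by (intro bexI[of _ "U * R"]) auto
qed

section \<open>Trace\<close>

lemma mtrace_add:
  assumes "X \<in> carrier_mat d d" "Y \<in> carrier_mat d d"
  shows "mtrace (X + Y) = mtrace X + mtrace Y"
  using assms by (simp add: mtrace_def sum.distrib)

lemma mtrace_minus:
  assumes "X \<in> carrier_mat d d" "Y \<in> carrier_mat d d"
  shows "mtrace (X - Y) = mtrace X - mtrace Y"
  using assms by (simp add: mtrace_def sum_subtractf)

lemma mtrace_smult: "X \<in> carrier_mat d d \<Longrightarrow> mtrace (c \<cdot>\<^sub>m X) = c * mtrace X"
  by (simp add: mtrace_def sum_distrib_left)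

lemma mtrace_one: "mtrace (1\<^sub>m d) = of_nat d"
  by (simp add: mtrace_def)

lemma mtrace_mult_commute:
  assumes "A \<in> carrier_mat m n" "B \<in> carrier_mat n m"
  shows "mtrace (A * B) = mtrace (B * A)"
proof -
  have "mtrace (A * B) = (\<Sum>i<m. \<Sum>j<n. A $$ (i, j) * B $$ (j, i))"
    using assms by (auto simp: mtrace_def scalar_prod_def atLeast0LessThan intro!: sum.cong)
  also have "\<dots> = (\<Sum>j<n. \<Sum>i<m. A $$ (i, j) * B $$ (j, i))" by (rule sum.swap)
  also have "\<dots> = mtrace (B * A)"
    using assms by (auto simp: mtrace_def scalar_prod_def atLeast0LessThan mult.commute intro!: sum.cong)
  finally show ?thesis .
qed

lemma mtrace_unitary_conj:
  assumes "unitary d U" "X \<in> carrier_mat d d"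
  shows "mtrace (U * X * mat_adjoint U) = mtrace X"
proof -
  have c: "U \<in> carrier_mat d d" using assms by (simp add: unitary_def)
  have "mtrace (U * X * mat_adjoint U) = mtrace (mat_adjoint U * (U * X))"
    by (rule mtrace_mult_commute[of _ d d]) (use c assms in auto)
  thus ?thesis using unitary_cancel[OF assms] by simp
qed

lemma mtrace_conj_test:
  assumes "K \<in> carrier_mat m n" "X \<in> carrier_mat n n" "T \<in> carrier_mat m m"
  shows "mtrace (T * (K * X * mat_adjoint K)) = mtrace ((mat_adjoint K * T * K) * X)"
proof -
  have "mtrace (T * (K * X * mat_adjoint K)) = mtrace ((T * (K * X)) * mat_adjoint K)"
    using carrier_matD[OF assms(1)] carrier_matD[OF assms(2)] carrier_matD[OF assms(3)]
    by (simp only: mat_assoc)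
  also have "\<dots> = mtrace (mat_adjoint K * (T * (K * X)))"
    by (rule mtrace_mult_commute[of _ m n]) (use assms in auto)
  also have "mat_adjoint K * (T * (K * X)) = (mat_adjoint K * T * K) * X"
    using carrier_matD[OF assms(1)] carrier_matD[OF assms(2)] carrier_matD[OF assms(3)]
    by (simp only: mat_assoc)
  finally show ?thesis .
qed

lemma psd_mtrace:
  assumes "psd d X"
  shows "0 \<le> Re (mtrace X)" "Im (mtrace X) = 0"
proof -
  have X: "X \<in> carrier_mat d d" using assms by (rule psd_carrier)
  show "0 \<le> Re (mtrace X)"
    using psd_diagonal_entry[OF assms] X by (auto simp: mtrace_def intro!: sum_nonneg)
  have "Im (X $$ (i, i)) = 0" if "i < d" for i
    using hermitian_cscalar[OF X psd_hermitian[OF assms], of "unit_vec d i" "unit_vec d i"] cscalar_unit[OF X that that]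
    by (auto simp: complex_eq_iff)
  thus "Im (mtrace X) = 0" using X by (simp add: mtrace_def)
qed

text \<open>With \<open>T = K * mat_adjoint K\<close> the trace equals that of
  \<open>mat_adjoint K * X * K\<close>, which is positive.\<close>

lemma psd_mtrace_mult:
  assumes "psd d T" "psd d X"
  shows "0 \<le> Re (mtrace (T * X))" "Im (mtrace (T * X)) = 0"
proof -
  obtain K where K: "K \<in> carrier_mat d d" "T = K * mat_adjoint K" using psd_factor[OF assms(1)] by auto
  have X: "X \<in> carrier_mat d d" using assms(2) by (rule psd_carrier)
  have "mtrace (T * X) = mtrace (K * (mat_adjoint K * X))"
    unfolding K(2) using carrier_matD[OF K(1)] carrier_matD[OF X] by (simp only: mat_assoc)
  also have "\<dots> = mtrace (mat_adjoint K * X * mat_adjoint (mat_adjoint K))"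
    unfolding mat_adjoint_adjoint by (rule mtrace_mult_commute[of _ d d]) (use K X in auto)
  finally show "0 \<le> Re (mtrace (T * X))" "Im (mtrace (T * X)) = 0"
    using psd_mtrace[OF psd_conj[OF assms(2) mat_adjoint_carrier[OF K(1)]]] by simp_all
qed

lemma mtrace_test_minus:
  assumes "T \<in> carrier_mat d d" "X \<in> carrier_mat d d" "Y \<in> carrier_mat d d"
  shows "mtrace (T * (X - Y)) = mtrace (T * X) - mtrace (T * Y)"
  unfolding mult_minus_distrib_mat[OF assms]
  by (rule mtrace_minus[of _ d]) (use assms in auto)

lemma mtrace_test_add:
  assumes "T \<in> carrier_mat d d" "X \<in> carrier_mat d d" "Y \<in> carrier_mat d d"
  shows "mtrace (T * (X + Y)) = mtrace (T * X) + mtrace (T * Y)"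
  unfolding mult_add_distrib_mat[OF assms]
  by (rule mtrace_add[of _ d]) (use assms in auto)

lemma mtrace_test_smult:
  assumes "T \<in> carrier_mat d d" "X \<in> carrier_mat d d"
  shows "mtrace (T * (c \<cdot>\<^sub>m X)) = c * mtrace (T * X)"
  unfolding mult_smult_distrib[OF assms]
  by (rule mtrace_smult[of _ d]) (use assms in auto)

lemma mtrace_test_mono:
  assumes "psd d T" "psd d (Y - X)" "X \<in> carrier_mat d d" "Y \<in> carrier_mat d d"
  shows "Re (mtrace (T * X)) \<le> Re (mtrace (T * Y))"
  using psd_mtrace_mult(1)[OF assms(1,2)] mtrace_test_minus[OF psd_carrier[OF assms(1)] assms(4,3)] by simp

lemma mtrace_mono:
  assumes "psd d (Y - X)" "X \<in> carrier_mat d d" "Y \<in> carrier_mat d d"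
  shows "Re (mtrace X) \<le> Re (mtrace Y)"
  using psd_mtrace(1)[OF assms(1)] mtrace_minus[OF assms(3,2)] by simp

lemma testsD: "T \<in> tests d \<Longrightarrow> psd d T" "T \<in> tests d \<Longrightarrow> psd d (1\<^sub>m d - T)"
  "T \<in> tests d \<Longrightarrow> T \<in> carrier_mat d d"
  by (auto simp: tests_def psd_carrier)

lemma mtrace_test_le:
  assumes "T \<in> tests d" "psd d X"
  shows "Re (mtrace (T * X)) \<le> Re (mtrace X)"
proof -
  have X: "X \<in> carrier_mat d d" using assms(2) by (rule psd_carrier)
  note T = testsD(3)[OF assms(1)]
  have "(1\<^sub>m d - T) * X = X - T * X"
    using minus_mult_distrib_mat[OF one_carrier_mat T X] X by simp
  hence "mtrace ((1\<^sub>m d - T) * X) = mtrace X - mtrace (T * X)"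
    using mtrace_minus[OF X, of "T * X"] T X by simp
  thus ?thesis using psd_mtrace_mult(1)[OF testsD(2)[OF assms(1)] assms(2)] by simp
qed

section \<open>Rank-one matrices\<close>

definition rank1 :: "complex vec \<Rightarrow> complex mat" where
  "rank1 v = mat (dim_vec v) (dim_vec v) (\<lambda>(i, j). v $ i * cnj (v $ j))"

definition col_mat :: "complex vec \<Rightarrow> complex mat" where
  "col_mat v = mat (dim_vec v) 1 (\<lambda>(i, j). v $ i)"

lemma col_mat_carrier: "v \<in> carrier_vec d \<Longrightarrow> col_mat v \<in> carrier_mat d 1"
  by (simp add: col_mat_def)

lemma rank1_carrier: "v \<in> carrier_vec d \<Longrightarrow> rank1 v \<in> carrier_mat d d"
  by (simp add: rank1_def)

lemma rank1_col_mat: "rank1 v = col_mat v * mat_adjoint (col_mat v)"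
  by (rule eq_matI) (auto simp: rank1_def col_mat_def scalar_prod_def)

lemma col_mat_mult:
  assumes "K \<in> carrier_mat m n" "v \<in> carrier_vec n"
  shows "col_mat (K *\<^sub>v v) = K * col_mat v"
  using assms by (intro eq_matI) (auto simp: col_mat_def scalar_prod_def)

lemma rank1_conj:
  assumes "K \<in> carrier_mat m n" "v \<in> carrier_vec n"
  shows "K * rank1 v * mat_adjoint K = rank1 (K *\<^sub>v v)"
  unfolding rank1_col_mat col_mat_mult[OF assms]
  using carrier_matD[OF assms(1)] carrier_matD[OF col_mat_carrier[OF assms(2)]]
  by (simp only: mat_assoc)

lemma psd_rank1: "v \<in> carrier_vec d \<Longrightarrow> psd d (rank1 v)"
  unfolding rank1_col_mat by (rule psd_gram[OF col_mat_carrier])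

text \<open>The spectral decomposition writes \<open>X\<close> as a combination of rank-one matrices
  with nonnegative weights. The truncations \<open>Y k\<close> take the place of a finite sum of
  matrices. Only real scalars are required of \<open>g\<close>, so that real parts of linear
  functionals qualify.\<close>

lemma psd_rank1_induct:
  fixes g :: "complex mat \<Rightarrow> real"
  assumes add: "\<And>X Y. X \<in> carrier_mat d d \<Longrightarrow> Y \<in> carrier_mat d d \<Longrightarrow> g (X + Y) = g X + g Y"
    and smult: "\<And>X c. X \<in> carrier_mat d d \<Longrightarrow> g (complex_of_real c \<cdot>\<^sub>m X) = c * g X"
    and rank1: "\<And>v. v \<in> carrier_vec d \<Longrightarrow> 0 \<le> g (rank1 v)"
    and X: "psd d X"
  shows "0 \<le> g X"
proof -
  obtain U l where U: "unitary d U" "\<forall>i<d. 0 \<le> l i"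
      "X = U * mat_diag d (\<lambda>i. complex_of_real (l i)) * mat_adjoint U"
    using psd_diagonalisation[OF X] by auto
  have Uc: "U \<in> carrier_mat d d" using U by (simp add: unitary_def)
  define Y where "Y k = U * mat_diag d (\<lambda>i. if i < k then complex_of_real (l i) else 0) * mat_adjoint U" for k
  have Yc: "Y k \<in> carrier_mat d d" for k
    using Uc by (intro carrier_matI) (auto simp: Y_def)
  have "0 \<le> g (Y k)" if "k \<le> d" for k
    using that
  proof (induction k)
    case 0
    have "Y 0 = complex_of_real 0 \<cdot>\<^sub>m 0\<^sub>m d d"
      using Yc[of 0] by (intro eq_matI) (auto simp: Y_def diag_conj_index[OF Uc])
    thus ?case using smult[of "0\<^sub>m d d" 0] by simp
  next
    case (Suc k)
    have k: "k < d" using Suc.prems by simp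
    have cU: "col U k \<in> carrier_vec d" using Uc by (intro carrier_vecI) auto
    have "Y (Suc k) = Y k + complex_of_real (l k) \<cdot>\<^sub>m rank1 (col U k)"
    proof (rule eq_matI)
      fix p q assume "p < dim_row (Y k + complex_of_real (l k) \<cdot>\<^sub>m rank1 (col U k))"
        "q < dim_col (Y k + complex_of_real (l k) \<cdot>\<^sub>m rank1 (col U k))"
      hence pq: "p < d" "q < d" using Uc by (auto simp: rank1_def)
      let ?t = "\<lambda>i. U $$ (p, i) * cnj (U $$ (q, i))"
      have "Y (Suc k) $$ (p, q) = (\<Sum>i<d. (if i < Suc k then complex_of_real (l i) else 0) * ?t i)"
        unfolding Y_def by (rule diag_conj_index[OF Uc pq])
      also have "\<dots> = (\<Sum>i<d. (if i < k then complex_of_real (l i) else 0) * ?t i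
          + (if i = k then complex_of_real (l k) * ?t k else 0))"
        by (rule sum.cong) (auto simp: less_Suc_eq)
      also have "\<dots> = Y k $$ (p, q) + complex_of_real (l k) * ?t k"
        unfolding Y_def diag_conj_index[OF Uc pq] using k by (simp add: sum.distrib)
      finally show "Y (Suc k) $$ (p, q) = (Y k + complex_of_real (l k) \<cdot>\<^sub>m rank1 (col U k)) $$ (p, q)"
        using pq Uc k Yc[of k] by (simp add: rank1_def)
    qed (use Yc[of "Suc k"] Uc in \<open>auto simp: rank1_def\<close>)
    hence "g (Y (Suc k)) = g (Y k) + l k * g (rank1 (col U k))"
      using add[OF Yc smult_carrier_mat[OF rank1_carrier[OF cU]]] smult[OF rank1_carrier[OF cU]]
      by simp
    thus ?case using Suc U(2) rank1[OF cU] k by simp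
  qed
  moreover have "Y d = X"
    unfolding Y_def U(3) by (rule arg_cong[of _ _ "\<lambda>D. U * D * mat_adjoint U"], rule eq_matI)
      (auto simp: mat_diag_def)
  ultimately show ?thesis by (metis order_refl)
qed

section \<open>Positive parts and a Riesz-type decomposition\<close>

text \<open>\<open>D\<close> is the positive part of \<open>X\<close> and \<open>T\<close> the
  projection onto its positive eigenspaces, the Neyman-Pearson test. This turns an inequality valid
  for all tests into a bound on the trace of a positive operator.\<close>

lemma positive_part:
  assumes "X \<in> carrier_mat d d" "mat_adjoint X = X"
  shows "\<exists>D T. psd d D \<and> T \<in> tests d \<and> psd d (D - X) \<and> mtrace D = mtrace (T * X)"
proof -
  obtain U l where U: "unitary d U" "X = U * mat_diag d (\<lambda>i. complex_of_real (l i)) * mat_adjoint U"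
    using hermitian_diagonalisation[OF assms] by auto
  have Uc: "U \<in> carrier_mat d d" using U by (simp add: unitary_def)
  define C where "C f = U * mat_diag d (\<lambda>i. complex_of_real (f i)) * mat_adjoint U" for f
  have Cc: "C f \<in> carrier_mat d d" for f using Uc by (intro carrier_matI) (auto simp: C_def)
  have Cpsd: "psd d (C f)" if "\<And>i. 0 \<le> f i" for f
    unfolding C_def by (rule psd_conj[OF psd_diag Uc]) (use that in auto)
  have Cmin: "C f - C g = C (\<lambda>i. f i - g i)" for f g
  proof (rule eq_matI)
    fix p q assume "p < dim_row (C (\<lambda>i. f i - g i))" "q < dim_col (C (\<lambda>i. f i - g i))"
    hence pq: "p < d" "q < d" using Cc[of "\<lambda>i. f i - g i"] by auto
    have "(C f - C g) $$ (p, q) = C f $$ (p, q) - C g $$ (p, q)"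
      using pq Cc[of g] by simp
    also have "\<dots> = C (\<lambda>i. f i - g i) $$ (p, q)"
      unfolding C_def diag_conj_index[OF Uc pq] by (simp add: sum_subtractf left_diff_distrib)
    finally show "(C f - C g) $$ (p, q) = C (\<lambda>i. f i - g i) $$ (p, q)" .
  qed (simp_all only: minus_carrier_mat carrier_matD[OF Cc] index_minus_mat)
  have Cmul: "C f * C g = C (\<lambda>i. f i * g i)" for f g
  proof -
    let ?D = "\<lambda>f. mat_diag d (\<lambda>i. complex_of_real (f i))"
    have c: "dim_row (?D f) = d" "dim_col (?D f) = d" for f by (auto simp: mat_diag_def)
    have "C f * C g = U * (?D f * (mat_adjoint U * (U * (?D g * mat_adjoint U))))"
      unfolding C_def using carrier_matD[OF Uc] by (simp only: mat_assoc c)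
    also have "mat_adjoint U * (U * (?D g * mat_adjoint U)) = ?D g * mat_adjoint U"
      by (rule unitary_cancel(1)[OF U(1) mult_carrier_mat[OF mat_diag_dim mat_adjoint_carrier[OF Uc]]])
    also have "U * (?D f * (?D g * mat_adjoint U)) = U * (?D f * ?D g) * mat_adjoint U"
      using carrier_matD[OF Uc] by (simp only: mat_assoc c)
    finally show ?thesis by (simp add: C_def)
  qed
  have C1: "C (\<lambda>i. 1) = 1\<^sub>m d" using U(1) Uc by (simp add: C_def unitary_def)
  have X: "X = C l" by (simp add: C_def U(2))
  let ?D = "C (\<lambda>i. max 0 (l i))" and ?T = "C (\<lambda>i. if 0 < l i then 1 else 0)"
  have "?T * X = ?D"
    unfolding X Cmul by (rule arg_cong[of _ _ C]) auto
  moreover have "psd d (1\<^sub>m d - ?T)" unfolding C1[symmetric] Cmin by (rule Cpsd) auto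
  moreover have "psd d ?T" "psd d ?D" by (rule Cpsd, simp)+
  moreover have "psd d (?D - X)" unfolding X Cmin by (rule Cpsd) auto
  ultimately show ?thesis by (intro exI[of _ ?D] exI[of _ ?T]) (auto simp: tests_def)
qed

lemma pos_def_inverse:
  assumes "psd d X" "0 < \<eta>"
  shows "\<exists>Y\<in>carrier_mat d d. mat_adjoint Y = Y \<and>
    (X + complex_of_real \<eta> \<cdot>\<^sub>m 1\<^sub>m d) * Y = 1\<^sub>m d \<and> Y * (X + complex_of_real \<eta> \<cdot>\<^sub>m 1\<^sub>m d) = 1\<^sub>m d"
proof -
  obtain U l where U: "unitary d U" "\<forall>i<d. 0 \<le> l i"
      "X = U * mat_diag d (\<lambda>i. complex_of_real (l i)) * mat_adjoint U"
    using psd_diagonalisation[OF assms(1)] by auto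
  have Uc: "U \<in> carrier_mat d d" and UU: "U * mat_adjoint U = 1\<^sub>m d" using U by (auto simp: unitary_def)
  let ?D = "\<lambda>f. mat_diag d (\<lambda>i. complex_of_real (f i))"
  let ?C = "X + complex_of_real \<eta> \<cdot>\<^sub>m 1\<^sub>m d" and ?l = "\<lambda>i. l i + \<eta>"
  define Y where "Y = U * ?D (\<lambda>i. 1 / ?l i) * mat_adjoint U"
  have Xc: "X \<in> carrier_mat d d" using assms(1) by (rule psd_carrier)
  have Y: "Y \<in> carrier_mat d d" using Uc by (intro carrier_matI) (auto simp: Y_def)
  have c: "dim_row (?D f) = d" "dim_col (?D f) = d" for f by (auto simp: mat_diag_def)
  have one: "1\<^sub>m d = U * ?D (\<lambda>i. 1) * mat_adjoint U" using UU Uc by simp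
  have C: "?C = U * ?D ?l * mat_adjoint U"
  proof (rule eq_matI)
    fix p q assume "p < dim_row (U * ?D ?l * mat_adjoint U)" "q < dim_col (U * ?D ?l * mat_adjoint U)"
    hence pq: "p < d" "q < d" using Uc by auto
    have "?C $$ (p, q) = X $$ (p, q) + complex_of_real \<eta> * (1\<^sub>m d :: complex mat) $$ (p, q)"
      using pq Xc by simp
    also have "\<dots> = (U * ?D ?l * mat_adjoint U) $$ (p, q)"
      unfolding one U(3) diag_conj_index[OF Uc pq]
      by (simp only: sum_distrib_left sum.distrib[symmetric])
        (rule sum.cong, simp_all add: algebra_simps)
    finally show "?C $$ (p, q) = (U * ?D ?l * mat_adjoint U) $$ (p, q)" .
  qed (use Xc Uc in auto)
  have adjY: "mat_adjoint Y = Y"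
    unfolding Y_def using carrier_matD[OF Uc] by (simp only: mat_assoc c mat_adjoint_diag)
  have nz: "i < d \<Longrightarrow> ?l i \<noteq> 0" for i using U(2) assms(2) by (force simp: add_nonneg_eq_0_iff)
  have "?C * Y = U * (?D ?l * (mat_adjoint U * (U * (?D (\<lambda>i. 1 / ?l i) * mat_adjoint U))))"
    unfolding C Y_def using carrier_matD[OF Uc] by (simp only: mat_assoc c)
  also have "mat_adjoint U * (U * (?D (\<lambda>i. 1 / ?l i) * mat_adjoint U)) = ?D (\<lambda>i. 1 / ?l i) * mat_adjoint U"
    by (rule unitary_cancel(1)[OF U(1) mult_carrier_mat[OF mat_diag_dim mat_adjoint_carrier[OF Uc]]])
  also have "U * (?D ?l * (?D (\<lambda>i. 1 / ?l i) * mat_adjoint U)) = U * (?D ?l * ?D (\<lambda>i. 1 / ?l i)) * mat_adjoint U"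
    using carrier_matD[OF Uc] by (simp only: mat_assoc c)
  also have "?D ?l * ?D (\<lambda>i. 1 / ?l i) = ?D (\<lambda>i. 1)"
    unfolding mat_diag_diag using nz
    by (intro eq_matI) (auto simp: mat_diag_def of_real_mult[symmetric] simp del: of_real_mult of_real_divide of_real_add)
  finally have CY: "?C * Y = 1\<^sub>m d" unfolding one .
  moreover have "Y * ?C = 1\<^sub>m d"
    by (rule mat_mult_left_right_inverse[OF _ Y CY]) (use Xc in auto)
  ultimately show ?thesis using Y adjY by blast
qed

text \<open>The noncommutative substitute for splitting \<open>\<rho> \<le> S + D\<close> into parts below \<open>S\<close> and \<open>D\<close>: with
  \<open>C = S + D\<close> invertible, take \<open>A = S C\<^sup>-\<^sup>1 \<rho> C\<^sup>-\<^sup>1 S\<close> and \<open>B = D C\<^sup>-\<^sup>1 \<rho> C\<^sup>-\<^sup>1 D\<close>.\<close>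

lemma riesz_part_le:
  assumes S: "psd d S" and D: "psd d D" and rho: "psd d \<rho>" and le: "psd d (S + D - \<rho>)"
    and Y: "Y \<in> carrier_mat d d" "mat_adjoint Y = Y" "(S + D) * Y = 1\<^sub>m d"
  shows "psd d (S - (S * Y) * \<rho> * mat_adjoint (S * Y))"
proof -
  note Sc = psd_carrier[OF S] and Dc = psd_carrier[OF D] and rc = psd_carrier[OF rho]
  let ?A = "(S * Y) * \<rho> * mat_adjoint (S * Y)"
  have SY: "S * Y \<in> carrier_mat d d" using Sc Y by simp
  have YS: "mat_adjoint (S * Y) = Y * S"
    using carrier_matD[OF Sc] carrier_matD[OF Y(1)] by (simp only: mat_assoc psd_hermitian[OF S] Y(2))
  have A: "psd d ?A" by (rule psd_conj[OF rho SY])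
  show ?thesis
    unfolding psd_iff
  proof (intro conjI ballI)
    show "S - ?A \<in> carrier_mat d d" by (rule minus_carrier_mat[OF psd_carrier[OF A]])
    show "mat_adjoint (S - ?A) = S - ?A"
      using mat_adjoint_minus[OF Sc psd_carrier[OF A]] psd_hermitian[OF A] psd_hermitian[OF S] by simp
    fix v :: "complex vec" assume v: "v \<in> carrier_vec d"
    define x where "x = (Y * S) *\<^sub>v v"
    have x: "x \<in> carrier_vec d" unfolding x_def using Y Sc by (intro carrier_vecI) auto
    have Cc: "S + D \<in> carrier_mat d d" using Dc by simp
    have Sv: "S *\<^sub>v v \<in> carrier_vec d" using Sc by (intro carrier_vecI) auto
    have "(S + D) *\<^sub>v x = ((S + D) * (Y * S)) *\<^sub>v v"
      unfolding x_def by (rule assoc_mult_mat_vec[OF Cc mult_carrier_mat[OF Y(1) Sc] v, symmetric])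
    also have "(S + D) * (Y * S) = S"
      using assoc_mult_mat[OF Cc Y(1) Sc] Y(3) Sc by simp
    finally have Cx: "(S + D) *\<^sub>v x = S *\<^sub>v v" .
    have "qform ?A v = qform \<rho> x" using qform_conj[OF rc SY v] by (simp only: YS x_def)
    also have "\<dots> \<le> qform (S + D) x"
      using psd_qform[OF le x] qform_minus[OF Cc rc x] by simp
    finally have 1: "qform ?A v \<le> qform (S + D) x" .
    have 2: "qform (S + D) x = Re ((S *\<^sub>v v) \<bullet>c x)" by (simp add: qform_def Cx)
    have Sx: "S *\<^sub>v x \<in> carrier_vec d" using Sc by (intro carrier_vecI) auto
    \<comment> \<open>Let t be the form of \<open>S + D\<close> at \<open>x\<close>, which equals
      the real part of the pairing of \<open>S v\<close> with \<open>x\<close>. Positivity of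
      \<open>S\<close> at \<open>v - x\<close> gives S(v) \<ge> 2 t - S(x), and S(x) \<le> t because
      \<open>D\<close> is positive; hence S(v) \<ge> t.\<close>
    have "qform S (v - x) = qform S v - 2 * Re ((S *\<^sub>v v) \<bullet>c x) + qform S x"
      unfolding qform_def minus_mult_mat_vec_right[OF Sc v x]
      using hermitian_cscalar[OF Sc psd_hermitian[OF S] x v] v x Sv Sx
      by (simp add: cscalar_minus_left[of _ d] cscalar_minus_right[of _ d])
    moreover have "0 \<le> qform S (v - x)" by (rule psd_qform[OF S]) (use v x in auto)
    moreover have "0 \<le> qform D x" by (rule psd_qform[OF D x])
    ultimately show "0 \<le> qform (S - ?A) v"
      using 1 2 qform_minus[OF Sc psd_carrier[OF A] v] qform_add[OF Sc Dc x] by simp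
  qed
qed

text \<open>With E the shift of \<open>D\<close> by \<open>\<eta>\<close>, the operators
  \<open>Y * S\<close> and \<open>Y * E\<close> add up to the identity, so every \<open>v\<close> is
  \<open>x v + y v\<close>, and the forms of \<open>A\<close> and \<open>B\<close> at
  \<open>v\<close> are those of \<open>\<rho>\<close> at \<open>x v\<close> and \<open>y v\<close>.
  The parallelogram law for \<open>\<rho>\<close> yields the three inequalities with factor 2; the
  last two later bound the trace of \<open>A\<close> and dominate \<open>B\<close>. The shift makes
  \<open>S + E\<close> invertible and is charged to \<open>B\<close>.\<close>

lemma riesz_decomposition:
  assumes S: "psd d S" and D: "psd d D" and rho: "psd d \<rho>" and le: "psd d (S + D - \<rho>)" and eta: "0 < \<eta>"
  shows "\<exists>A B. psd d A \<and> psd d B \<and> psd d (2 \<cdot>\<^sub>m A + 2 \<cdot>\<^sub>m B - \<rho>) \<and> psd d (S - A) \<and>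
    psd d (D + complex_of_real \<eta> \<cdot>\<^sub>m 1\<^sub>m d - B) \<and>
    psd d (2 \<cdot>\<^sub>m \<rho> + 2 \<cdot>\<^sub>m B - A) \<and> psd d (2 \<cdot>\<^sub>m \<rho> + 2 \<cdot>\<^sub>m A - B)"
proof -
  note Sc = psd_carrier[OF S] and Dc = psd_carrier[OF D] and rc = psd_carrier[OF rho]
  define E where "E = D + complex_of_real \<eta> \<cdot>\<^sub>m 1\<^sub>m d"
  have E: "psd d E" unfolding E_def by (intro psd_add D psd_smult psd_one) (use eta in auto)
  note Ec = psd_carrier[OF E]
  have SDE: "S + D + complex_of_real \<eta> \<cdot>\<^sub>m 1\<^sub>m d = S + E"
    using Sc Dc by (intro eq_matI) (auto simp: E_def)
  obtain Y where Y: "Y \<in> carrier_mat d d" "mat_adjoint Y = Y" "(S + E) * Y = 1\<^sub>m d" "Y * (S + E) = 1\<^sub>m d"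
    using pos_def_inverse[OF psd_add[OF S D] eta] unfolding SDE by auto
  have ES: "E + S = S + E" using Sc Ec by (intro eq_matI) auto
  have leE: "psd d (S + E - \<rho>)"
  proof -
    have "S + E - \<rho> = (S + D - \<rho>) + complex_of_real \<eta> \<cdot>\<^sub>m 1\<^sub>m d"
      using Sc Dc rc by (intro eq_matI) (auto simp: E_def)
    thus ?thesis using psd_add[OF le psd_smult[OF psd_one]] eta by simp
  qed
  define A where "A = (S * Y) * \<rho> * mat_adjoint (S * Y)"
  define B where "B = (E * Y) * \<rho> * mat_adjoint (E * Y)"
  have SY: "S * Y \<in> carrier_mat d d" and EY: "E * Y \<in> carrier_mat d d" using Sc Ec Y by auto
  have A: "psd d A" and B: "psd d B"
    unfolding A_def B_def by (rule psd_conj[OF rho SY], rule psd_conj[OF rho EY])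
  note Ac = psd_carrier[OF A] and Bc = psd_carrier[OF B]
  have SA: "psd d (S - A)" unfolding A_def by (rule riesz_part_le[OF S E rho leE Y(1-3)])
  have EB: "psd d (E - B)"
    unfolding B_def by (rule riesz_part_le[OF E S rho _ Y(1,2)]) (use leE Y(3) ES in auto)
  define x where "x v = (Y * S) *\<^sub>v v" for v
  define y where "y v = (Y * E) *\<^sub>v v" for v
  have xc: "x v \<in> carrier_vec d" and yc: "y v \<in> carrier_vec d" for v
    unfolding x_def y_def using Y by (auto intro!: carrier_vecI)
  have xy: "v = x v + y v" if "v \<in> carrier_vec d" for v
  proof -
    have "x v + y v = (Y * S + Y * E) *\<^sub>v v"
      unfolding x_def y_def
      by (rule add_mult_distrib_mat_vec[OF mult_carrier_mat[OF Y(1) Sc] mult_carrier_mat[OF Y(1) Ec] that, symmetric])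
    also have "Y * S + Y * E = 1\<^sub>m d" using mult_add_distrib_mat[OF Y(1) Sc Ec] Y(4) by simp
    finally show ?thesis using that by simp
  qed
  have qA: "qform A v = qform \<rho> (x v)" if "v \<in> carrier_vec d" for v
  proof -
    have "mat_adjoint (S * Y) = Y * S"
      using carrier_matD[OF Sc] carrier_matD[OF Y(1)] by (simp only: mat_assoc psd_hermitian[OF S] Y(2))
    thus ?thesis unfolding A_def qform_conj[OF rc SY that] x_def by simp
  qed
  have qB: "qform B v = qform \<rho> (y v)" if "v \<in> carrier_vec d" for v
  proof -
    have "mat_adjoint (E * Y) = Y * E"
      using carrier_matD[OF Ec] carrier_matD[OF Y(1)] by (simp only: mat_assoc psd_hermitian[OF E] Y(2))
    thus ?thesis unfolding B_def qform_conj[OF rc EY that] y_def by simp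
  qed
  have psd_comb: "psd d (2 \<cdot>\<^sub>m X + 2 \<cdot>\<^sub>m Z - W)"
    if h: "psd d X" "psd d Z" "psd d W"
      and q: "\<And>v. v \<in> carrier_vec d \<Longrightarrow> qform W v \<le> 2 * qform X v + 2 * qform Z v" for X Z W
  proof -
    note c = psd_carrier[OF h(1)] psd_carrier[OF h(2)] psd_carrier[OF h(3)]
    have 2: "psd d (complex_of_real 2 \<cdot>\<^sub>m X + complex_of_real 2 \<cdot>\<^sub>m Z)"
      by (intro psd_add psd_smult h) auto
    have "psd d (complex_of_real 2 \<cdot>\<^sub>m X + complex_of_real 2 \<cdot>\<^sub>m Z - W)"
      unfolding psd_iff
    proof (intro conjI ballI)
      show "mat_adjoint (complex_of_real 2 \<cdot>\<^sub>m X + complex_of_real 2 \<cdot>\<^sub>m Z - W) =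
          complex_of_real 2 \<cdot>\<^sub>m X + complex_of_real 2 \<cdot>\<^sub>m Z - W"
        unfolding mat_adjoint_minus[OF psd_carrier[OF 2] c(3)] psd_hermitian[OF 2] psd_hermitian[OF h(3)] ..
      fix v :: "complex vec" assume v: "v \<in> carrier_vec d"
      show "0 \<le> qform (complex_of_real 2 \<cdot>\<^sub>m X + complex_of_real 2 \<cdot>\<^sub>m Z - W) v"
        unfolding qform_minus[OF psd_carrier[OF 2] c(3) v]
          qform_add[OF smult_carrier_mat[OF c(1)] smult_carrier_mat[OF c(2)] v]
          qform_smult[OF c(1) v] qform_smult[OF c(2) v] using q[OF v] by simp
    qed (use c in auto)
    thus ?thesis by simp
  qed
  have par: "qform \<rho> (u + w) + qform \<rho> (u - w) = 2 * qform \<rho> u + 2 * qform \<rho> w"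
    if "u \<in> carrier_vec d" "w \<in> carrier_vec d" for u w
    by (rule qform_parallelogram[OF rc that])
  have 1: "qform \<rho> v \<le> 2 * qform A v + 2 * qform B v" if v: "v \<in> carrier_vec d" for v
  proof -
    have "qform \<rho> v = qform \<rho> (x v + y v)" by (rule arg_cong[OF xy[OF v]])
    thus ?thesis
      using par[OF xc yc, of v v] psd_qform[OF rho minus_carrier_vec[OF xc yc], of v v]
      unfolding qA[OF v] qB[OF v] by simp
  qed
  have 2: "qform A v \<le> 2 * qform \<rho> v + 2 * qform B v" if v: "v \<in> carrier_vec d" for v
  proof -
    have "v - y v = x v + y v - y v" by (rule arg_cong[OF xy[OF v], where f = "\<lambda>a. a - y v"])
    also have "\<dots> = x v" using xc[of v] yc[of v] by (intro eq_vecI) auto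
    finally have "v - y v = x v" .
    thus ?thesis
      using par[OF v yc, of v] psd_qform[OF rho add_carrier_vec[OF v yc], of v]
      unfolding qA[OF v] qB[OF v] by simp
  qed
  have 3: "qform B v \<le> 2 * qform \<rho> v + 2 * qform A v" if v: "v \<in> carrier_vec d" for v
  proof -
    have "v - x v = x v + y v - x v" by (rule arg_cong[OF xy[OF v], where f = "\<lambda>a. a - x v"])
    also have "\<dots> = y v" using xc[of v] yc[of v] by (intro eq_vecI) auto
    finally have "v - x v = y v" .
    thus ?thesis
      using par[OF v xc, of v] psd_qform[OF rho add_carrier_vec[OF v xc], of v]
      unfolding qA[OF v] qB[OF v] by simp
  qed
  show ?thesis
    using A B SA EB psd_comb[OF A B rho 1] psd_comb[OF rho B A 2] psd_comb[OF rho A B 3]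
    unfolding E_def by blast
qed

section \<open>Tensor products and completely positive maps\<close>

section \<open>Kronecker products\<close>

lemma kron_dim [simp]:
  "dim_row (kron X Y) = dim_row X * dim_row Y" "dim_col (kron X Y) = dim_col X * dim_col Y"
  by (auto simp: kron_def)

lemma kron_carrier [intro]:
  "X \<in> carrier_mat a b \<Longrightarrow> Y \<in> carrier_mat c d \<Longrightarrow> kron X Y \<in> carrier_mat (a * c) (b * d)"
  by (auto simp: kron_def)

lemma div_less_of_prod: "p < a * b \<Longrightarrow> p div b < (a :: nat)"
  by (simp add: less_mult_imp_div_less)

lemma mod_less_of_prod: "p < a * b \<Longrightarrow> p mod b < (b :: nat)"
  by (cases "b = 0") auto

lemma pair_index_less: "i < a \<Longrightarrow> k < b \<Longrightarrow> i * b + k < a * (b :: nat)"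
proof -
  assume "i < a" "k < b"
  hence "i * b + k < Suc i * b" by simp
  also have "\<dots> \<le> a * b" using \<open>i < a\<close> by (intro mult_right_mono) auto
  finally show ?thesis .
qed

lemma kron_index:
  assumes "X \<in> carrier_mat a b" "Y \<in> carrier_mat c d" "p < a * c" "q < b * d"
  shows "kron X Y $$ (p, q) = X $$ (p div c, q div d) * Y $$ (p mod c, q mod d)"
  using assms by (auto simp: kron_def)

lemma sum_div_mod:
  fixes f :: "nat \<Rightarrow> nat \<Rightarrow> 'a :: comm_monoid_add"
  shows "(\<Sum>k<a * b. f (k div b) (k mod b)) = (\<Sum>i<a. \<Sum>j<b. f i j)"
proof -
  have "(\<Sum>i<a. \<Sum>j<b. f i j) = (\<Sum>(i, j)\<in>{..<a} \<times> {..<b}. f i j)"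
    by (rule sum.cartesian_product)
  also have "\<dots> = (\<Sum>k<a * b. f (k div b) (k mod b))"
    by (rule sum.reindex_bij_witness[of _ "\<lambda>k. (k div b, k mod b)" "\<lambda>(i, j). i * b + j"])
      (auto simp: pair_index_less div_less_of_prod mod_less_of_prod)
  finally show ?thesis by simp
qed

lemma kron_mult:
  assumes A: "A \<in> carrier_mat a b" and B: "B \<in> carrier_mat a' b'"
    and C: "C \<in> carrier_mat b c" and D: "D \<in> carrier_mat b' c'"
  shows "kron A B * kron C D = kron (A * C) (B * D)"
proof (rule eq_matI)
  fix p q assume "p < dim_row (kron (A * C) (B * D))" "q < dim_col (kron (A * C) (B * D))"
  hence p: "p < a * a'" and q: "q < c * c'" using assms by auto
  have pq: "p div a' < a" "p mod a' < a'" "q div c' < c" "q mod c' < c'"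
    using p q by (auto intro: div_less_of_prod mod_less_of_prod)
  have "(kron A B * kron C D) $$ (p, q) = (\<Sum>k<b * b'. kron A B $$ (p, k) * kron C D $$ (k, q))"
    using assms p q by (auto simp: scalar_prod_def atLeast0LessThan intro!: sum.cong)
  also have "\<dots> = (\<Sum>k<b * b'. (A $$ (p div a', k div b') * B $$ (p mod a', k mod b')) *
      (C $$ (k div b', q div c') * D $$ (k mod b', q mod c')))"
    using p q by (intro sum.cong refl) (simp add: kron_index[OF A B] kron_index[OF C D])
  also have "\<dots> = (\<Sum>i<b. \<Sum>j<b'. (A $$ (p div a', i) * B $$ (p mod a', j)) *
      (C $$ (i, q div c') * D $$ (j, q mod c')))"
    by (rule sum_div_mod)
  also have "\<dots> = (\<Sum>i<b. A $$ (p div a', i) * C $$ (i, q div c')) *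
      (\<Sum>j<b'. B $$ (p mod a', j) * D $$ (j, q mod c'))"
    by (simp add: sum_product mult_ac)
  also have "\<dots> = (A * C) $$ (p div a', q div c') * (B * D) $$ (p mod a', q mod c')"
    using assms pq by (auto simp: scalar_prod_def atLeast0LessThan)
  also have "\<dots> = kron (A * C) (B * D) $$ (p, q)"
    using kron_index[OF mult_carrier_mat[OF A C] mult_carrier_mat[OF B D] p q] by simp
  finally show "(kron A B * kron C D) $$ (p, q) = kron (A * C) (B * D) $$ (p, q)" .
qed (use assms in auto)

text \<open>An equality of matrices, with no isomorphism in between: flattening nested pairs of
  indices gives the same number for both bracketings. Rearranging tensor factors therefore only ever
  requires swaps.\<close>

lemma kron_assoc: "kron (kron X Y) Z = kron X (kron Y Z)"
proof (rule eq_matI)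
  let ?b = "dim_row Y" and ?c = "dim_row Z" and ?b' = "dim_col Y" and ?c' = "dim_col Z"
  fix p q assume "p < dim_row (kron X (kron Y Z))" "q < dim_col (kron X (kron Y Z))"
  hence p: "p < dim_row X * (?b * ?c)" and q: "q < dim_col X * (?b' * ?c')" by auto
  have bp: "p mod (?b * ?c) < ?b * ?c" "q mod (?b' * ?c') < ?b' * ?c'"
    using mod_less_of_prod[OF p] mod_less_of_prod[OF q] by auto
  have pc: "p div ?c < dim_row X * ?b" "q div ?c' < dim_col X * ?b'"
    using p q by (auto intro!: div_less_of_prod simp: mult.assoc)
  have d: "p div (?b * ?c) = p div ?c div ?b" "q div (?b' * ?c') = q div ?c' div ?b'"
    by (metis div_mult2_eq mult.commute)+
  have c0: "0 < ?c" "0 < ?c'" using p q by (auto intro!: Nat.gr0I)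
  have m: "p mod (?b * ?c) div ?c = p div ?c mod ?b" "p mod (?b * ?c) mod ?c = p mod ?c"
    "q mod (?b' * ?c') div ?c' = q div ?c' mod ?b'" "q mod (?b' * ?c') mod ?c' = q mod ?c'"
    using mod_mult2_eq[of p ?c ?b] mod_mult2_eq[of q ?c' ?b'] c0
    by (auto simp: mult.commute[of _ ?c] mult.commute[of _ ?c'])
  show "kron (kron X Y) Z $$ (p, q) = kron X (kron Y Z) $$ (p, q)"
    using p q bp pc by (simp add: kron_def d m mult.assoc)
qed (auto simp: mult.assoc)

lemma kron_add_right:
  assumes "X \<in> carrier_mat a b" "Y \<in> carrier_mat c d" "Y' \<in> carrier_mat c d"
  shows "kron X (Y + Y') = kron X Y + kron X Y'"
  using assms
  by (intro eq_matI) (auto simp: kron_def mod_less_of_prod distrib_left)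

lemma kron_minus_left:
  assumes "X \<in> carrier_mat a b" "X' \<in> carrier_mat a b" "Y \<in> carrier_mat c d"
  shows "kron (X - X') Y = kron X Y - kron X' Y"
  using assms
  by (intro eq_matI) (auto simp: kron_def div_less_of_prod left_diff_distrib)

lemma kron_minus_right:
  assumes "X \<in> carrier_mat a b" "Y \<in> carrier_mat c d" "Y' \<in> carrier_mat c d"
  shows "kron X (Y - Y') = kron X Y - kron X Y'"
  using assms
  by (intro eq_matI) (auto simp: kron_def mod_less_of_prod right_diff_distrib)

lemma kron_smult_left: "kron (c \<cdot>\<^sub>m X) Y = c \<cdot>\<^sub>m kron X Y"
  by (rule eq_matI) (auto simp: kron_def div_less_of_prod)

lemma kron_smult_right: "kron X (c \<cdot>\<^sub>m Y) = c \<cdot>\<^sub>m kron X Y"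
  by (rule eq_matI) (auto simp: kron_def mod_less_of_prod)

lemma mat_adjoint_kron: "mat_adjoint (kron X Y) = kron (mat_adjoint X) (mat_adjoint Y)"
  by (rule eq_matI) (auto simp: kron_def div_less_of_prod mod_less_of_prod)

lemma kron_one: "kron (1\<^sub>m a) (1\<^sub>m b) = 1\<^sub>m (a * b)"
proof (rule eq_matI)
  fix p q assume "p < dim_row (1\<^sub>m (a * b) :: complex mat)" "q < dim_col (1\<^sub>m (a * b) :: complex mat)"
  hence pq: "p < a * b" "q < a * b" by auto
  have "p = q \<longleftrightarrow> p div b = q div b \<and> p mod b = q mod b" by (metis div_mult_mod_eq)
  thus "kron (1\<^sub>m a) (1\<^sub>m b) $$ (p, q) = 1\<^sub>m (a * b) $$ (p, q)"
    using pq by (auto simp: kron_def div_less_of_prod mod_less_of_prod)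
qed auto

lemma kron_one_right: "kron X (1\<^sub>m 1) = X"
  by (rule eq_matI) (auto simp: kron_def)

lemma kron_conj:
  assumes "K \<in> carrier_mat a b" "X \<in> carrier_mat b b" "L \<in> carrier_mat c d" "Y \<in> carrier_mat d d"
  shows "kron K L * kron X Y * mat_adjoint (kron K L) = kron (K * X * mat_adjoint K) (L * Y * mat_adjoint L)"
  unfolding mat_adjoint_kron kron_mult[OF assms(1,3,2,4)]
  by (rule kron_mult) (use assms in auto)

lemma psd_kron:
  assumes "psd a X" "psd b Y"
  shows "psd (a * b) (kron X Y)"
proof -
  obtain K where K: "K \<in> carrier_mat a a" "X = K * mat_adjoint K" using psd_factor[OF assms(1)] by auto
  obtain L where L: "L \<in> carrier_mat b b" "Y = L * mat_adjoint L" using psd_factor[OF assms(2)] by auto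
  have "kron X Y = kron K L * mat_adjoint (kron K L)"
    unfolding K(2) L(2) mat_adjoint_kron
    by (rule kron_mult[OF K(1) L(1) mat_adjoint_carrier[OF K(1)] mat_adjoint_carrier[OF L(1)], symmetric])
  thus ?thesis using psd_gram[OF kron_carrier[OF K(1) L(1)]] by simp
qed

lemma mtrace_kron:
  assumes "X \<in> carrier_mat a a" "Y \<in> carrier_mat b b"
  shows "mtrace (kron X Y) = mtrace X * mtrace Y"
proof -
  have "mtrace (kron X Y) = (\<Sum>k<a * b. X $$ (k div b, k div b) * Y $$ (k mod b, k mod b))"
    using assms by (auto simp: mtrace_def kron_index[OF assms] intro!: sum.cong)
  also have "\<dots> = (\<Sum>i<a. \<Sum>j<b. X $$ (i, i) * Y $$ (j, j))" by (rule sum_div_mod)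
  also have "\<dots> = mtrace X * mtrace Y" using assms by (simp add: mtrace_def sum_product)
  finally show ?thesis .
qed

lemma matrix_unit_carrier [simp]: "matrix_unit d i j \<in> carrier_mat d d"
  by (simp add: matrix_unit_def)

lemma matrix_unit_kron:
  assumes "i < a" "j < a" "k < b" "l < b"
  shows "matrix_unit (a * b) (i * b + k) (j * b + l) = kron (matrix_unit a i j) (matrix_unit b k l)"
proof (rule eq_matI)
  fix p q assume "p < dim_row (kron (matrix_unit a i j) (matrix_unit b k l))"
    "q < dim_col (kron (matrix_unit a i j) (matrix_unit b k l))"
  hence pq: "p < a * b" "q < a * b" by (auto simp: matrix_unit_def)
  have "p = i * b + k \<longleftrightarrow> p div b = i \<and> p mod b = k" if "k < b" for p i k
    using that by auto
  thus "matrix_unit (a * b) (i * b + k) (j * b + l) $$ (p, q) =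
      kron (matrix_unit a i j) (matrix_unit b k l) $$ (p, q)"
    using pq assms by (auto simp: kron_def matrix_unit_def div_less_of_prod mod_less_of_prod)
qed (auto simp: matrix_unit_def)

section \<open>Linear maps of matrices\<close>

lemma linear_mapD:
  assumes "linear_map a b \<Phi>"
  shows "X \<in> carrier_mat a a \<Longrightarrow> \<Phi> X \<in> carrier_mat b b"
    "X \<in> carrier_mat a a \<Longrightarrow> Y \<in> carrier_mat a a \<Longrightarrow> \<Phi> (X + Y) = \<Phi> X + \<Phi> Y"
    "X \<in> carrier_mat a a \<Longrightarrow> \<Phi> (c \<cdot>\<^sub>m X) = c \<cdot>\<^sub>m \<Phi> X"
  using assms by (auto simp: linear_map_def)

lemma linear_map_minus:
  assumes \<Phi>: "linear_map a b \<Phi>" and X: "X \<in> carrier_mat a a" and Y: "Y \<in> carrier_mat a a"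
  shows "\<Phi> (X - Y) = \<Phi> X - \<Phi> Y"
proof -
  have "X - Y = X + (-1) \<cdot>\<^sub>m Y" using X Y by (intro eq_matI) auto
  hence "\<Phi> (X - Y) = \<Phi> X + (-1) \<cdot>\<^sub>m \<Phi> Y"
    using linear_mapD(2)[OF \<Phi> X smult_carrier_mat[OF Y]] linear_mapD(3)[OF \<Phi> Y] by simp
  also have "\<dots> = \<Phi> X - \<Phi> Y"
    using linear_mapD(1)[OF \<Phi> X] linear_mapD(1)[OF \<Phi> Y] by (intro eq_matI) auto
  finally show ?thesis .
qed

text \<open>\<open>Y S\<close> keeps the entries whose index lies in \<open>S\<close>; adding the
  indices one at a time replaces a sum of matrix units by finitely many uses of additivity.\<close>

lemma linear_map_expand:
  assumes \<Phi>: "linear_map a b \<Phi>" and X: "X \<in> carrier_mat a a" and pq: "p < b" "q < b"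
  shows "\<Phi> X $$ (p, q) = (\<Sum>i<a. \<Sum>j<a. X $$ (i, j) * \<Phi> (matrix_unit a i j) $$ (p, q))"
proof -
  define Y where "Y S = mat a a (\<lambda>ij. if ij \<in> S then X $$ ij else 0)" for S
  have Yc: "Y S \<in> carrier_mat a a" for S by (simp add: Y_def)
  have "\<Phi> (Y S) $$ (p, q) = (\<Sum>(i, j)\<in>S. X $$ (i, j) * \<Phi> (matrix_unit a i j) $$ (p, q))"
    if "finite S" for S
    using that
  proof (induction S)
    case empty
    have "Y {} = 0 \<cdot>\<^sub>m Y {}" by (rule eq_matI) (auto simp: Y_def)
    hence "\<Phi> (Y {}) = 0 \<cdot>\<^sub>m \<Phi> (Y {})" using linear_mapD(3)[OF \<Phi> Yc] by metis
    hence "\<Phi> (Y {}) $$ (p, q) = (0 \<cdot>\<^sub>m \<Phi> (Y {})) $$ (p, q)" by (rule arg_cong)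
    also have "\<dots> = 0" using linear_mapD(1)[OF \<Phi> Yc, of "{}"] pq by simp
    finally show ?case by simp
  next
    case (insert x S)
    obtain i j where x: "x = (i, j)" by (cases x)
    let ?E = "X $$ (i, j) \<cdot>\<^sub>m matrix_unit a i j"
    have E: "?E \<in> carrier_mat a a" by simp
    have "Y (insert x S) = Y S + ?E"
      using insert.hyps by (intro eq_matI) (auto simp: Y_def matrix_unit_def x)
    hence "\<Phi> (Y (insert x S)) = \<Phi> (Y S) + X $$ (i, j) \<cdot>\<^sub>m \<Phi> (matrix_unit a i j)"
      using linear_mapD(2)[OF \<Phi> Yc E] linear_mapD(3)[OF \<Phi> matrix_unit_carrier] by simp
    moreover have "\<Phi> (matrix_unit a i j) \<in> carrier_mat b b" "\<Phi> (Y S) \<in> carrier_mat b b"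
      by (rule linear_mapD(1)[OF \<Phi>], simp add: Yc)+
    ultimately have "\<Phi> (Y (insert x S)) $$ (p, q) =
        \<Phi> (Y S) $$ (p, q) + X $$ (i, j) * \<Phi> (matrix_unit a i j) $$ (p, q)"
      using pq by simp
    thus ?case using insert by (simp add: x add.commute)
  qed
  from this[of "{..<a} \<times> {..<a}"]
  have "\<Phi> (Y ({..<a} \<times> {..<a})) $$ (p, q) =
      (\<Sum>i<a. \<Sum>j<a. X $$ (i, j) * \<Phi> (matrix_unit a i j) $$ (p, q))"
    by (simp add: sum.cartesian_product)
  moreover have "Y ({..<a} \<times> {..<a}) = X" using X by (intro eq_matI) (auto simp: Y_def)
  ultimately show ?thesis by simp
qed

lemma linear_map_eqI:
  assumes "linear_map a b \<Phi>" "linear_map a b \<Psi>"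
    and "\<And>i j. i < a \<Longrightarrow> j < a \<Longrightarrow> \<Phi> (matrix_unit a i j) = \<Psi> (matrix_unit a i j)"
    and "X \<in> carrier_mat a a"
  shows "\<Phi> X = \<Psi> X"
proof (rule eq_matI)
  note c = linear_mapD(1)[OF assms(1,4)] linear_mapD(1)[OF assms(2,4)]
  fix p q assume "p < dim_row (\<Psi> X)" "q < dim_col (\<Psi> X)"
  hence pq: "p < b" "q < b" using c by auto
  show "\<Phi> X $$ (p, q) = \<Psi> X $$ (p, q)"
    unfolding linear_map_expand[OF assms(1,4) pq] linear_map_expand[OF assms(2,4) pq]
    by (intro sum.cong refl) (simp add: assms(3))
qed (use linear_mapD(1)[OF assms(1,4)] linear_mapD(1)[OF assms(2,4)] in auto)

text \<open>Matrix units of a product space are Kronecker products of matrix units, so linear maps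
  that agree on product operators agree. Most identities between tensor constructions below are
  proved this way.\<close>

lemma linear_map_kron_eqI:
  assumes "linear_map (a * c) b \<Phi>" "linear_map (a * c) b \<Psi>"
    and eq: "\<And>X Y. X \<in> carrier_mat a a \<Longrightarrow> Y \<in> carrier_mat c c \<Longrightarrow> \<Phi> (kron X Y) = \<Psi> (kron X Y)"
    and "X \<in> carrier_mat (a * c) (a * c)"
  shows "\<Phi> X = \<Psi> X"
proof (rule linear_map_eqI[OF assms(1,2) _ assms(4)])
  fix p q assume pq: "p < a * c" "q < a * c"
  have "matrix_unit (a * c) p q = kron (matrix_unit a (p div c) (q div c)) (matrix_unit c (p mod c) (q mod c))"
    using matrix_unit_kron[OF div_less_of_prod[OF pq(1)] div_less_of_prod[OF pq(2)]
        mod_less_of_prod[OF pq(1)] mod_less_of_prod[OF pq(2)]]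
    unfolding div_mult_mod_eq .
  thus "\<Phi> (matrix_unit (a * c) p q) = \<Psi> (matrix_unit (a * c) p q)" by (simp add: eq)
qed

lemma linear_map_kron3_eqI:
  assumes "linear_map (a * (c * e)) b \<Phi>" "linear_map (a * (c * e)) b \<Psi>"
    and eq: "\<And>X Y Z. X \<in> carrier_mat a a \<Longrightarrow> Y \<in> carrier_mat c c \<Longrightarrow> Z \<in> carrier_mat e e \<Longrightarrow>
      \<Phi> (kron X (kron Y Z)) = \<Psi> (kron X (kron Y Z))"
    and "X \<in> carrier_mat (a * (c * e)) (a * (c * e))"
  shows "\<Phi> X = \<Psi> X"
proof (rule linear_map_eqI[OF assms(1,2) _ assms(4)])
  fix p q assume pq: "p < a * (c * e)" "q < a * (c * e)"
  let ?p = "p mod (c * e)" and ?q = "q mod (c * e)"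
  have pq': "?p < c * e" "?q < c * e" using mod_less_of_prod[OF pq(1)] mod_less_of_prod[OF pq(2)] by auto
  have "matrix_unit (a * (c * e)) p q =
      kron (matrix_unit a (p div (c * e)) (q div (c * e))) (matrix_unit (c * e) ?p ?q)"
    using matrix_unit_kron[OF div_less_of_prod[OF pq(1)] div_less_of_prod[OF pq(2)] pq']
    unfolding div_mult_mod_eq .
  also have "matrix_unit (c * e) ?p ?q = kron (matrix_unit c (?p div e) (?q div e)) (matrix_unit e (?p mod e) (?q mod e))"
    using matrix_unit_kron[OF div_less_of_prod[OF pq'(1)] div_less_of_prod[OF pq'(2)]
        mod_less_of_prod[OF pq'(1)] mod_less_of_prod[OF pq'(2)]]
    unfolding div_mult_mod_eq .
  finally show "\<Phi> (matrix_unit (a * (c * e)) p q) = \<Psi> (matrix_unit (a * (c * e)) p q)" by (simp add: eq)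
qed

lemma linear_map_id: "linear_map a a (\<lambda>X. X)"
  by (simp add: linear_map_def)

lemma linear_map_comp:
  assumes "linear_map a b \<Phi>" "linear_map b c \<Psi>"
  shows "linear_map a c (\<lambda>X. \<Psi> (\<Phi> X))"
  using assms unfolding linear_map_def by simp

lemma linear_map_conj:
  assumes K: "K \<in> carrier_mat b a"
  shows "linear_map a b (\<lambda>X. K * X * mat_adjoint K)"
  unfolding linear_map_def
proof (intro conjI ballI allI)
  note K' = mat_adjoint_carrier[OF K]
  fix X :: "complex mat" assume X: "X \<in> carrier_mat a a"
  show "K * X * mat_adjoint K \<in> carrier_mat b b"
    by (rule mult_carrier_mat[OF mult_carrier_mat[OF K X] K'])
  show "K * (X + Y) * mat_adjoint K = K * X * mat_adjoint K + K * Y * mat_adjoint K"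
    if Y: "Y \<in> carrier_mat a a" for Y
    unfolding mult_add_distrib_mat[OF K X Y]
    by (rule add_mult_distrib_mat[OF mult_carrier_mat[OF K X] mult_carrier_mat[OF K Y] K'])
  show "K * (c \<cdot>\<^sub>m X) * mat_adjoint K = c \<cdot>\<^sub>m (K * X * mat_adjoint K)" for c
    unfolding mult_smult_distrib[OF K X]
    by (rule mult_smult_assoc_mat[OF mult_carrier_mat[OF K X] K'])
qed

lemma linear_map_combination:
  assumes "linear_map a b \<Phi>" "linear_map a b \<Psi>"
  shows "linear_map a b (\<lambda>X. c \<cdot>\<^sub>m \<Psi> X - \<Phi> X)"
  unfolding linear_map_def
proof (intro conjI ballI allI)
  fix X :: "complex mat" assume X: "X \<in> carrier_mat a a"
  note cX = linear_mapD(1)[OF assms(1) X] linear_mapD(1)[OF assms(2) X]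
  show "c \<cdot>\<^sub>m \<Psi> X - \<Phi> X \<in> carrier_mat b b" by (rule minus_carrier_mat[OF cX(1)])
  show "c \<cdot>\<^sub>m \<Psi> (e \<cdot>\<^sub>m X) - \<Phi> (e \<cdot>\<^sub>m X) = e \<cdot>\<^sub>m (c \<cdot>\<^sub>m \<Psi> X - \<Phi> X)" for e
    unfolding linear_mapD(3)[OF assms(1) X] linear_mapD(3)[OF assms(2) X]
    using cX by (intro eq_matI) (auto simp: algebra_simps)
  fix Y :: "complex mat" assume Y: "Y \<in> carrier_mat a a"
  note cY = linear_mapD(1)[OF assms(1) Y] linear_mapD(1)[OF assms(2) Y]
  show "c \<cdot>\<^sub>m \<Psi> (X + Y) - \<Phi> (X + Y) = c \<cdot>\<^sub>m \<Psi> X - \<Phi> X + (c \<cdot>\<^sub>m \<Psi> Y - \<Phi> Y)"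
    unfolding linear_mapD(2)[OF assms(1) X Y] linear_mapD(2)[OF assms(2) X Y]
    using cX cY by (intro eq_matI) (auto simp: algebra_simps)
qed

lemma tensor_map_linear: "linear_map (dA * dA') (dB * dB') (tensor_map dA dB dA' dB' \<Phi> \<Psi>)"
  unfolding linear_map_def
proof (intro conjI ballI allI)
  fix X :: "complex mat" assume X: "X \<in> carrier_mat (dA * dA') (dA * dA')"
  show "tensor_map dA dB dA' dB' \<Phi> \<Psi> X \<in> carrier_mat (dB * dB') (dB * dB')"
    by (simp add: tensor_map_def)
  show "tensor_map dA dB dA' dB' \<Phi> \<Psi> (c \<cdot>\<^sub>m X) = c \<cdot>\<^sub>m tensor_map dA dB dA' dB' \<Phi> \<Psi> X" for c
    using X by (intro eq_matI) (auto simp: tensor_map_def sum_distrib_left pair_index_less mult.assoc intro!: sum.cong)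
  fix Y :: "complex mat" assume Y: "Y \<in> carrier_mat (dA * dA') (dA * dA')"
  show "tensor_map dA dB dA' dB' \<Phi> \<Psi> (X + Y) =
      tensor_map dA dB dA' dB' \<Phi> \<Psi> X + tensor_map dA dB dA' dB' \<Phi> \<Psi> Y"
  proof (rule eq_matI)
    fix p q
    assume "p < dim_row (tensor_map dA dB dA' dB' \<Phi> \<Psi> X + tensor_map dA dB dA' dB' \<Phi> \<Psi> Y)"
      "q < dim_col (tensor_map dA dB dA' dB' \<Phi> \<Psi> X + tensor_map dA dB dA' dB' \<Phi> \<Psi> Y)"
    hence pq: "p < dB * dB'" "q < dB * dB'" by (auto simp: tensor_map_def)
    let ?t = "\<lambda>Z i j k l. Z $$ (i * dA' + k, j * dA' + l) *
        kron (\<Phi> (matrix_unit dA i j)) (\<Psi> (matrix_unit dA' k l)) $$ (p, q)"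
    have t: "tensor_map dA dB dA' dB' \<Phi> \<Psi> Z $$ (p, q) = (\<Sum>i<dA. \<Sum>j<dA. \<Sum>k<dA'. \<Sum>l<dA'. ?t Z i j k l)" for Z
      using pq by (simp add: tensor_map_def)
    have "tensor_map dA dB dA' dB' \<Phi> \<Psi> (X + Y) $$ (p, q) =
        (\<Sum>i<dA. \<Sum>j<dA. \<Sum>k<dA'. \<Sum>l<dA'. ?t X i j k l + ?t Y i j k l)"
      unfolding t using X Y by (intro sum.cong refl) (simp add: pair_index_less distrib_right)
    also have "\<dots> = tensor_map dA dB dA' dB' \<Phi> \<Psi> X $$ (p, q) + tensor_map dA dB dA' dB' \<Phi> \<Psi> Y $$ (p, q)"
      unfolding t by (simp only: sum.distrib)
    finally show "tensor_map dA dB dA' dB' \<Phi> \<Psi> (X + Y) $$ (p, q) =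
        (tensor_map dA dB dA' dB' \<Phi> \<Psi> X + tensor_map dA dB dA' dB' \<Phi> \<Psi> Y) $$ (p, q)"
      using pq by (simp add: tensor_map_def)
  qed (auto simp: tensor_map_def)
qed

lemma tensor_map_kron:
  assumes \<Phi>: "linear_map dA dB \<Phi>" and \<Psi>: "linear_map dA' dB' \<Psi>"
    and X: "X \<in> carrier_mat dA dA" and Y: "Y \<in> carrier_mat dA' dA'"
  shows "tensor_map dA dB dA' dB' \<Phi> \<Psi> (kron X Y) = kron (\<Phi> X) (\<Psi> Y)"
proof (rule eq_matI)
  note c = linear_mapD(1)[OF \<Phi> X] linear_mapD(1)[OF \<Psi> Y]
  fix p q assume "p < dim_row (kron (\<Phi> X) (\<Psi> Y))" "q < dim_col (kron (\<Phi> X) (\<Psi> Y))"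
  hence pq: "p < dB * dB'" "q < dB * dB'" using c by auto
  note b = div_less_of_prod[OF pq(1)] div_less_of_prod[OF pq(2)]
  note b' = mod_less_of_prod[OF pq(1)] mod_less_of_prod[OF pq(2)]
  let ?f = "\<lambda>i j. X $$ (i, j) * \<Phi> (matrix_unit dA i j) $$ (p div dB', q div dB')"
  let ?g = "\<lambda>k l. Y $$ (k, l) * \<Psi> (matrix_unit dA' k l) $$ (p mod dB', q mod dB')"
  have "tensor_map dA dB dA' dB' \<Phi> \<Psi> (kron X Y) $$ (p, q) =
      (\<Sum>i<dA. \<Sum>j<dA. \<Sum>k<dA'. \<Sum>l<dA'. kron X Y $$ (i * dA' + k, j * dA' + l) *
        kron (\<Phi> (matrix_unit dA i j)) (\<Psi> (matrix_unit dA' k l)) $$ (p, q))"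
    using pq by (simp add: tensor_map_def)
  also have "\<dots> = (\<Sum>i<dA. \<Sum>j<dA. \<Sum>k<dA'. \<Sum>l<dA'. ?f i j * ?g k l)"
    by (intro sum.cong refl)
      (simp add: kron_index[OF X Y] pair_index_less kron_index[OF linear_mapD(1)[OF \<Phi> matrix_unit_carrier]
          linear_mapD(1)[OF \<Psi> matrix_unit_carrier] pq] mult_ac)
  also have "\<dots> = (\<Sum>i<dA. \<Sum>j<dA. ?f i j) * (\<Sum>k<dA'. \<Sum>l<dA'. ?g k l)"
    by (simp only: sum_distrib_right) (simp only: sum_distrib_left)
  also have "\<dots> = kron (\<Phi> X) (\<Psi> Y) $$ (p, q)"
    unfolding kron_index[OF c pq] linear_map_expand[OF \<Phi> X b] linear_map_expand[OF \<Psi> Y b'] ..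
  finally show "tensor_map dA dB dA' dB' \<Phi> \<Psi> (kron X Y) $$ (p, q) = kron (\<Phi> X) (\<Psi> Y) $$ (p, q)" .
qed (use linear_mapD(1)[OF \<Phi> X] linear_mapD(1)[OF \<Psi> Y] in \<open>auto simp: tensor_map_def\<close>)

lemma id_tensor_linear: "linear_map (r * dA) (r * dB) (id_tensor r dA dB \<Phi>)"
  unfolding id_tensor_def by (rule tensor_map_linear)

lemma id_tensor_kron:
  assumes "linear_map dA dB \<Phi>" "X \<in> carrier_mat r r" "Y \<in> carrier_mat dA dA"
  shows "id_tensor r dA dB \<Phi> (kron X Y) = kron X (\<Phi> Y)"
  unfolding id_tensor_def by (rule tensor_map_kron[OF linear_map_id assms])

section \<open>Swaps\<close>

text \<open>Row \<open>p\<close> picks coordinate \<open>s p\<close>, so conjugation reindexes rows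
  and columns by \<open>s\<close>; for a bijection this is a permutation matrix.\<close>

definition selection_mat :: "nat \<Rightarrow> nat \<Rightarrow> (nat \<Rightarrow> nat) \<Rightarrow> complex mat" where
  "selection_mat m n s = mat m n (\<lambda>(p, q). if q = s p then 1 else 0)"

lemma selection_mat_conj:
  assumes s: "\<And>p. p < m \<Longrightarrow> s p < n" and X: "X \<in> carrier_mat n n" and pq: "p < m" "q < m"
  shows "(selection_mat m n s * X * mat_adjoint (selection_mat m n s)) $$ (p, q) = X $$ (s p, s q)"
proof -
  let ?S = "selection_mat m n s"
  have S: "?S \<in> carrier_mat m n" by (simp add: selection_mat_def)
  have SX: "(?S * X) $$ (p, k) = X $$ (s p, k)" if "k < n" for k
  proof -
    have "(?S * X) $$ (p, k) = (\<Sum>i<n. (if i = s p then 1 else 0) * X $$ (i, k))"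
      using X S that pq by (auto simp: scalar_prod_def selection_mat_def atLeast0LessThan intro!: sum.cong)
    also have "\<dots> = (\<Sum>i<n. if i = s p then X $$ (i, k) else 0)" by (rule sum.cong) auto
    finally show ?thesis using s[OF pq(1)] by simp
  qed
  have "(?S * X * mat_adjoint ?S) $$ (p, q) = (\<Sum>k<n. (?S * X) $$ (p, k) * cnj (?S $$ (q, k)))"
    using X S pq by (auto simp: scalar_prod_def atLeast0LessThan)
  also have "\<dots> = (\<Sum>k<n. if k = s q then X $$ (s p, k) else 0)"
  proof (rule sum.cong)
    fix k assume "k \<in> {..<n}"
    hence "?S $$ (q, k) = (if k = s q then 1 else 0)" using pq by (simp add: selection_mat_def)
    thus "(?S * X) $$ (p, k) * cnj (?S $$ (q, k)) = (if k = s q then X $$ (s p, k) else 0)"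
      using SX[of k] \<open>k \<in> {..<n}\<close> by simp
  qed simp
  finally show ?thesis using s[OF pq(2)] by simp
qed

text \<open>The flip of two tensor factors of dimensions \<open>a\<close> and \<open>b\<close>: a
  row index \<open>p\<close> of the target is the pair \<open>(p div a, p mod a)\<close>, whose
  coordinates are exchanged to give the source index.\<close>

definition swap_mat :: "nat \<Rightarrow> nat \<Rightarrow> complex mat" where
  "swap_mat a b = selection_mat (b * a) (a * b) (\<lambda>p. p mod a * b + p div a)"

lemma swap_mat_carrier: "swap_mat a b \<in> carrier_mat (b * a) (a * b)"
  by (simp add: swap_mat_def selection_mat_def)

lemma swap_mat_conj:
  assumes X: "X \<in> carrier_mat a a" and Y: "Y \<in> carrier_mat b b"
  shows "swap_mat a b * kron X Y * mat_adjoint (swap_mat a b) = kron Y X"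
proof (rule eq_matI)
  fix p q assume "p < dim_row (kron Y X)" "q < dim_col (kron Y X)"
  hence pq: "p < b * a" "q < b * a" using X Y by auto
  have s: "p mod a * b + p div a < a * b" if "p < b * a" for p
    using that by (intro pair_index_less) (auto simp: mod_less_of_prod div_less_of_prod)
  have "(swap_mat a b * kron X Y * mat_adjoint (swap_mat a b)) $$ (p, q) =
      kron X Y $$ (p mod a * b + p div a, q mod a * b + q div a)"
    unfolding swap_mat_def by (rule selection_mat_conj[OF s kron_carrier[OF X Y] pq])
  also have "\<dots> = kron Y X $$ (p, q)"
    unfolding kron_index[OF X Y s[OF pq(1)] s[OF pq(2)]] kron_index[OF Y X pq]
    using div_less_of_prod[OF pq(1)] div_less_of_prod[OF pq(2)] by simp
  finally show "(swap_mat a b * kron X Y * mat_adjoint (swap_mat a b)) $$ (p, q) = kron Y X $$ (p, q)" .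
qed (use X Y swap_mat_carrier[of a b] in auto)

text \<open>Unitarity is the flip identity applied to two identity matrices.\<close>

lemma unitary_swap_mat: "unitary (a * b) (swap_mat a b)"
proof -
  have c: "swap_mat a b \<in> carrier_mat (a * b) (a * b)"
    using swap_mat_carrier[of a b] by (simp add: mult.commute)
  have "swap_mat a b * mat_adjoint (swap_mat a b) = 1\<^sub>m (a * b)"
    using swap_mat_conj[OF one_carrier_mat one_carrier_mat, of a b] c
    by (simp add: kron_one mult.commute)
  hence "unitary (a * b) (mat_adjoint (swap_mat a b))"
    using c by (intro unitaryI) auto
  thus ?thesis using unitary_adjoint[of "a * b" "mat_adjoint (swap_mat a b)"] by simp
qed

section \<open>Completely positive maps\<close>

lemma kron_one_left: "kron (1\<^sub>m 1) X = X"
  by (rule eq_matI) (auto simp: kron_def)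

text \<open>Channels are functions on all matrices and may be arbitrary outside the carrier; an
  equality on the carrier is all that proofs about them provide.\<close>

lemma id_tensor_cong:
  assumes "\<And>X. X \<in> carrier_mat a a \<Longrightarrow> \<Phi> X = \<Psi> X"
  shows "id_tensor r a b \<Phi> = id_tensor r a b \<Psi>"
  unfolding id_tensor_def tensor_map_def
  by (intro ext arg_cong[of _ _ "mat (r * b) (r * b)"]) (auto simp: assms)

lemma completely_positive_cong:
  assumes "\<And>X. X \<in> carrier_mat a a \<Longrightarrow> \<Phi> X = \<Psi> X"
  shows "completely_positive a b \<Phi> \<longleftrightarrow> completely_positive a b \<Psi>"
  using id_tensor_cong[of a \<Phi> \<Psi>, OF assms] by (simp add: completely_positive_def)

lemma id_tensor_one:
  assumes "linear_map a b \<Phi>" "X \<in> carrier_mat a a"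
  shows "id_tensor 1 a b \<Phi> X = \<Phi> X"
  using id_tensor_kron[OF assms(1) one_carrier_mat assms(2), of 1] by (simp only: kron_one_left)

lemma completely_positive_psd:
  assumes "linear_map a b \<Phi>" "completely_positive a b \<Phi>" "psd a X"
  shows "psd b (\<Phi> X)"
proof -
  have "psd (1 * b) (id_tensor 1 a b \<Phi> X)"
    using assms(2,3) unfolding completely_positive_def by (metis mult_1)
  thus ?thesis using id_tensor_one[OF assms(1) psd_carrier[OF assms(3)]] by simp
qed

lemma id_tensor_id:
  assumes "X \<in> carrier_mat (r * a) (r * a)"
  shows "id_tensor r a a (\<lambda>X. X) X = X"
  by (rule linear_map_kron_eqI[OF id_tensor_linear linear_map_id _ assms])
    (rule id_tensor_kron[OF linear_map_id])

lemma completely_positive_id: "completely_positive a a (\<lambda>X. X)"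
  unfolding completely_positive_def by (simp add: id_tensor_id psd_carrier)

lemma id_tensor_conj:
  assumes K: "K \<in> carrier_mat b a" and X: "X \<in> carrier_mat (r * a) (r * a)"
  shows "id_tensor r a b (\<lambda>X. K * X * mat_adjoint K) X =
    kron (1\<^sub>m r) K * X * mat_adjoint (kron (1\<^sub>m r) K)"
proof (rule linear_map_kron_eqI[OF id_tensor_linear linear_map_conj _ X])
  show "kron (1\<^sub>m r) K \<in> carrier_mat (r * b) (r * a)" using K by auto
  fix Y Z :: "complex mat" assume c: "Y \<in> carrier_mat r r" "Z \<in> carrier_mat a a"
  show "id_tensor r a b (\<lambda>X. K * X * mat_adjoint K) (kron Y Z) =
      kron (1\<^sub>m r) K * kron Y Z * mat_adjoint (kron (1\<^sub>m r) K)"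
    unfolding id_tensor_kron[OF linear_map_conj[OF K] c] kron_conj[OF one_carrier_mat c(1) K c(2)]
    using c by simp
qed

lemma completely_positive_conj:
  assumes "K \<in> carrier_mat b a"
  shows "completely_positive a b (\<lambda>X. K * X * mat_adjoint K)"
  unfolding completely_positive_def
proof (intro allI impI)
  fix r X assume X: "psd (r * a) X"
  show "psd (r * b) (id_tensor r a b (\<lambda>X. K * X * mat_adjoint K) X)"
    unfolding id_tensor_conj[OF assms psd_carrier[OF X]]
    by (rule psd_conj[OF X]) (use assms in auto)
qed

text \<open>\<open>id_tensor\<close> acts on the last factor only. So \<open>\<Psi>\<close> is
  applied there, a swap puts the input of \<open>\<Phi>\<close> last, \<open>\<Phi>\<close> is
  applied, and a second swap restores the order. Complete positivity of tensor products follows from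
  this factorisation.\<close>

lemma id_tensor_tensor_map:
  assumes \<Phi>: "linear_map a b \<Phi>" and \<Psi>: "linear_map a' b' \<Psi>"
    and X: "X \<in> carrier_mat (r * (a * a')) (r * (a * a'))"
  shows "id_tensor r (a * a') (b * b') (tensor_map a b a' b' \<Phi> \<Psi>) X =
    kron (1\<^sub>m r) (swap_mat b' b) *
      id_tensor (r * b') a b \<Phi>
        (kron (1\<^sub>m r) (swap_mat a b') * id_tensor (r * a) a' b' \<Psi> X * mat_adjoint (kron (1\<^sub>m r) (swap_mat a b'))) *
    mat_adjoint (kron (1\<^sub>m r) (swap_mat b' b))"
proof (rule linear_map_kron3_eqI[OF id_tensor_linear _ _ X])
  let ?S = "kron (1\<^sub>m r) (swap_mat a b')" and ?S' = "kron (1\<^sub>m r) (swap_mat b' b)"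
  have S: "?S \<in> carrier_mat ((r * b') * a) ((r * a) * b')" and S': "?S' \<in> carrier_mat (r * (b * b')) ((r * b') * b)"
    using swap_mat_carrier[of a b'] swap_mat_carrier[of b' b] by (auto simp: mult.assoc)
  have l1: "linear_map (r * (a * a')) ((r * a) * b') (id_tensor (r * a) a' b' \<Psi>)"
    using id_tensor_linear[of "r * a" a' b' \<Psi>] by (simp only: mult.assoc)
  show "linear_map (r * (a * a')) (r * (b * b'))
     (\<lambda>X. ?S' * id_tensor (r * b') a b \<Phi> (?S * id_tensor (r * a) a' b' \<Psi> X * mat_adjoint ?S) * mat_adjoint ?S')"
    by (rule linear_map_comp[OF linear_map_comp[OF linear_map_comp[OF l1 linear_map_conj[OF S]]
            id_tensor_linear] linear_map_conj[OF S']])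
  fix A B C :: "complex mat"
  assume c: "A \<in> carrier_mat r r" "B \<in> carrier_mat a a" "C \<in> carrier_mat a' a'"
  note cB = linear_mapD(1)[OF \<Phi> c(2)] and cC = linear_mapD(1)[OF \<Psi> c(3)]
  have "id_tensor (r * a) a' b' \<Psi> (kron A (kron B C)) = kron A (kron B (\<Psi> C))"
    using id_tensor_kron[OF \<Psi> kron_carrier[OF c(1,2)] c(3)] by (simp only: kron_assoc)
  moreover have "?S * kron A (kron B (\<Psi> C)) * mat_adjoint ?S = kron A (kron (\<Psi> C) B)"
    using kron_conj[OF one_carrier_mat c(1) swap_mat_carrier kron_carrier[OF c(2) cC]] c(1)
    by (simp add: swap_mat_conj[OF c(2) cC])
  moreover have "id_tensor (r * b') a b \<Phi> (kron A (kron (\<Psi> C) B)) = kron A (kron (\<Psi> C) (\<Phi> B))"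
    using id_tensor_kron[OF \<Phi> kron_carrier[OF c(1) cC] c(2)] by (simp only: kron_assoc)
  moreover have "?S' * kron A (kron (\<Psi> C) (\<Phi> B)) * mat_adjoint ?S' = kron A (kron (\<Phi> B) (\<Psi> C))"
    using kron_conj[OF one_carrier_mat c(1) swap_mat_carrier kron_carrier[OF cC cB]] c(1)
    by (simp add: swap_mat_conj[OF cC cB])
  moreover have "id_tensor r (a * a') (b * b') (tensor_map a b a' b' \<Phi> \<Psi>) (kron A (kron B C)) =
      kron A (kron (\<Phi> B) (\<Psi> C))"
    unfolding id_tensor_kron[OF tensor_map_linear c(1) kron_carrier[OF c(2,3)]]
      tensor_map_kron[OF \<Phi> \<Psi> c(2,3)] ..
  ultimately show "id_tensor r (a * a') (b * b') (tensor_map a b a' b' \<Phi> \<Psi>) (kron A (kron B C)) =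
     ?S' * id_tensor (r * b') a b \<Phi> (?S * id_tensor (r * a) a' b' \<Psi> (kron A (kron B C)) * mat_adjoint ?S) *
       mat_adjoint ?S'"
    by (simp only:)
qed

lemma completely_positive_tensor_map:
  assumes \<Phi>: "linear_map a b \<Phi>" "completely_positive a b \<Phi>"
    and \<Psi>: "linear_map a' b' \<Psi>" "completely_positive a' b' \<Psi>"
  shows "completely_positive (a * a') (b * b') (tensor_map a b a' b' \<Phi> \<Psi>)"
  unfolding completely_positive_def
proof (intro allI impI)
  fix r X assume X: "psd (r * (a * a')) X"
  let ?S = "kron (1\<^sub>m r) (swap_mat a b')" and ?S' = "kron (1\<^sub>m r) (swap_mat b' b)"
  have S: "?S \<in> carrier_mat ((r * b') * a) ((r * a) * b')" and S': "?S' \<in> carrier_mat (r * (b * b')) ((r * b') * b)"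
    using swap_mat_carrier[of a b'] swap_mat_carrier[of b' b] by (auto simp: mult.assoc)
  have "psd ((r * a) * b') (id_tensor (r * a) a' b' \<Psi> X)"
    using \<Psi>(2) X unfolding completely_positive_def mult.assoc[symmetric] by blast
  hence "psd ((r * b') * a) (?S * id_tensor (r * a) a' b' \<Psi> X * mat_adjoint ?S)"
    by (rule psd_conj[OF _ S])
  hence "psd ((r * b') * b) (id_tensor (r * b') a b \<Phi> (?S * id_tensor (r * a) a' b' \<Psi> X * mat_adjoint ?S))"
    using \<Phi>(2) by (simp only: completely_positive_def)
  thus "psd (r * (b * b')) (id_tensor r (a * a') (b * b') (tensor_map a b a' b' \<Phi> \<Psi>) X)"
    unfolding id_tensor_tensor_map[OF \<Phi>(1) \<Psi>(1) psd_carrier[OF X]] by (rule psd_conj[OF _ S'])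
qed

text \<open>The trace as a map into 1 by 1 matrices, so that comparing linear maps on product
  operators also proves identities between traces.\<close>

lemma linear_map_mtrace: "linear_map a 1 (\<lambda>X. mtrace X \<cdot>\<^sub>m 1\<^sub>m 1)"
  unfolding linear_map_def by (auto simp: mtrace_add mtrace_smult distrib_right intro!: eq_matI)

lemma trace_preserving_kronI:
  assumes \<Phi>: "linear_map (a * c) b \<Phi>"
    and eq: "\<And>X Y. X \<in> carrier_mat a a \<Longrightarrow> Y \<in> carrier_mat c c \<Longrightarrow> mtrace (\<Phi> (kron X Y)) = mtrace (kron X Y)"
  shows "trace_preserving (a * c) \<Phi>"
  unfolding trace_preserving_def
proof
  fix X :: "complex mat" assume X: "X \<in> carrier_mat (a * c) (a * c)"
  have "mtrace (\<Phi> X) \<cdot>\<^sub>m 1\<^sub>m 1 = mtrace X \<cdot>\<^sub>m (1\<^sub>m 1 :: complex mat)"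
    by (rule linear_map_kron_eqI[OF linear_map_comp[OF \<Phi> linear_map_mtrace] linear_map_mtrace _ X])
      (simp add: eq)
  hence "(mtrace (\<Phi> X) \<cdot>\<^sub>m 1\<^sub>m 1) $$ (0, 0) = (mtrace X \<cdot>\<^sub>m (1\<^sub>m 1 :: complex mat)) $$ (0, 0)" by simp
  thus "mtrace (\<Phi> X) = mtrace X" by simp
qed

lemma CPTP_D:
  assumes "\<Phi> \<in> CPTP a b"
  shows "linear_map a b \<Phi>" "completely_positive a b \<Phi>" "X \<in> carrier_mat a a \<Longrightarrow> mtrace (\<Phi> X) = mtrace X"
    "psd a X \<Longrightarrow> psd b (\<Phi> X)"
  using assms completely_positive_psd by (auto simp: CPTP_def trace_preserving_def)

lemma CPTP_id: "(\<lambda>X. X) \<in> CPTP a a"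
  by (simp add: CPTP_def linear_map_id completely_positive_id trace_preserving_def)

lemma CPTP_unitary_conj: "unitary a U \<Longrightarrow> (\<lambda>X. U * X * mat_adjoint U) \<in> CPTP a a"
  by (simp add: CPTP_def linear_map_conj completely_positive_conj trace_preserving_def
      mtrace_unitary_conj unitary_carrier)

lemma CPTP_tensor_map:
  assumes "\<Phi> \<in> CPTP a b" "\<Psi> \<in> CPTP a' b'"
  shows "tensor_map a b a' b' \<Phi> \<Psi> \<in> CPTP (a * a') (b * b')"
proof -
  note \<Phi> = CPTP_D[OF assms(1)] and \<Psi> = CPTP_D[OF assms(2)]
  have "trace_preserving (a * a') (tensor_map a b a' b' \<Phi> \<Psi>)"
    by (rule trace_preserving_kronI[OF tensor_map_linear])
      (simp add: tensor_map_kron[OF \<Phi>(1) \<Psi>(1)] mtrace_kron[OF linear_mapD(1)[OF \<Phi>(1)] linear_mapD(1)[OF \<Psi>(1)]]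
        \<Phi>(3) \<Psi>(3) mtrace_kron)
  thus ?thesis
    by (simp add: CPTP_def tensor_map_linear completely_positive_tensor_map[OF \<Phi>(1,2) \<Psi>(1,2)])
qed

lemma CPTP_id_tensor: "\<Phi> \<in> CPTP a b \<Longrightarrow> id_tensor r a b \<Phi> \<in> CPTP (r * a) (r * b)"
  unfolding id_tensor_def by (rule CPTP_tensor_map[OF CPTP_id])

lemma CPTP_tensor_power: "\<Phi> \<in> CPTP a b \<Longrightarrow> tensor_power a b \<Phi> n \<in> CPTP (a ^ n) (b ^ n)"
  by (induction n) (auto intro: CPTP_id CPTP_tensor_map)

lemma linear_map_tensor_power: "linear_map (a ^ n) (b ^ n) (tensor_power a b \<Phi> n)"
  by (cases n) (simp_all add: linear_map_id tensor_map_linear)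

text \<open>Merges the memory of a strategy with the identity factor of the channel into one
  reference of dimension \<open>r * s\<close>.\<close>

lemma id_tensor_assoc:
  assumes "linear_map a b \<Phi>" "X \<in> carrier_mat (r * s * a) (r * s * a)"
  shows "id_tensor r (s * a) (s * b) (id_tensor s a b \<Phi>) X = id_tensor (r * s) a b \<Phi> X"
proof (rule linear_map_kron3_eqI[of r s a "r * s * b" "id_tensor r (s * a) (s * b) (id_tensor s a b \<Phi>)"])
  show "linear_map (r * (s * a)) (r * s * b) (id_tensor r (s * a) (s * b) (id_tensor s a b \<Phi>))"
    using id_tensor_linear[of r "s * a" "s * b"] by (simp only: mult.assoc)
  show "linear_map (r * (s * a)) (r * s * b) (id_tensor (r * s) a b \<Phi>)"
    using id_tensor_linear[of "r * s" a b] by (simp only: mult.assoc)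
  show "X \<in> carrier_mat (r * (s * a)) (r * (s * a))" using assms(2) by (simp only: mult.assoc)
  fix A B C :: "complex mat" assume c: "A \<in> carrier_mat r r" "B \<in> carrier_mat s s" "C \<in> carrier_mat a a"
  show "id_tensor r (s * a) (s * b) (id_tensor s a b \<Phi>) (kron A (kron B C)) =
      id_tensor (r * s) a b \<Phi> (kron A (kron B C))"
    using id_tensor_kron[OF assms(1) kron_carrier[OF c(1,2)] c(3)]
    unfolding id_tensor_kron[OF id_tensor_linear c(1) kron_carrier[OF c(2,3)]]
      id_tensor_kron[OF assms(1) c(2,3)] kron_assoc by simp
qed

section \<open>Kronecker powers\<close>

primrec kron_power :: "complex mat \<Rightarrow> nat \<Rightarrow> complex mat" where
  "kron_power X 0 = 1\<^sub>m 1"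
| "kron_power X (Suc n) = kron X (kron_power X n)"

lemma kron_power_carrier: "X \<in> carrier_mat a b \<Longrightarrow> kron_power X n \<in> carrier_mat (a ^ n) (b ^ n)"
  by (induction n) auto

lemma psd_kron_power: "psd a X \<Longrightarrow> psd (a ^ n) (kron_power X n)"
  by (induction n) (auto intro: psd_one psd_kron simp: psd_one[of 1, simplified])

lemma mtrace_kron_power: "X \<in> carrier_mat a a \<Longrightarrow> mtrace (kron_power X n) = mtrace X ^ n"
  by (induction n) (auto simp: mtrace_kron[OF _ kron_power_carrier] mtrace_def[of "1\<^sub>m _"])

lemma kron_power_mult:
  assumes "A \<in> carrier_mat a b" "B \<in> carrier_mat b c"
  shows "kron_power A n * kron_power B n = kron_power (A * B) n"
  by (induction n)
    (simp_all add: kron_mult[OF assms(1) kron_power_carrier[OF assms(1)] assms(2) kron_power_carrier[OF assms(2)]])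

lemma tensor_power_kron_power:
  assumes "linear_map a b \<Phi>" "X \<in> carrier_mat a a"
  shows "tensor_power a b \<Phi> n (kron_power X n) = kron_power (\<Phi> X) n"
  by (induction n)
    (simp_all add: tensor_map_kron[OF assms(1) linear_map_tensor_power assms(2) kron_power_carrier[OF assms(2)]])

text \<open>The complement is \<open>1 - X\<close> tensor \<open>1\<close> plus \<open>X\<close>
  tensor \<open>1 - Y\<close>.\<close>

lemma tests_kron:
  assumes "X \<in> tests a" "Y \<in> tests b"
  shows "kron X Y \<in> tests (a * b)"
proof -
  note X = testsD[OF assms(1)] and Y = testsD[OF assms(2)]
  have "1\<^sub>m (a * b) - kron X Y = kron (1\<^sub>m a - X) (1\<^sub>m b) + kron X (1\<^sub>m b - Y)"
    unfolding kron_minus_left[OF one_carrier_mat X(3) one_carrier_mat]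
      kron_minus_right[OF X(3) one_carrier_mat Y(3)] kron_one
    using X(3) Y(3) by (intro eq_matI) auto
  moreover have "psd (a * b) \<dots>" by (intro psd_add psd_kron X Y psd_one)
  ultimately show ?thesis using psd_kron[OF X(1) Y(1)] by (simp add: tests_def)
qed

lemma tests_one: "1\<^sub>m d \<in> tests d"
proof -
  have e: "1\<^sub>m d - 1\<^sub>m d = (0\<^sub>m d d :: complex mat)" by (rule eq_matI) auto
  show ?thesis unfolding tests_def mem_Collect_eq e by (intro conjI psd_one psd_zero)
qed

lemma tests_kron_power: "T \<in> tests d \<Longrightarrow> kron_power T n \<in> tests (d ^ n)"
  by (induction n) (auto simp: tests_kron tests_one[of 1, simplified])

section \<open>Domination of completely positive maps\<close>

text \<open>Positivity of the difference would not do: the bound has to survive the presence of a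
  memory and the passage to tensor powers.\<close>

definition cp_dominated :: "nat \<Rightarrow> nat \<Rightarrow> real \<Rightarrow> (complex mat \<Rightarrow> complex mat) \<Rightarrow> (complex mat \<Rightarrow> complex mat) \<Rightarrow> bool"
  where "cp_dominated a b c \<Phi> \<Psi> \<longleftrightarrow> completely_positive a b (\<lambda>X. complex_of_real c \<cdot>\<^sub>m \<Psi> X - \<Phi> X)"

lemma cp_dominated_psd:
  assumes "linear_map a b \<Phi>" "linear_map a b \<Psi>" "cp_dominated a b c \<Phi> \<Psi>" "psd a X"
  shows "psd b (complex_of_real c \<cdot>\<^sub>m \<Psi> X - \<Phi> X)"
  using completely_positive_psd[OF linear_map_combination[OF assms(1,2)] _ assms(4)] assms(3)
  unfolding cp_dominated_def by blast

lemma cp_dominated_id: "cp_dominated a a 1 (\<lambda>X. X) (\<lambda>X. X)"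
  unfolding cp_dominated_def completely_positive_def
proof (intro allI impI)
  fix r X assume X: "psd (r * a) X"
  have "id_tensor r a a (\<lambda>X. complex_of_real 1 \<cdot>\<^sub>m X - X) X = 0 \<cdot>\<^sub>m X"
  proof (rule linear_map_kron_eqI[OF id_tensor_linear _ _ psd_carrier[OF X]])
    show "linear_map (r * a) (r * a) (\<lambda>X. 0 \<cdot>\<^sub>m X)"
      by (auto simp: linear_map_def)
    fix A B :: "complex mat" assume c: "A \<in> carrier_mat r r" "B \<in> carrier_mat a a"
    have "complex_of_real 1 \<cdot>\<^sub>m B - B = 0 \<cdot>\<^sub>m B" by (rule eq_matI) auto
    thus "id_tensor r a a (\<lambda>X. complex_of_real 1 \<cdot>\<^sub>m X - X) (kron A B) = 0 \<cdot>\<^sub>m kron A B"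
      using id_tensor_kron[OF linear_map_combination[OF linear_map_id linear_map_id] c, of "complex_of_real 1"]
      by (simp add: kron_smult_right)
  qed
  thus "psd (r * a) (id_tensor r a a (\<lambda>X. complex_of_real 1 \<cdot>\<^sub>m X - X) X)"
    using psd_smult[OF X, of 0] by simp
qed

lemma linear_map_scaled_add:
  assumes "linear_map a b \<Phi>" "linear_map a b \<Psi>"
  shows "linear_map a b (\<lambda>X. c \<cdot>\<^sub>m \<Phi> X + \<Psi> X)"
  unfolding linear_map_def
proof (intro conjI ballI allI)
  fix X :: "complex mat" assume X: "X \<in> carrier_mat a a"
  note cX = linear_mapD(1)[OF assms(1) X] linear_mapD(1)[OF assms(2) X]
  show "c \<cdot>\<^sub>m \<Phi> X + \<Psi> X \<in> carrier_mat b b" using cX by simp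
  show "c \<cdot>\<^sub>m \<Phi> (e \<cdot>\<^sub>m X) + \<Psi> (e \<cdot>\<^sub>m X) = e \<cdot>\<^sub>m (c \<cdot>\<^sub>m \<Phi> X + \<Psi> X)" for e
    unfolding linear_mapD(3)[OF assms(1) X] linear_mapD(3)[OF assms(2) X]
    using cX by (intro eq_matI) (auto simp: algebra_simps)
  fix Y :: "complex mat" assume Y: "Y \<in> carrier_mat a a"
  note cY = linear_mapD(1)[OF assms(1) Y] linear_mapD(1)[OF assms(2) Y]
  show "c \<cdot>\<^sub>m \<Phi> (X + Y) + \<Psi> (X + Y) = c \<cdot>\<^sub>m \<Phi> X + \<Psi> X + (c \<cdot>\<^sub>m \<Phi> Y + \<Psi> Y)"
    unfolding linear_mapD(2)[OF assms(1) X Y] linear_mapD(2)[OF assms(2) X Y]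
    using cX cY by (intro eq_matI) (auto simp: algebra_simps)
qed

lemma completely_positive_scaled_add:
  assumes \<Phi>: "linear_map a b \<Phi>" "completely_positive a b \<Phi>"
    and \<Psi>: "linear_map a b \<Psi>" "completely_positive a b \<Psi>" and c: "0 \<le> c"
  shows "completely_positive a b (\<lambda>X. complex_of_real c \<cdot>\<^sub>m \<Phi> X + \<Psi> X)"
  unfolding completely_positive_def
proof (intro allI impI)
  fix r X assume X: "psd (r * a) X"
  have "id_tensor r a b (\<lambda>X. complex_of_real c \<cdot>\<^sub>m \<Phi> X + \<Psi> X) X =
      complex_of_real c \<cdot>\<^sub>m id_tensor r a b \<Phi> X + id_tensor r a b \<Psi> X"
  proof (rule linear_map_kron_eqI[OF id_tensor_linear linear_map_scaled_add[OF id_tensor_linear id_tensor_linear]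
        _ psd_carrier[OF X]])
    fix A B :: "complex mat" assume AB: "A \<in> carrier_mat r r" "B \<in> carrier_mat a a"
    show "id_tensor r a b (\<lambda>X. complex_of_real c \<cdot>\<^sub>m \<Phi> X + \<Psi> X) (kron A B) =
        complex_of_real c \<cdot>\<^sub>m id_tensor r a b \<Phi> (kron A B) + id_tensor r a b \<Psi> (kron A B)"
      unfolding id_tensor_kron[OF linear_map_scaled_add[OF \<Phi>(1) \<Psi>(1)] AB] id_tensor_kron[OF \<Phi>(1) AB]
        id_tensor_kron[OF \<Psi>(1) AB] kron_smult_right[symmetric]
      by (rule kron_add_right[OF AB(1) smult_carrier_mat[OF linear_mapD(1)[OF \<Phi>(1) AB(2)]]
            linear_mapD(1)[OF \<Psi>(1) AB(2)]])
  qed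
  moreover have "psd (r * b) (id_tensor r a b \<Phi> X)" "psd (r * b) (id_tensor r a b \<Psi> X)"
    using \<Phi>(2) \<Psi>(2) X by (auto simp: completely_positive_def)
  ultimately show "psd (r * b) (id_tensor r a b (\<lambda>X. complex_of_real c \<cdot>\<^sub>m \<Phi> X + \<Psi> X) X)"
    using c by (simp add: psd_add psd_smult)
qed

text \<open>With juxtaposition for the tensor product, \<open>c c' \<Psi> \<Psi>' - \<Phi> \<Phi>' =
  c \<Psi> (c' \<Psi>' - \<Phi>') + (c \<Psi> - \<Phi>) \<Phi>'\<close>, and both terms on the right
  are completely positive.\<close>

lemma cp_dominated_tensor_map:
  assumes \<Phi>: "linear_map a b \<Phi>" and \<Psi>: "linear_map a b \<Psi>" "completely_positive a b \<Psi>"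
    and \<Phi>': "linear_map a' b' \<Phi>'" "completely_positive a' b' \<Phi>'" and \<Psi>': "linear_map a' b' \<Psi>'"
    and dom: "cp_dominated a b c \<Phi> \<Psi>" "cp_dominated a' b' c' \<Phi>' \<Psi>'" and c: "0 \<le> c"
  shows "cp_dominated (a * a') (b * b') (c * c') (tensor_map a b a' b' \<Phi> \<Phi>') (tensor_map a b a' b' \<Psi> \<Psi>')"
proof -
  let ?D = "\<lambda>X. complex_of_real c \<cdot>\<^sub>m \<Psi> X - \<Phi> X" and ?D' = "\<lambda>X. complex_of_real c' \<cdot>\<^sub>m \<Psi>' X - \<Phi>' X"
  let ?L = "\<lambda>X. complex_of_real (c * c') \<cdot>\<^sub>m tensor_map a b a' b' \<Psi> \<Psi>' X - tensor_map a b a' b' \<Phi> \<Phi>' X"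
  let ?R = "\<lambda>X. complex_of_real c \<cdot>\<^sub>m tensor_map a b a' b' \<Psi> ?D' X + tensor_map a b a' b' ?D \<Phi>' X"
  note lD = linear_map_combination[OF \<Phi> \<Psi>(1), of "complex_of_real c"]
  note lD' = linear_map_combination[OF \<Phi>'(1) \<Psi>', of "complex_of_real c'"]
  have "?L X = ?R X" if X: "X \<in> carrier_mat (a * a') (a * a')" for X
  proof (rule linear_map_kron_eqI[OF linear_map_combination[OF tensor_map_linear tensor_map_linear]
        linear_map_scaled_add[OF tensor_map_linear tensor_map_linear] _ X])
    fix Y Z :: "complex mat" assume YZ: "Y \<in> carrier_mat a a" "Z \<in> carrier_mat a' a'"
    note cs = linear_mapD(1)[OF \<Phi> YZ(1)] linear_mapD(1)[OF \<Psi>(1) YZ(1)]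
      linear_mapD(1)[OF \<Phi>'(1) YZ(2)] linear_mapD(1)[OF \<Psi>' YZ(2)]
    show "?L (kron Y Z) = ?R (kron Y Z)"
      unfolding tensor_map_kron[OF \<Phi> \<Phi>'(1) YZ] tensor_map_kron[OF \<Psi>(1) \<Psi>' YZ]
        tensor_map_kron[OF \<Psi>(1) lD' YZ] tensor_map_kron[OF lD \<Phi>'(1) YZ]
        kron_minus_right[OF cs(2) smult_carrier_mat[OF cs(4)] cs(3)]
        kron_minus_left[OF smult_carrier_mat[OF cs(2)] cs(1,3)] kron_smult_left kron_smult_right
      using cs by (intro eq_matI) (auto simp: algebra_simps)
  qed
  moreover have "completely_positive (a * a') (b * b') ?R"
    using dom unfolding cp_dominated_def
    by (intro completely_positive_scaled_add tensor_map_linear completely_positive_tensor_map lD lD' \<Psi> \<Phi>' c)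
  ultimately show ?thesis
    unfolding cp_dominated_def using completely_positive_cong[of "a * a'" ?L ?R] by simp
qed

lemma cp_dominated_id_tensor:
  assumes "linear_map a b \<Phi>" "completely_positive a b \<Phi>" "linear_map a b \<Psi>" "cp_dominated a b c \<Phi> \<Psi>"
  shows "cp_dominated (r * a) (r * b) c (id_tensor r a b \<Phi>) (id_tensor r a b \<Psi>)"
  using cp_dominated_tensor_map[OF linear_map_id linear_map_id completely_positive_id assms(1-3)
      cp_dominated_id assms(4)]
  by (simp add: id_tensor_def)

lemma cp_dominated_tensor_power:
  assumes "\<Phi> \<in> CPTP a b" "\<Psi> \<in> CPTP a b" "cp_dominated a b c \<Phi> \<Psi>" "0 \<le> c"
  shows "cp_dominated (a ^ n) (b ^ n) (c ^ n) (tensor_power a b \<Phi> n) (tensor_power a b \<Psi> n)"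
proof (induction n)
  case 0
  show ?case using cp_dominated_id[of 1] by simp
next
  case (Suc n)
  show ?case
    using cp_dominated_tensor_map[OF CPTP_D(1)[OF assms(1)] CPTP_D(1,2)[OF assms(2)]
        CPTP_D(1,2)[OF CPTP_tensor_power[OF assms(1)]] CPTP_D(1)[OF CPTP_tensor_power[OF assms(2)]]
        assms(3) Suc assms(4)]
    by simp
qed

section \<open>Bounds that do not depend on the size of the reference\<close>

section \<open>Reduction of the reference system\<close>

text \<open>Not normalised: the sum of the vectors \<open>e_i\<close> tensor \<open>e_i\<close>, of
  squared norm \<open>a\<close>. In this form it is the vectorisation of the identity.\<close>

definition max_entangled :: "nat \<Rightarrow> complex vec" where
  "max_entangled a = vec (a * a) (\<lambda>i. if i div a = i mod a then 1 else 0)"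

lemma max_entangled_carrier: "max_entangled a \<in> carrier_vec (a * a)"
  by (simp add: max_entangled_def)

text \<open>Vectorisation: \<open>v\<close> is reshaped into an operator on the reference, which
  creates \<open>v\<close> from the vectorised identity.\<close>

lemma kron_one_max_entangled:
  assumes v: "v \<in> carrier_vec (r * a)"
  shows "kron (mat r a (\<lambda>(x, k). v $ (x * a + k))) (1\<^sub>m a) *\<^sub>v max_entangled a = v"
proof (rule eq_vecI)
  let ?V = "mat r a (\<lambda>(x, k). v $ (x * a + k))"
  have V: "?V \<in> carrier_mat r a" by simp
  fix p assume "p < dim_vec v"
  hence p: "p < r * a" using v by simp
  note b = div_less_of_prod[OF p] mod_less_of_prod[OF p]
  have "(kron ?V (1\<^sub>m a) *\<^sub>v max_entangled a) $ p =
      (\<Sum>k<a * a. kron ?V (1\<^sub>m a) $$ (p, k) * max_entangled a $ k)"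
    using p by (simp add: scalar_prod_def max_entangled_def atLeast0LessThan)
  also have "\<dots> = (\<Sum>k<a * a. (?V $$ (p div a, k div a) * 1\<^sub>m a $$ (p mod a, k mod a)) *
      (if k div a = k mod a then 1 else 0))"
    using p by (intro sum.cong refl) (simp add: kron_index[OF V one_carrier_mat] max_entangled_def)
  also have "\<dots> = (\<Sum>i<a. \<Sum>j<a. (?V $$ (p div a, i) * 1\<^sub>m a $$ (p mod a, j)) * (if i = j then 1 else 0))"
    by (rule sum_div_mod)
  also have "\<dots> = (\<Sum>i<a. \<Sum>j<a. if i = j then ?V $$ (p div a, i) * 1\<^sub>m a $$ (p mod a, i) else 0)"
    by (intro sum.cong refl) simp
  also have "\<dots> = (\<Sum>i<a. ?V $$ (p div a, i) * 1\<^sub>m a $$ (p mod a, i))" by simp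
  also have "\<dots> = (\<Sum>i<a. if i = p mod a then ?V $$ (p div a, i) else 0)"
    using b by (intro sum.cong refl) simp
  also have "\<dots> = v $ p" using b by simp
  finally show "(kron ?V (1\<^sub>m a) *\<^sub>v max_entangled a) $ p = v $ p" .
qed (use v in auto)

lemma id_tensor_kron_conj:
  assumes \<Phi>: "linear_map a b \<Phi>" and G: "G \<in> carrier_mat r s" and X: "X \<in> carrier_mat (s * a) (s * a)"
  shows "id_tensor r a b \<Phi> (kron G (1\<^sub>m a) * X * mat_adjoint (kron G (1\<^sub>m a))) =
    kron G (1\<^sub>m b) * id_tensor s a b \<Phi> X * mat_adjoint (kron G (1\<^sub>m b))"
proof (rule linear_map_kron_eqI[OF linear_map_comp[OF linear_map_conj id_tensor_linear]
      linear_map_comp[OF id_tensor_linear linear_map_conj] _ X])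
  show "kron G (1\<^sub>m a) \<in> carrier_mat (r * a) (s * a)" "kron G (1\<^sub>m b) \<in> carrier_mat (r * b) (s * b)"
    using G by auto
  fix Y Z :: "complex mat" assume c: "Y \<in> carrier_mat s s" "Z \<in> carrier_mat a a"
  note cZ = linear_mapD(1)[OF \<Phi> c(2)]
  have GY: "G * Y * mat_adjoint G \<in> carrier_mat r r" using G c by (intro carrier_matI) auto
  show "id_tensor r a b \<Phi> (kron G (1\<^sub>m a) * kron Y Z * mat_adjoint (kron G (1\<^sub>m a))) =
      kron G (1\<^sub>m b) * id_tensor s a b \<Phi> (kron Y Z) * mat_adjoint (kron G (1\<^sub>m b))"
    unfolding id_tensor_kron[OF \<Phi> c] kron_conj[OF G c(1) one_carrier_mat c(2)]
      kron_conj[OF G c(1) one_carrier_mat cZ]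
    using id_tensor_kron[OF \<Phi> GY c(2)] c cZ by simp
qed

text \<open>A polar decomposition. If \<open>U\<close> diagonalises \<open>mat_adjoint V * V\<close>
  with eigenvalues \<open>l\<close>, then \<open>Z\<close> is the diagonal of
  \<open>sqrt (l i)\<close> times \<open>mat_adjoint U\<close>, and \<open>G\<close> is
  \<open>V * U\<close> times the diagonal of the pseudo-inverses \<open>t i\<close>.
  \<open>G\<close> is a partial isometry, hence a contraction even when \<open>V\<close> has a
  kernel.\<close>

lemma contraction_factor:
  fixes V :: "complex mat"
  assumes V: "V \<in> carrier_mat r d"
  shows "\<exists>G\<in>carrier_mat r d. \<exists>Z\<in>carrier_mat d d.
    V = G * Z \<and> psd d (1\<^sub>m d - mat_adjoint G * G) \<and> mat_adjoint Z * Z = mat_adjoint V * V"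
proof -
  have "psd d (mat_adjoint V * V)" using psd_gram[OF mat_adjoint_carrier[OF V]] by simp
  then obtain U l where U: "unitary d U" "\<forall>i<d. 0 \<le> l i"
      "mat_adjoint V * V = U * mat_diag d (\<lambda>i. complex_of_real (l i)) * mat_adjoint U"
    using psd_diagonalisation by metis
  have Uc: "U \<in> carrier_mat d d" and UU: "mat_adjoint U * U = 1\<^sub>m d" "U * mat_adjoint U = 1\<^sub>m d"
    using U by (auto simp: unitary_def)
  define D where "D f = mat_diag d (\<lambda>i. complex_of_real (f i))" for f
  have Dc: "D f \<in> carrier_mat d d" for f by (simp add: D_def)
  have Dd: "dim_row (D f) = d" "dim_col (D f) = d" for f by (simp_all add: D_def mat_diag_def)
  have Dm: "D f * D g = D (\<lambda>i. f i * g i)" for f g by (simp add: D_def)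
  have Da: "mat_adjoint (D f) = D f" for f by (simp add: D_def mat_adjoint_diag)
  have Dcong: "D f = D g" if "\<And>i. i < d \<Longrightarrow> f i = g i" for f g
    unfolding D_def using that by (intro eq_matI) (auto simp: mat_diag_def)
  define t where "t i = (if l i = 0 then 0 else 1 / sqrt (l i))" for i
  define W where "W = V * U"
  define G where "G = W * D t"
  define Z where "Z = D (\<lambda>i. sqrt (l i)) * mat_adjoint U"
  have Wc: "W \<in> carrier_mat r d" using V Uc by (simp add: W_def)
  have Gc: "G \<in> carrier_mat r d" using Wc Dc by (simp add: G_def)
  have Zc: "Z \<in> carrier_mat d d" using Uc Dc unfolding Z_def by (intro mult_carrier_mat) auto
  have WW: "mat_adjoint W * W = D l"
  proof -
    have "mat_adjoint W * W = mat_adjoint U * (mat_adjoint V * V) * U"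
      unfolding W_def using carrier_matD[OF V] carrier_matD[OF Uc] by (simp only: mat_assoc)
    also have "\<dots> = D l" unfolding U(3) D_def by (rule unitary_conj_diag[OF U(1) mat_diag_dim])
    finally show ?thesis .
  qed
  \<comment> \<open>Column \<open>i\<close> of \<open>W\<close> has squared norm \<open>l i\<close>,
    so nothing is lost where the pseudo-inverse \<open>t\<close> is 0.\<close>
  have W0: "W $$ (k, i) = 0" if "k < r" "i < d" "l i = 0" for k i
  proof -
    have "(mat_adjoint W * W) $$ (i, i) = (\<Sum>k<r. cnj (W $$ (k, i)) * W $$ (k, i))"
      using Wc that by (auto simp: scalar_prod_def atLeast0LessThan)
    moreover have "(mat_adjoint W * W) $$ (i, i) = 0"
      unfolding WW using that by (simp add: D_def mat_diag_def)
    ultimately have "(\<Sum>k<r. cnj (W $$ (k, i)) * W $$ (k, i)) = 0" by simp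
    moreover have "complex_of_real (\<Sum>k<r. (cmod (W $$ (k, i)))\<^sup>2) = (\<Sum>k<r. cnj (W $$ (k, i)) * W $$ (k, i))"
      unfolding of_real_sum by (intro sum.cong refl) (simp only: complex_norm_square mult.commute)
    ultimately have "complex_of_real (\<Sum>k<r. (cmod (W $$ (k, i)))\<^sup>2) = 0" by simp
    hence "(\<Sum>k<r. (cmod (W $$ (k, i)))\<^sup>2) = 0" using of_real_eq_0_iff by blast
    thus ?thesis using that(1) by (simp add: sum_nonneg_eq_0_iff)
  qed
  have ts: "t i * sqrt (l i) = (if l i = 0 then 0 else 1)" for i by (simp add: t_def)
  have WD: "W * D (\<lambda>i. t i * sqrt (l i)) = W"
  proof -
    have "W * D (\<lambda>i. t i * sqrt (l i)) = mat r d (\<lambda>(k, i). W $$ (k, i) * complex_of_real (t i * sqrt (l i)))"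
      unfolding D_def by (rule mat_diag_mult_right[OF Wc])
    also have "\<dots> = W" using Wc W0 unfolding ts by (intro eq_matI) auto
    finally show ?thesis .
  qed
  have "G * Z = W * (D t * D (\<lambda>i. sqrt (l i))) * mat_adjoint U"
    unfolding G_def Z_def using carrier_matD[OF Wc] carrier_matD[OF Uc] by (simp only: mat_assoc Dd)
  also have "\<dots> = V * (U * mat_adjoint U)"
    unfolding Dm WD using carrier_matD[OF V] carrier_matD[OF Uc] by (simp only: W_def mat_assoc)
  finally have GZ: "V = G * Z" unfolding UU using V by simp
  have "mat_adjoint G * G = D t * (mat_adjoint W * W) * D t"
    unfolding G_def using carrier_matD[OF Wc] by (simp only: mat_assoc Dd Da)
  also have "\<dots> = D (\<lambda>i. if l i = 0 then 0 else 1)"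
    unfolding WW Dm using U(2) by (intro Dcong) (auto simp: t_def field_simps)
  finally have GG: "mat_adjoint G * G = D (\<lambda>i. if l i = 0 then 0 else 1)" .
  have "1\<^sub>m d - mat_adjoint G * G = D (\<lambda>i. if l i = 0 then 1 else 0)"
    unfolding GG D_def by (rule eq_matI) (auto simp: mat_diag_def)
  hence con: "psd d (1\<^sub>m d - mat_adjoint G * G)"
    unfolding D_def using psd_diag[of d "\<lambda>i. if l i = 0 then 1 else 0"] by simp
  have "mat_adjoint Z * Z = U * (D (\<lambda>i. sqrt (l i)) * D (\<lambda>i. sqrt (l i))) * mat_adjoint U"
    unfolding Z_def using carrier_matD[OF Uc] by (simp only: mat_assoc Dd Da)
  also have "D (\<lambda>i. sqrt (l i)) * D (\<lambda>i. sqrt (l i)) = D l"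
    unfolding Dm using U(2) by (intro Dcong) auto
  finally have "mat_adjoint Z * Z = mat_adjoint V * V" unfolding U(3) D_def .
  with Gc Zc GZ con show ?thesis by blast
qed

text \<open>The Schmidt rank of \<open>v\<close> is at most \<open>a\<close>, so a reference of
  dimension \<open>a\<close> suffices. As \<open>r\<close> may be smaller than \<open>a\<close>, the
  map back is a contraction and not an isometry. The norms of \<open>z\<close> and \<open>v\<close>
  agree because \<open>Z\<close> and \<open>V\<close> have the same Gram matrix.\<close>

lemma reference_reduction:
  assumes v: "v \<in> carrier_vec (r * a)"
  shows "\<exists>G\<in>carrier_mat r a. \<exists>z\<in>carrier_vec (a * a).
    kron G (1\<^sub>m a) *\<^sub>v z = v \<and> psd a (1\<^sub>m a - mat_adjoint G * G) \<and> mtrace (rank1 z) = mtrace (rank1 v)"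
proof -
  define V where "V = mat r a (\<lambda>(x, k). v $ (x * a + k))"
  have V: "V \<in> carrier_mat r a" by (simp add: V_def)
  have vV: "kron V (1\<^sub>m a) *\<^sub>v max_entangled a = v"
    unfolding V_def by (rule kron_one_max_entangled[OF v])
  obtain G Z where GZ: "G \<in> carrier_mat r a" "Z \<in> carrier_mat a a" "V = G * Z"
      "psd a (1\<^sub>m a - mat_adjoint G * G)" "mat_adjoint Z * Z = mat_adjoint V * V"
    using contraction_factor[OF V] by blast
  define z where "z = kron Z (1\<^sub>m a) *\<^sub>v max_entangled a"
  have G1: "kron G (1\<^sub>m a) \<in> carrier_mat (r * a) (a * a)" and Z1: "kron Z (1\<^sub>m a) \<in> carrier_mat (a * a) (a * a)"
    and V1: "kron V (1\<^sub>m a) \<in> carrier_mat (r * a) (a * a)"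
    using GZ V by auto
  have z: "z \<in> carrier_vec (a * a)" unfolding z_def using Z1 by (intro carrier_vecI) auto
  have "kron G (1\<^sub>m a) *\<^sub>v z = (kron G (1\<^sub>m a) * kron Z (1\<^sub>m a)) *\<^sub>v max_entangled a"
    unfolding z_def by (rule assoc_mult_mat_vec[OF G1 Z1 max_entangled_carrier, symmetric])
  also have "kron G (1\<^sub>m a) * kron Z (1\<^sub>m a) = kron V (1\<^sub>m a)"
    using kron_mult[OF GZ(1) one_carrier_mat GZ(2) one_carrier_mat] GZ(3) by simp
  finally have Gz: "kron G (1\<^sub>m a) *\<^sub>v z = v" using vV by simp
  have tr: "mtrace (rank1 (kron K (1\<^sub>m a) *\<^sub>v max_entangled a)) =
      mtrace (kron (mat_adjoint K * K) (1\<^sub>m a) * rank1 (max_entangled a))"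
    if K: "K \<in> carrier_mat s a" for K s
  proof -
    have K1: "kron K (1\<^sub>m a) \<in> carrier_mat (s * a) (a * a)" using K by auto
    note me = rank1_carrier[OF max_entangled_carrier]
    have c: "kron K (1\<^sub>m a) * rank1 (max_entangled a) * mat_adjoint (kron K (1\<^sub>m a)) \<in> carrier_mat (s * a) (s * a)"
      using K1 me by (intro carrier_matI) auto
    have "mtrace (rank1 (kron K (1\<^sub>m a) *\<^sub>v max_entangled a)) =
        mtrace (1\<^sub>m (s * a) * (kron K (1\<^sub>m a) * rank1 (max_entangled a) * mat_adjoint (kron K (1\<^sub>m a))))"
      using left_mult_one_mat[OF c] rank1_conj[OF K1 max_entangled_carrier] by simp
    also have "\<dots> = mtrace ((mat_adjoint (kron K (1\<^sub>m a)) * 1\<^sub>m (s * a) * kron K (1\<^sub>m a)) * rank1 (max_entangled a))"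
      by (rule mtrace_conj_test[OF K1 me one_carrier_mat])
    also have "mat_adjoint (kron K (1\<^sub>m a)) * 1\<^sub>m (s * a) = mat_adjoint (kron K (1\<^sub>m a))"
      by (rule right_mult_one_mat[OF mat_adjoint_carrier[OF K1]])
    also have "mat_adjoint (kron K (1\<^sub>m a)) * kron K (1\<^sub>m a) = kron (mat_adjoint K * K) (1\<^sub>m a)"
      unfolding mat_adjoint_kron
      using kron_mult[OF mat_adjoint_carrier[OF K] one_carrier_mat K one_carrier_mat] by simp
    finally show ?thesis .
  qed
  have "mtrace (rank1 z) = mtrace (rank1 v)"
    using tr[OF GZ(2)] tr[OF V] unfolding vV z_def GZ(5) by simp
  with GZ(1,4) z Gz show ?thesis by blast
qed

text \<open>A contraction is enough: the complement of the pulled-back test is the pulled-back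
  complement plus \<open>1 - mat_adjoint G * G\<close> tensored with the identity, and both are
  positive.\<close>

lemma tests_pullback:
  assumes T: "T \<in> tests (r * b)" and G: "G \<in> carrier_mat r s" "psd s (1\<^sub>m s - mat_adjoint G * G)"
  shows "mat_adjoint (kron G (1\<^sub>m b)) * T * kron G (1\<^sub>m b) \<in> tests (s * b)"
proof -
  let ?G = "kron G (1\<^sub>m b)"
  note T' = testsD[OF T]
  have G1: "?G \<in> carrier_mat (r * b) (s * b)" using G by auto
  have GG: "mat_adjoint ?G * ?G = kron (mat_adjoint G * G) (1\<^sub>m b)"
    unfolding mat_adjoint_kron
    using kron_mult[OF mat_adjoint_carrier[OF G(1)] one_carrier_mat G(1) one_carrier_mat] by simp
  have conj: "psd (s * b) (mat_adjoint ?G * X * ?G)" if "psd (r * b) X" for X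
    using psd_conj[OF that mat_adjoint_carrier[OF G1]] by simp
  have T1: "mat_adjoint ?G * (1\<^sub>m (r * b) - T) * ?G = mat_adjoint ?G * ?G - mat_adjoint ?G * T * ?G"
    using linear_map_minus[OF linear_map_conj[OF mat_adjoint_carrier[OF G1]] one_carrier_mat T'(3)]
      right_mult_one_mat[OF mat_adjoint_carrier[OF G1]] by simp
  have "1\<^sub>m (s * b) - mat_adjoint ?G * T * ?G =
      kron (1\<^sub>m s - mat_adjoint G * G) (1\<^sub>m b) + mat_adjoint ?G * (1\<^sub>m (r * b) - T) * ?G"
  proof -
    have GGc: "mat_adjoint G * G \<in> carrier_mat s s" using G(1) by auto
    have c: "mat_adjoint ?G * T * ?G \<in> carrier_mat (s * b) (s * b)" "mat_adjoint ?G * ?G \<in> carrier_mat (s * b) (s * b)"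
      using G1 T'(3) by (auto intro!: carrier_matI)
    show ?thesis
      unfolding T1 kron_minus_left[OF one_carrier_mat GGc one_carrier_mat] kron_one GG[symmetric]
      using c by (intro eq_matI) auto
  qed
  moreover have "psd (s * b) \<dots>" by (intro psd_add psd_kron G(2) psd_one conj T')
  ultimately show ?thesis using conj[OF T'(1)] by (simp add: tests_def)
qed

text \<open>The contraction of \<open>reference_reduction\<close> commutes with the maps and is absorbed by the test.\<close>

lemma id_tensor_bound:
  assumes \<Phi>: "linear_map a b \<Phi>" and \<Psi>: "linear_map a b \<Psi>"
    and bound: "\<And>z T. z \<in> carrier_vec (a * a) \<Longrightarrow> T \<in> tests (a * b) \<Longrightarrow>
      Re (mtrace (T * id_tensor a a b \<Phi> (rank1 z))) \<le>
      \<mu> * Re (mtrace (T * id_tensor a a b \<Psi> (rank1 z))) + \<kappa> * Re (mtrace (rank1 z))"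
    and X: "psd (r * a) X" and T: "T \<in> tests (r * b)"
  shows "Re (mtrace (T * id_tensor r a b \<Phi> X)) \<le>
    \<mu> * Re (mtrace (T * id_tensor r a b \<Psi> X)) + \<kappa> * Re (mtrace X)"
proof -
  \<comment> \<open>The slack of the claimed inequality. It is additive and real-homogeneous in the
    input, so only rank-one inputs remain.\<close>
  define g where "g X = \<mu> * Re (mtrace (T * id_tensor r a b \<Psi> X)) + \<kappa> * Re (mtrace X)
    - Re (mtrace (T * id_tensor r a b \<Phi> X))" for X
  note Tc = testsD(3)[OF T]
  note lin = id_tensor_linear[of r a b]
  have "0 \<le> g X"
  proof (rule psd_rank1_induct[OF _ _ _ X])
    fix Y Z :: "complex mat" assume c: "Y \<in> carrier_mat (r * a) (r * a)" "Z \<in> carrier_mat (r * a) (r * a)"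
    show "g (Y + Z) = g Y + g Z"
      unfolding g_def linear_mapD(2)[OF lin c] mtrace_add[OF c]
        mtrace_test_add[OF Tc linear_mapD(1)[OF lin c(1)] linear_mapD(1)[OF lin c(2)]]
      by (simp add: algebra_simps)
  next
    fix Y :: "complex mat" and e :: real assume c: "Y \<in> carrier_mat (r * a) (r * a)"
    show "g (complex_of_real e \<cdot>\<^sub>m Y) = e * g Y"
      unfolding g_def linear_mapD(3)[OF lin c] mtrace_smult[OF c]
        mtrace_test_smult[OF Tc linear_mapD(1)[OF lin c]]
      by (simp add: algebra_simps)
  next
    fix v :: "complex vec" assume v: "v \<in> carrier_vec (r * a)"
    obtain G z where G: "G \<in> carrier_mat r a" "z \<in> carrier_vec (a * a)" "kron G (1\<^sub>m a) *\<^sub>v z = v"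
        "psd a (1\<^sub>m a - mat_adjoint G * G)" "mtrace (rank1 z) = mtrace (rank1 v)"
      using reference_reduction[OF v] by blast
    have G1: "kron G (1\<^sub>m a) \<in> carrier_mat (r * a) (a * a)" "kron G (1\<^sub>m b) \<in> carrier_mat (r * b) (a * b)"
      using G by auto
    note zc = rank1_carrier[OF G(2)]
    have "rank1 v = kron G (1\<^sub>m a) * rank1 z * mat_adjoint (kron G (1\<^sub>m a))"
      using rank1_conj[OF G1(1) G(2)] G(3) by simp
    hence "mtrace (T * id_tensor r a b \<Theta> (rank1 v)) =
        mtrace ((mat_adjoint (kron G (1\<^sub>m b)) * T * kron G (1\<^sub>m b)) * id_tensor a a b \<Theta> (rank1 z))"
      if "linear_map a b \<Theta>" for \<Theta>
      using id_tensor_kron_conj[OF that G(1) zc]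
        mtrace_conj_test[OF G1(2) linear_mapD(1)[OF id_tensor_linear zc] Tc] by simp
    thus "0 \<le> g (rank1 v)"
      using bound[OF G(2) tests_pullback[OF T G(1,4)]] \<Phi> \<Psi> G(5) by (simp add: g_def)
  qed
  thus ?thesis by (simp add: g_def)
qed

text \<open>Choi's criterion: every rank-one input with reference \<open>r\<close> arises from the
  maximally entangled one by a conjugation on the reference, which commutes with
  \<open>\<Phi>\<close>.\<close>

lemma choi_completely_positive:
  assumes \<Phi>: "linear_map a b \<Phi>" and psd: "psd (a * b) (id_tensor a a b \<Phi> (rank1 (max_entangled a)))"
  shows "completely_positive a b \<Phi>"
  unfolding completely_positive_def
proof (intro allI impI)
  fix r X assume X: "psd (r * a) X"
  note lin = id_tensor_linear[of r a b]
  have rk: "psd (r * b) (id_tensor r a b \<Phi> (rank1 v))" if v: "v \<in> carrier_vec (r * a)" for v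
  proof -
    define V where "V = mat r a (\<lambda>(x, k). v $ (x * a + k))"
    have V: "V \<in> carrier_mat r a" by (simp add: V_def)
    have V1: "kron V (1\<^sub>m a) \<in> carrier_mat (r * a) (a * a)" "kron V (1\<^sub>m b) \<in> carrier_mat (r * b) (a * b)"
      using V by auto
    have "rank1 v = kron V (1\<^sub>m a) * rank1 (max_entangled a) * mat_adjoint (kron V (1\<^sub>m a))"
      using rank1_conj[OF V1(1) max_entangled_carrier] kron_one_max_entangled[OF v] by (simp add: V_def)
    thus ?thesis
      using id_tensor_kron_conj[OF \<Phi> V rank1_carrier[OF max_entangled_carrier]] psd_conj[OF psd V1(2)]
      by simp
  qed
  have c: "id_tensor r a b \<Phi> X \<in> carrier_mat (r * b) (r * b)"
    by (rule linear_mapD(1)[OF lin psd_carrier[OF X]])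
  \<comment> \<open>\<open>psd_rank1_induct\<close> handles real functionals; nonnegativity in the
    complex order follows from the instances \<open>Re\<close>, \<open>Im\<close> and minus
    \<open>Im\<close>.\<close>
  have form: "0 \<le> h ((id_tensor r a b \<Phi> X *\<^sub>v w) \<bullet>c w)"
    if w: "w \<in> carrier_vec (r * b)"
      and h: "\<And>x y. h (x + y) = h x + h y" "\<And>x e. h (complex_of_real e * x) = e * h x"
        "\<And>x :: complex. 0 \<le> x \<Longrightarrow> 0 \<le> h x"
    for w and h :: "complex \<Rightarrow> real"
  proof (rule psd_rank1_induct[OF _ _ _ X])
    fix Y Z :: "complex mat" assume c: "Y \<in> carrier_mat (r * a) (r * a)" "Z \<in> carrier_mat (r * a) (r * a)"
    note cY = linear_mapD(1)[OF lin c(1)] and cZ = linear_mapD(1)[OF lin c(2)]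
    have cw: "id_tensor r a b \<Phi> Y *\<^sub>v w \<in> carrier_vec (r * b)" "id_tensor r a b \<Phi> Z *\<^sub>v w \<in> carrier_vec (r * b)"
      using carrier_matD[OF cY] carrier_matD[OF cZ] by (auto intro!: carrier_vecI)
    show "h ((id_tensor r a b \<Phi> (Y + Z) *\<^sub>v w) \<bullet>c w) =
        h ((id_tensor r a b \<Phi> Y *\<^sub>v w) \<bullet>c w) + h ((id_tensor r a b \<Phi> Z *\<^sub>v w) \<bullet>c w)"
      unfolding linear_mapD(2)[OF lin c] add_mult_distrib_mat_vec[OF cY cZ w]
        cscalar_add_left[OF cw w] h(1) ..
  next
    fix Y :: "complex mat" and e :: real assume c: "Y \<in> carrier_mat (r * a) (r * a)"
    note cY = linear_mapD(1)[OF lin c]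
    have cw: "id_tensor r a b \<Phi> Y *\<^sub>v w \<in> carrier_vec (r * b)"
      using carrier_matD[OF cY] by (auto intro!: carrier_vecI)
    show "h ((id_tensor r a b \<Phi> (complex_of_real e \<cdot>\<^sub>m Y) *\<^sub>v w) \<bullet>c w) = e * h ((id_tensor r a b \<Phi> Y *\<^sub>v w) \<bullet>c w)"
      unfolding linear_mapD(3)[OF lin c] smult_mult_mat_vec[OF cY w] cscalar_smult_left[OF cw w] h(2) ..
  next
    fix v :: "complex vec" assume v: "v \<in> carrier_vec (r * a)"
    show "0 \<le> h ((id_tensor r a b \<Phi> (rank1 v) *\<^sub>v w) \<bullet>c w)"
      by (rule h(3)) (use rk[OF v] w in \<open>simp add: psd_def\<close>)
  qed
  show "psd (r * b) (id_tensor r a b \<Phi> X)"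
    unfolding psd_def
  proof (intro conjI ballI c)
    fix w :: "complex vec" assume w: "w \<in> carrier_vec (r * b)"
    show "0 \<le> (id_tensor r a b \<Phi> X *\<^sub>v w) \<bullet>c w"
      using form[OF w, of Re] form[OF w, of Im] form[OF w, of "\<lambda>x. - Im x"]
      by (simp add: less_eq_complex_def)
  qed
qed

section \<open>Regrouping the references of tensor powers\<close>

definition swap_middle :: "nat \<Rightarrow> nat \<Rightarrow> nat \<Rightarrow> nat \<Rightarrow> complex mat" where
  "swap_middle q a r c = kron (1\<^sub>m q) (kron (swap_mat a r) (1\<^sub>m c))"

lemma unitary_kron:
  assumes "unitary a U" "unitary b V"
  shows "unitary (a * b) (kron U V)"
proof (rule unitaryI)
  have c: "U \<in> carrier_mat a a" "V \<in> carrier_mat b b" using assms by (auto simp: unitary_def)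
  show "kron U V \<in> carrier_mat (a * b) (a * b)" using c by auto
  show "mat_adjoint (kron U V) * kron U V = 1\<^sub>m (a * b)"
    unfolding mat_adjoint_kron
      kron_mult[OF mat_adjoint_carrier[OF c(1)] mat_adjoint_carrier[OF c(2)] c]
    using assms by (simp add: unitary_def kron_one)
qed

lemma unitary_one: "unitary d (1\<^sub>m d)"
  by (simp add: unitary_def)

lemma swap_middle_carrier: "swap_middle q a r c \<in> carrier_mat (q * r * (a * c)) (q * a * (r * c))"
  using kron_carrier[OF one_carrier_mat kron_carrier[OF swap_mat_carrier one_carrier_mat], of q a r c]
  by (simp add: swap_middle_def mult_ac)

lemma unitary_swap_middle: "unitary (q * (a * r * c)) (swap_middle q a r c)"
  unfolding swap_middle_def by (intro unitary_kron unitary_one unitary_swap_mat)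

lemma swap_middle_conj:
  assumes "X \<in> carrier_mat q q" "Y \<in> carrier_mat a a" "Z \<in> carrier_mat r r" "W \<in> carrier_mat c c"
  shows "swap_middle q a r c * kron (kron X Y) (kron Z W) * mat_adjoint (swap_middle q a r c) =
    kron (kron X Z) (kron Y W)"
proof -
  have "swap_middle q a r c * kron X (kron (kron Y Z) W) * mat_adjoint (swap_middle q a r c) =
      kron X (kron (kron Z Y) W)"
    unfolding swap_middle_def
      kron_conj[OF one_carrier_mat assms(1) kron_carrier[OF swap_mat_carrier one_carrier_mat]
        kron_carrier[OF kron_carrier[OF assms(2,3)] assms(4)]]
      kron_conj[OF swap_mat_carrier kron_carrier[OF assms(2,3)] one_carrier_mat assms(4)]
      swap_mat_conj[OF assms(2,3)]
    using assms by simp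
  thus ?thesis by (simp only: kron_assoc)
qed

text \<open>The permutation that sorts m pairs of factors of dimensions \<open>q\<close> and
  \<open>a\<close> so that all factors of dimension \<open>q\<close> come first: the tail is
  regrouped, then its references are moved past the first factor of dimension
  \<open>a\<close>.\<close>

primrec regroup :: "nat \<Rightarrow> nat \<Rightarrow> nat \<Rightarrow> complex mat" where
  "regroup q a 0 = 1\<^sub>m 1"
| "regroup q a (Suc m) = swap_middle q a (q ^ m) (a ^ m) * kron (1\<^sub>m (q * a)) (regroup q a m)"

lemma unitary_regroup: "unitary ((q * a) ^ m) (regroup q a m)"
proof (induction m)
  case 0
  show ?case by (simp add: unitary_one[of 1, simplified])
next
  case (Suc m)
  have "q * (a * q ^ m * a ^ m) = (q * a) ^ Suc m" by (simp add: power_mult_distrib mult_ac)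
  hence "unitary ((q * a) ^ Suc m) (swap_middle q a (q ^ m) (a ^ m))"
    using unitary_swap_middle[of q a "q ^ m" "a ^ m"] by metis
  moreover have "unitary ((q * a) ^ Suc m) (kron (1\<^sub>m (q * a)) (regroup q a m))"
    using unitary_kron[OF unitary_one Suc] by simp
  ultimately show ?case using unitary_mult by simp
qed

lemma regroup_carrier: "regroup q a m \<in> carrier_mat (q ^ m * a ^ m) ((q * a) ^ m)"
  using unitary_carrier[OF unitary_regroup[of q a m]] by (simp add: power_mult_distrib)

lemma linear_map_kron_left:
  assumes "X \<in> carrier_mat a a"
  shows "linear_map c (a * c) (\<lambda>Y. kron X Y)"
  unfolding linear_map_def
  using assms by (auto simp: kron_add_right[OF assms] kron_smult_right)

text \<open>The inductive step of regrouping. \<open>Z\<close> may be entangled with its reference,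
  but both sides are linear in it, so products suffice.\<close>

lemma swap_middle_id_tensor:
  assumes \<Phi>: "linear_map a b \<Phi>" and \<Psi>: "linear_map c d \<Psi>"
    and X: "X \<in> carrier_mat q q" and Y: "Y \<in> carrier_mat a a" and Z: "Z \<in> carrier_mat (r * c) (r * c)"
  shows "swap_middle q b r d * kron (kron X (\<Phi> Y)) (id_tensor r c d \<Psi> Z) * mat_adjoint (swap_middle q b r d) =
    id_tensor (q * r) (a * c) (b * d) (tensor_map a b c d \<Phi> \<Psi>)
      (swap_middle q a r c * kron (kron X Y) Z * mat_adjoint (swap_middle q a r c))"
proof (rule linear_map_kron_eqI[OF _ _ _ Z])
  note cY = linear_mapD(1)[OF \<Phi> Y]
  show "linear_map (r * c) (q * r * (b * d))
      (\<lambda>Z. swap_middle q b r d * kron (kron X (\<Phi> Y)) (id_tensor r c d \<Psi> Z) * mat_adjoint (swap_middle q b r d))"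
    by (rule linear_map_comp[OF linear_map_comp[OF id_tensor_linear linear_map_kron_left[OF kron_carrier[OF X cY]]]
          linear_map_conj[OF swap_middle_carrier]])
  show "linear_map (r * c) (q * r * (b * d)) (\<lambda>Z. id_tensor (q * r) (a * c) (b * d) (tensor_map a b c d \<Phi> \<Psi>)
      (swap_middle q a r c * kron (kron X Y) Z * mat_adjoint (swap_middle q a r c)))"
    by (rule linear_map_comp[OF linear_map_comp[OF linear_map_kron_left[OF kron_carrier[OF X Y]]
          linear_map_conj[OF swap_middle_carrier]] id_tensor_linear])
  fix A B :: "complex mat" assume c: "A \<in> carrier_mat r r" "B \<in> carrier_mat c c"
  note cB = linear_mapD(1)[OF \<Psi> c(2)]
  show "swap_middle q b r d * kron (kron X (\<Phi> Y)) (id_tensor r c d \<Psi> (kron A B)) * mat_adjoint (swap_middle q b r d) =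
    id_tensor (q * r) (a * c) (b * d) (tensor_map a b c d \<Phi> \<Psi>)
      (swap_middle q a r c * kron (kron X Y) (kron A B) * mat_adjoint (swap_middle q a r c))"
    unfolding id_tensor_kron[OF \<Psi> c] swap_middle_conj[OF X cY c(1) cB] swap_middle_conj[OF X Y c]
      id_tensor_kron[OF tensor_map_linear kron_carrier[OF X c(1)] kron_carrier[OF Y c(2)]]
      tensor_map_kron[OF \<Phi> \<Psi> Y c(2)] ..
qed

lemma mult_conj:
  fixes A :: "complex mat"
  assumes "A \<in> carrier_mat a b" "B \<in> carrier_mat b c" "X \<in> carrier_mat c c"
  shows "(A * B) * X * mat_adjoint (A * B) = A * (B * X * mat_adjoint B) * mat_adjoint A"
  using carrier_matD[OF assms(1)] carrier_matD[OF assms(2)] carrier_matD[OF assms(3)]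
  by (simp only: mat_assoc)

lemma regroup_Suc_conj:
  assumes X: "X \<in> carrier_mat (q * a) (q * a)" and Y: "Y \<in> carrier_mat ((q * a) ^ m) ((q * a) ^ m)"
  shows "regroup q a (Suc m) * kron X Y * mat_adjoint (regroup q a (Suc m)) =
    swap_middle q a (q ^ m) (a ^ m) * kron X (regroup q a m * Y * mat_adjoint (regroup q a m)) *
      mat_adjoint (swap_middle q a (q ^ m) (a ^ m))"
proof -
  have K: "kron (1\<^sub>m (q * a)) (regroup q a m) \<in> carrier_mat (q * a * (q ^ m * a ^ m)) (q * a * (q * a) ^ m)"
    using regroup_carrier by auto
  have "regroup q a (Suc m) * kron X Y * mat_adjoint (regroup q a (Suc m)) =
      swap_middle q a (q ^ m) (a ^ m) *
      (kron (1\<^sub>m (q * a)) (regroup q a m) * kron X Y * mat_adjoint (kron (1\<^sub>m (q * a)) (regroup q a m))) *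
      mat_adjoint (swap_middle q a (q ^ m) (a ^ m))"
    unfolding regroup.simps by (rule mult_conj[OF swap_middle_carrier K kron_carrier[OF X Y]])
  also have "kron (1\<^sub>m (q * a)) (regroup q a m) * kron X Y * mat_adjoint (kron (1\<^sub>m (q * a)) (regroup q a m)) =
      kron X (regroup q a m * Y * mat_adjoint (regroup q a m))"
    using kron_conj[OF one_carrier_mat X regroup_carrier Y] X by simp
  finally show ?thesis .
qed

text \<open>The references attached to the m copies become one reference of dimension
  \<open>q ^ m\<close> next to the m-fold power of \<open>\<Phi>\<close>, the shape to which the
  reduction of the reference applies.\<close>

lemma regroup_tensor_power:
  assumes \<Phi>: "linear_map a b \<Phi>" and X: "X \<in> carrier_mat ((q * a) ^ m) ((q * a) ^ m)"
  shows "regroup q b m * tensor_power (q * a) (q * b) (id_tensor q a b \<Phi>) m X * mat_adjoint (regroup q b m) =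
    id_tensor (q ^ m) (a ^ m) (b ^ m) (tensor_power a b \<Phi> m) (regroup q a m * X * mat_adjoint (regroup q a m))"
  using X
proof (induction m arbitrary: X)
  case 0
  hence X: "X \<in> carrier_mat 1 1" by simp
  have "1\<^sub>m 1 * X * mat_adjoint (1\<^sub>m 1) = X" using X by simp
  moreover have "id_tensor 1 1 1 (\<lambda>X. X) X = X" by (rule id_tensor_id) (use X in simp)
  ultimately show ?case by simp
next
  case (Suc m)
  let ?E = "id_tensor q a b \<Phi>" and ?T = "tensor_power (q * a) (q * b) (id_tensor q a b \<Phi>) m"
    and ?R = "\<lambda>a m. regroup q a m" and ?P = "tensor_power a b \<Phi> m"
  have lT: "linear_map ((q * a) ^ m) ((q * b) ^ m) ?T" by (rule linear_map_tensor_power)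
  have lP: "linear_map (a ^ m) (b ^ m) ?P" by (rule linear_map_tensor_power)
  have X: "X \<in> carrier_mat (q * (a * (q * a) ^ m)) (q * (a * (q * a) ^ m))"
    using Suc.prems by (simp add: mult.assoc)
  let ?L = "\<lambda>X. ?R b (Suc m) * tensor_power (q * a) (q * b) ?E (Suc m) X * mat_adjoint (?R b (Suc m))"
  let ?Q = "\<lambda>X. id_tensor (q ^ Suc m) (a ^ Suc m) (b ^ Suc m) (tensor_power a b \<Phi> (Suc m))
      (?R a (Suc m) * X * mat_adjoint (?R a (Suc m)))"
  show "?L X = ?Q X"
  proof (rule linear_map_kron3_eqI[of q a "(q * a) ^ m" "q ^ Suc m * b ^ Suc m" ?L ?Q, OF _ _ _ X])
    have d: "q * (a * (q * a) ^ m) = (q * a) ^ Suc m" by simp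
    show "linear_map (q * (a * (q * a) ^ m)) (q ^ Suc m * b ^ Suc m) ?L"
      unfolding d by (rule linear_map_comp[OF linear_map_tensor_power linear_map_conj[OF regroup_carrier]])
    show "linear_map (q * (a * (q * a) ^ m)) (q ^ Suc m * b ^ Suc m) ?Q"
      unfolding d by (rule linear_map_comp[OF linear_map_conj[OF regroup_carrier] id_tensor_linear])
    fix A B C :: "complex mat"
    assume c: "A \<in> carrier_mat q q" "B \<in> carrier_mat a a" "C \<in> carrier_mat ((q * a) ^ m) ((q * a) ^ m)"
    note cB = linear_mapD(1)[OF \<Phi> c(2)] and cC = linear_mapD(1)[OF lT c(3)]
    have cR: "?R a m * C * mat_adjoint (?R a m) \<in> carrier_mat (q ^ m * a ^ m) (q ^ m * a ^ m)"
      by (rule linear_mapD(1)[OF linear_map_conj[OF regroup_carrier] c(3)])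
    have "tensor_power (q * a) (q * b) ?E (Suc m) (kron (kron A B) C) = kron (kron A (\<Phi> B)) (?T C)"
      using tensor_map_kron[OF id_tensor_linear[of q a b \<Phi>] lT kron_carrier[OF c(1,2)] c(3)]
        id_tensor_kron[OF \<Phi> c(1,2)] by simp
    hence "?L (kron (kron A B) C) = swap_middle q b (q ^ m) (b ^ m) *
        kron (kron A (\<Phi> B)) (?R b m * ?T C * mat_adjoint (?R b m)) * mat_adjoint (swap_middle q b (q ^ m) (b ^ m))"
      using regroup_Suc_conj[OF kron_carrier[OF c(1) cB] cC] by simp
    also have "\<dots> = id_tensor (q * q ^ m) (a * a ^ m) (b * b ^ m) (tensor_map a b (a ^ m) (b ^ m) \<Phi> ?P)
      (swap_middle q a (q ^ m) (a ^ m) * kron (kron A B) (?R a m * C * mat_adjoint (?R a m)) *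
        mat_adjoint (swap_middle q a (q ^ m) (a ^ m)))"
      unfolding Suc.IH[OF c(3)] by (rule swap_middle_id_tensor[OF \<Phi> lP c(1,2) cR])
    also have "\<dots> = ?Q (kron (kron A B) C)"
      unfolding regroup_Suc_conj[OF kron_carrier[OF c(1,2)] c(3)] by simp
    finally show "?L (kron A (kron B C)) = ?Q (kron A (kron B C))" by (simp only: kron_assoc)
  qed
qed

section \<open>The bound for sequential strategies\<close>

section \<open>Adaptive sequences of channels\<close>

lemma CPTP_comp:
  assumes "\<Phi> \<in> CPTP a b" "\<Psi> \<in> CPTP b c"
  shows "(\<lambda>X. \<Psi> (\<Phi> X)) \<in> CPTP a c"
proof -
  note \<Phi> = CPTP_D[OF assms(1)] and \<Psi> = CPTP_D[OF assms(2)]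
  have "id_tensor r a c (\<lambda>X. \<Psi> (\<Phi> X)) X = id_tensor r b c \<Psi> (id_tensor r a b \<Phi> X)"
    if X: "X \<in> carrier_mat (r * a) (r * a)" for r X
  proof (rule linear_map_kron_eqI[OF id_tensor_linear linear_map_comp[OF id_tensor_linear id_tensor_linear] _ X])
    fix Y Z :: "complex mat" assume c: "Y \<in> carrier_mat r r" "Z \<in> carrier_mat a a"
    show "id_tensor r a c (\<lambda>X. \<Psi> (\<Phi> X)) (kron Y Z) = id_tensor r b c \<Psi> (id_tensor r a b \<Phi> (kron Y Z))"
      unfolding id_tensor_kron[OF linear_map_comp[OF \<Phi>(1) \<Psi>(1)] c] id_tensor_kron[OF \<Phi>(1) c]
        id_tensor_kron[OF \<Psi>(1) c(1) linear_mapD(1)[OF \<Phi>(1) c(2)]] ..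
  qed
  hence "completely_positive a c (\<lambda>X. \<Psi> (\<Phi> X))"
    using \<Phi>(2) \<Psi>(2) psd_carrier unfolding completely_positive_def by metis
  thus ?thesis
    using linear_map_comp[OF \<Phi>(1) \<Psi>(1)] \<Phi>(3) \<Psi>(3) linear_mapD(1)[OF \<Phi>(1)]
    by (simp add: CPTP_def trace_preserving_def)
qed

text \<open>In contrast to \<open>seq_state\<close>, every use is followed by a processing map, the
  last one included, and the channel may vary from step to step. Dropping the first step therefore
  leaves an object of the same kind.\<close>

primrec adaptive :: "(nat \<Rightarrow> complex mat \<Rightarrow> complex mat) \<Rightarrow> (nat \<Rightarrow> complex mat \<Rightarrow> complex mat) \<Rightarrow> nat
    \<Rightarrow> complex mat \<Rightarrow> complex mat" where
  "adaptive e P 0 X = X"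
| "adaptive e P (Suc n) X = P n (e n (adaptive e P n X))"

text \<open>The recursion adds steps at the end, whereas the induction over a strategy splits off
  the first use.\<close>

lemma adaptive_shift:
  "adaptive e P (Suc n) X = adaptive (\<lambda>i. e (Suc i)) (\<lambda>i. P (Suc i)) n (P 0 (e 0 X))"
  by (induction n) simp_all

lemma adaptive_CPTP:
  assumes "\<And>i. i < n \<Longrightarrow> e i \<in> CPTP (a i) (b i)" "\<And>i. i < n \<Longrightarrow> P i \<in> CPTP (b i) (a (Suc i))"
  shows "adaptive e P n \<in> CPTP (a 0) (a n)"
  using assms
proof (induction n)
  case 0
  have "adaptive e P 0 = (\<lambda>X. X)" by (rule ext) simp
  thus ?case by (simp add: CPTP_id)
next
  case (Suc n)
  have IH: "adaptive e P n \<in> CPTP (a 0) (a n)" by (rule Suc.IH) (use Suc.prems in auto)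
  have "adaptive e P (Suc n) = (\<lambda>X. P n (e n (adaptive e P n X)))" by (rule ext) simp
  moreover have "(\<lambda>X. P n (e n (adaptive e P n X))) \<in> CPTP (a 0) (a (Suc n))"
    by (rule CPTP_comp[OF CPTP_comp[OF IH Suc.prems(1)[of n]] Suc.prems(2)[of n]]) simp_all
  ultimately show ?case by simp
qed

lemma psd_mtrace_eq_0:
  assumes "psd d X" "Re (mtrace X) = 0"
  shows "X = 0\<^sub>m d d"
proof -
  obtain U l where U: "unitary d U" "\<forall>i<d. 0 \<le> l i"
      "X = U * mat_diag d (\<lambda>i. complex_of_real (l i)) * mat_adjoint U"
    using psd_diagonalisation[OF assms(1)] by auto
  have Uc: "U \<in> carrier_mat d d" using U by (simp add: unitary_def)
  have "mtrace X = mtrace (mat_diag d (\<lambda>i. complex_of_real (l i)))"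
    unfolding U(3) by (rule mtrace_unitary_conj[OF U(1) mat_diag_dim])
  also have "\<dots> = complex_of_real (\<Sum>i<d. l i)" by (simp add: mtrace_def mat_diag_def)
  finally have "(\<Sum>i<d. l i) = 0" using assms(2) by simp
  hence l: "l i = 0" if "i < d" for i using U(2) sum_nonneg_eq_0_iff[of "{..<d}" l] that by auto
  show ?thesis
  proof (rule eq_matI)
    fix p q assume "p < dim_row (0\<^sub>m d d :: complex mat)" "q < dim_col (0\<^sub>m d d :: complex mat)"
    thus "X $$ (p, q) = 0\<^sub>m d d $$ (p, q)"
      unfolding U(3) by (simp add: diag_conj_index[OF Uc] l)
  qed (use psd_carrier[OF assms(1)] in auto)
qed

text \<open>The trace of the positive part \<open>D\<close> of \<open>e X - \<mu> f X\<close> is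
  attained at a test and so is at most \<open>\<kappa>\<close> times that of \<open>X\<close>; the
  operator decomposition is applied with \<open>\<mu> f X\<close> as \<open>S\<close>. Constants, in
  multiples of the trace of \<open>X\<close>: \<open>B\<close> is below \<open>D + \<eta>\<close>,
  which gives 2 \<kappa>, and \<open>A\<close> is below \<open>2 e X + 2 B\<close>, which gives 2 +
  4 \<kappa> \<le> 6. As multiple of \<open>f X\<close>, the bound \<open>2 e X + 2 A\<close> on
  \<open>B\<close> gives 2 \<Lambda> + 2 \<mu> \<le> 4 \<Lambda>.\<close>

lemma channel_split:
  assumes e: "e \<in> CPTP a b" and f: "f \<in> CPTP a b" and X: "psd a X"
    and bound: "\<And>T. T \<in> tests b \<Longrightarrow> Re (mtrace (T * e X)) \<le> \<mu> * Re (mtrace (T * f X)) + \<kappa> * Re (mtrace X)"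
    and dom: "psd b (complex_of_real \<Lambda> \<cdot>\<^sub>m f X - e X)"
    and par: "0 \<le> \<mu>" "\<mu> \<le> \<Lambda>" "0 < \<kappa>" "\<kappa> \<le> 1"
  shows "\<exists>A B. psd b A \<and> psd b B \<and> psd b (2 \<cdot>\<^sub>m A + 2 \<cdot>\<^sub>m B - e X) \<and>
    psd b (complex_of_real \<mu> \<cdot>\<^sub>m f X - A) \<and> psd b (complex_of_real (4 * \<Lambda>) \<cdot>\<^sub>m f X - B) \<and>
    Re (mtrace A) \<le> 6 * Re (mtrace X) \<and> Re (mtrace B) \<le> 2 * \<kappa> * Re (mtrace X)"
proof -
  note e' = CPTP_D[OF e] and f' = CPTP_D[OF f]
  note Xc = psd_carrier[OF X]
  note eX = e'(4)[OF X] and fX = f'(4)[OF X]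
  note ec = psd_carrier[OF eX] and fc = psd_carrier[OF fX]
  show ?thesis
  proof (cases "Re (mtrace X) = 0")
    \<comment> \<open>Here no positive \<open>\<eta>\<close> would be small enough for the trace
      bound; \<open>e X\<close> vanishes and both parts are taken to be 0.\<close>
    case True
    hence e0: "e X = 0\<^sub>m b b" by (intro psd_mtrace_eq_0[OF eX]) (simp add: e'(3)[OF Xc])
    have m: "c \<cdot>\<^sub>m f X - 0\<^sub>m b b = c \<cdot>\<^sub>m f X" for c using fc by (intro eq_matI) auto
    have z: "2 \<cdot>\<^sub>m 0\<^sub>m b b + 2 \<cdot>\<^sub>m 0\<^sub>m b b - 0\<^sub>m b b = (0\<^sub>m b b :: complex mat)" by (rule eq_matI) auto
    have "psd b (complex_of_real \<mu> \<cdot>\<^sub>m f X - 0\<^sub>m b b)" "psd b (complex_of_real (4 * \<Lambda>) \<cdot>\<^sub>m f X - 0\<^sub>m b b)"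
      unfolding m using par by (auto intro!: psd_smult[OF fX] simp del: of_real_mult)
    moreover have "psd b (2 \<cdot>\<^sub>m 0\<^sub>m b b + 2 \<cdot>\<^sub>m 0\<^sub>m b b - e X)" unfolding e0 z by (rule psd_zero)
    moreover have "mtrace (0\<^sub>m b b) = 0" by (simp add: mtrace_def)
    ultimately show ?thesis using True psd_zero by (intro exI[of _ "0\<^sub>m b b"]) auto
  next
    case False
    hence tX: "0 < Re (mtrace X)" using psd_mtrace(1)[OF X] by simp
    let ?S = "complex_of_real \<mu> \<cdot>\<^sub>m f X"
    have S: "psd b ?S" by (rule psd_smult[OF fX par(1)])
    note Sc = psd_carrier[OF S]
    have "mat_adjoint (e X - ?S) = e X - ?S"
      using mat_adjoint_minus[OF ec Sc] psd_hermitian[OF eX] psd_hermitian[OF S] by simp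
    then obtain D T where D: "psd b D" "T \<in> tests b" "psd b (D - (e X - ?S))" "mtrace D = mtrace (T * (e X - ?S))"
      using positive_part[OF minus_carrier_mat[OF Sc]] by blast
    note Dc = psd_carrier[OF D(1)] and Tc = testsD(3)[OF D(2)]
    have trD: "Re (mtrace D) \<le> \<kappa> * Re (mtrace X)"
      using bound[OF D(2)] unfolding D(4) mtrace_test_minus[OF Tc ec Sc] mtrace_test_smult[OF Tc fc] by simp
    \<comment> \<open>So small that the multiple of the identity adds at most another
      \<open>\<kappa>\<close> times the trace of \<open>X\<close>; the \<open>+ 1\<close> covers
      \<open>b = 0\<close>.\<close>
    define \<eta> where "\<eta> = \<kappa> * Re (mtrace X) / (real b + 1)"
    have eta: "0 < \<eta>" using tX par by (simp add: \<eta>_def)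
    have eta_b: "\<eta> * real b \<le> \<kappa> * Re (mtrace X)"
      using tX par by (simp add: \<eta>_def field_simps)
    have "?S + D - e X = D - (e X - ?S)" using fc Dc ec by (intro eq_matI) auto
    hence le: "psd b (?S + D - e X)" using D(3) by simp
    obtain A B where AB: "psd b A" "psd b B" "psd b (2 \<cdot>\<^sub>m A + 2 \<cdot>\<^sub>m B - e X)" "psd b (?S - A)"
        "psd b (D + complex_of_real \<eta> \<cdot>\<^sub>m 1\<^sub>m b - B)" "psd b (2 \<cdot>\<^sub>m e X + 2 \<cdot>\<^sub>m B - A)" "psd b (2 \<cdot>\<^sub>m e X + 2 \<cdot>\<^sub>m A - B)"
      using riesz_decomposition[OF S D(1) eX le eta] by blast
    note Ac = psd_carrier[OF AB(1)] and Bc = psd_carrier[OF AB(2)]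
    have "Re (mtrace B) \<le> Re (mtrace (D + complex_of_real \<eta> \<cdot>\<^sub>m 1\<^sub>m b))"
      by (rule mtrace_mono[OF AB(5)]) (use Bc Dc in auto)
    also have "\<dots> = Re (mtrace D) + \<eta> * real b"
      using mtrace_add[OF Dc, of "complex_of_real \<eta> \<cdot>\<^sub>m 1\<^sub>m b"] mtrace_smult[OF one_carrier_mat, of "complex_of_real \<eta>" b]
      by (simp add: mtrace_one)
    finally have trB: "Re (mtrace B) \<le> 2 * \<kappa> * Re (mtrace X)" using trD eta_b by simp
    have "Re (mtrace A) \<le> Re (mtrace (2 \<cdot>\<^sub>m e X + 2 \<cdot>\<^sub>m B))"
      by (rule mtrace_mono[OF AB(6)]) (use Ac Bc ec in auto)
    also have "\<dots> = 2 * Re (mtrace X) + 2 * Re (mtrace B)"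
      using mtrace_add[OF smult_carrier_mat[OF ec] smult_carrier_mat[OF Bc], of 2 2] mtrace_smult[OF ec, of 2] mtrace_smult[OF Bc, of 2]
      by (simp add: e'(3)[OF Xc])
    also have "\<dots> \<le> 6 * Re (mtrace X)"
    proof -
      have "\<kappa> * Re (mtrace X) \<le> 1 * Re (mtrace X)" by (rule mult_right_mono) (use par tX in auto)
      thus ?thesis using trB by linarith
    qed
    finally have trA: "Re (mtrace A) \<le> 6 * Re (mtrace X)" .
    have BD: "psd b (complex_of_real (4 * \<Lambda>) \<cdot>\<^sub>m f X - B)"
    proof -
      have "complex_of_real (4 * \<Lambda>) \<cdot>\<^sub>m f X - B = (2 \<cdot>\<^sub>m e X + 2 \<cdot>\<^sub>m A - B)
          + complex_of_real 2 \<cdot>\<^sub>m (complex_of_real \<Lambda> \<cdot>\<^sub>m f X - e X) + complex_of_real 2 \<cdot>\<^sub>m (?S - A)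
          + complex_of_real (2 * (\<Lambda> - \<mu>)) \<cdot>\<^sub>m f X"
        using ec fc Ac Bc by (intro eq_matI) (auto simp: algebra_simps)
      moreover have "psd b \<dots>"
        using par by (intro psd_add psd_smult AB dom fX) auto
      ultimately show ?thesis by simp
    qed
    show ?thesis using AB(1-4) BD trA trB by blast
  qed
qed

text \<open>Each use of the channels is split by \<open>channel_split\<close> into a part that costs a factor \<open>\<mu>\<close> relative
  to \<open>f\<close> and a part that costs \<open>\<mu> * q\<close> but has trace smaller by \<open>\<kappa>\<close>; \<open>K\<close> is the number of times the
  second part is followed before the trace bound is used.\<close>

lemma adaptive_bound:
  assumes par: "0 \<le> \<mu>" "1 \<le> q" "0 < \<kappa>" "\<kappa> \<le> 1"
    and e: "\<And>i. i < n \<Longrightarrow> e i \<in> CPTP (a i) (b i)" and f: "\<And>i. i < n \<Longrightarrow> f i \<in> CPTP (a i) (b i)"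
    and P: "\<And>i. i < n \<Longrightarrow> P i \<in> CPTP (b i) (a (Suc i))"
    and bound: "\<And>i X T. i < n \<Longrightarrow> psd (a i) X \<Longrightarrow> T \<in> tests (b i) \<Longrightarrow>
      Re (mtrace (T * e i X)) \<le> \<mu> * Re (mtrace (T * f i X)) + \<kappa> * Re (mtrace X)"
    and dom: "\<And>i X. i < n \<Longrightarrow> psd (a i) X \<Longrightarrow> psd (b i) (complex_of_real (\<mu> * q) \<cdot>\<^sub>m f i X - e i X)"
    and T: "T \<in> tests (a n)" and X: "psd (a 0) X" and Y: "psd (a 0) Y" and c: "0 \<le> c"
    and XY: "psd (a 0) (complex_of_real c \<cdot>\<^sub>m Y - X)" and w: "Re (mtrace X) \<le> w"
  shows "Re (mtrace (T * adaptive e P n X)) \<le>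
    16 ^ n * (c * \<mu> ^ n * q ^ K * Re (mtrace (T * adaptive f P n Y)) + w * \<kappa> ^ K)"
  using e f P bound dom T X Y c XY w
\<comment> \<open>The two runs start from different operators because after a split the run with
  \<open>e\<close> continues from \<open>A\<close> or \<open>B\<close>, the run with
  \<open>f\<close> from \<open>f 0 Y\<close>. The factor \<open>c\<close> accumulates the cost of
  domination and \<open>w\<close> bounds the remaining trace.\<close>
proof (induction n arbitrary: e f P a b X Y c w K)
  case 0
  note Tc = testsD[OF 0(6)] and Xc = psd_carrier[OF 0(7)] and Yc = psd_carrier[OF 0(8)]
  have "Re (mtrace (T * X)) \<le> Re (mtrace (T * (complex_of_real c \<cdot>\<^sub>m Y)))"
    by (rule mtrace_test_mono[OF Tc(1) 0(10) Xc]) (use Yc in simp)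
  also have "\<dots> = c * Re (mtrace (T * Y))" using mtrace_test_smult[OF Tc(3) Yc] by simp
  also have "\<dots> \<le> c * q ^ K * Re (mtrace (T * Y))"
  proof -
    have "c * 1 \<le> c * q ^ K" using 0(9) par(2) by (intro mult_left_mono one_le_power) auto
    thus ?thesis using mult_right_mono[OF _ psd_mtrace_mult(1)[OF Tc(1) 0(8)], of c "c * q ^ K"] by simp
  qed
  moreover have "0 \<le> w * \<kappa> ^ K" using psd_mtrace(1)[OF 0(7)] 0(11) par by simp
  ultimately show ?case by simp
next
  case (Suc n)
  note e = Suc.prems(1) and f = Suc.prems(2) and P = Suc.prems(3) and bound = Suc.prems(4)
    and dom = Suc.prems(5) and T = Suc.prems(6) and X = Suc.prems(7) and Y = Suc.prems(8)
    and c = Suc.prems(9) and XY = Suc.prems(10) and w = Suc.prems(11)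
  note Tc = testsD[OF T] and Xc = psd_carrier[OF X] and Yc = psd_carrier[OF Y]
  have w0: "0 \<le> w" using psd_mtrace(1)[OF X] w by simp
  have "adaptive e P (Suc n) \<in> CPTP (a 0) (a (Suc n))" by (rule adaptive_CPTP[of _ e a b]) (rule e P; assumption)+
  note runE = CPTP_D[OF this]
  have "adaptive f P (Suc n) \<in> CPTP (a 0) (a (Suc n))" by (rule adaptive_CPTP[of _ f a b]) (rule f P; assumption)+
  note runF = CPTP_D[OF this]
  define sf where "sf = Re (mtrace (T * adaptive f P (Suc n) Y))"
  have sf: "0 \<le> sf" unfolding sf_def by (rule psd_mtrace_mult(1)[OF Tc(1) runF(4)[OF Y]])
  show ?case
  proof (cases K)
    \<comment> \<open>The budget of second parts is exhausted: the success probability is bounded by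
      the trace, which the rest of the run preserves.\<close>
    case 0
    have "Re (mtrace (T * adaptive e P (Suc n) X)) \<le> Re (mtrace (adaptive e P (Suc n) X))"
      by (rule mtrace_test_le[OF T runE(4)[OF X]])
    also have "\<dots> \<le> w" using runE(3)[OF Xc] w by simp
    also have "\<dots> \<le> 16 ^ Suc n * w" using mult_right_mono[OF one_le_power[of 16 "Suc n"] w0] by simp
    also have "\<dots> \<le> 16 ^ Suc n * (c * \<mu> ^ Suc n * sf + w)"
      using c par(1) sf by (intro mult_left_mono) auto
    finally show ?thesis by (simp add: 0 sf_def)
  next
    case (Suc k)
    let ?e = "\<lambda>i. e (Suc i)" and ?f = "\<lambda>i. f (Suc i)" and ?P = "\<lambda>i. P (Suc i)"
    note e0 = CPTP_D[OF e[OF zero_less_Suc]] and f0 = CPTP_D[OF f[OF zero_less_Suc]]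
      and P0 = CPTP_D[OF P[OF zero_less_Suc]]
    have \<mu>q: "\<mu> \<le> \<mu> * q" using mult_left_mono[OF par(2,1)] by simp
    obtain A B where AB: "psd (b 0) A" "psd (b 0) B" "psd (b 0) (2 \<cdot>\<^sub>m A + 2 \<cdot>\<^sub>m B - e 0 X)"
        "psd (b 0) (complex_of_real \<mu> \<cdot>\<^sub>m f 0 X - A)" "psd (b 0) (complex_of_real (4 * (\<mu> * q)) \<cdot>\<^sub>m f 0 X - B)"
        "Re (mtrace A) \<le> 6 * Re (mtrace X)" "Re (mtrace B) \<le> 2 * \<kappa> * Re (mtrace X)"
      using channel_split[OF e[OF zero_less_Suc] f[OF zero_less_Suc] X bound[OF zero_less_Suc X]
          dom[OF zero_less_Suc X] par(1) \<mu>q par(3,4)] by blast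
    note Ac = psd_carrier[OF AB(1)] and Bc = psd_carrier[OF AB(2)]
    note fX = f0(4)[OF X] and fY = f0(4)[OF Y]
    note fXc = psd_carrier[OF fX] and fYc = psd_carrier[OF fY]
    have fXY: "psd (b 0) (complex_of_real c \<cdot>\<^sub>m f 0 Y - f 0 X)"
      using f0(4)[OF XY] linear_map_minus[OF f0(1) smult_carrier_mat[OF Yc] Xc] linear_mapD(3)[OF f0(1) Yc] by simp
    \<comment> \<open>Domination composes: a part below \<open>d f X\<close>, with
      \<open>f X\<close> below \<open>c f Y\<close>, is below \<open>d c f Y\<close>, and the
      processing map preserves this.\<close>
    have step: "psd (a 1) (complex_of_real (d * c) \<cdot>\<^sub>m P 0 (f 0 Y) - P 0 Z)"
      if Z: "psd (b 0) Z" and d: "0 \<le> d" "psd (b 0) (complex_of_real d \<cdot>\<^sub>m f 0 X - Z)" for Z d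
    proof -
      note Zc = psd_carrier[OF Z]
      have "complex_of_real (d * c) \<cdot>\<^sub>m f 0 Y - Z = (complex_of_real d \<cdot>\<^sub>m f 0 X - Z)
          + complex_of_real d \<cdot>\<^sub>m (complex_of_real c \<cdot>\<^sub>m f 0 Y - f 0 X)"
        using fXc fYc Zc by (intro eq_matI) (auto simp: algebra_simps)
      hence "psd (b 0) (complex_of_real (d * c) \<cdot>\<^sub>m f 0 Y - Z)"
        using psd_add[OF d(2) psd_smult[OF fXY d(1)]] by simp
      hence "psd (a (Suc 0)) (P 0 (complex_of_real (d * c) \<cdot>\<^sub>m f 0 Y - Z))" by (rule P0(4))
      thus ?thesis
        using linear_map_minus[OF P0(1) smult_carrier_mat[OF fYc] Zc] linear_mapD(3)[OF P0(1) fYc] by simp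
    qed
    have IH: "Re (mtrace (T * adaptive ?e ?P n (P 0 Z))) \<le>
        16 ^ n * ((d * c) * \<mu> ^ n * q ^ j * sf + v * \<kappa> ^ j)"
      if Z: "psd (b 0) Z" and d: "0 \<le> d" "psd (b 0) (complex_of_real d \<cdot>\<^sub>m f 0 X - Z)"
        and v: "Re (mtrace Z) \<le> v" for Z d v j
    proof -
      have "Re (mtrace (T * adaptive ?e ?P n (P 0 Z))) \<le>
          16 ^ n * ((d * c) * \<mu> ^ n * q ^ j * Re (mtrace (T * adaptive ?f ?P n (P 0 (f 0 Y)))) + v * \<kappa> ^ j)"
      proof (rule Suc.IH[of ?e "\<lambda>i. a (Suc i)" "\<lambda>i. b (Suc i)" ?f ?P])
        show "psd (a (Suc 0)) (complex_of_real (d * c) \<cdot>\<^sub>m P 0 (f 0 Y) - P 0 Z)"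
          using step[OF Z d] by simp
        show "Re (mtrace (P 0 Z)) \<le> v" using P0(3)[OF psd_carrier[OF Z]] v by simp
      qed (use e f P bound dom T P0(4)[OF Z] P0(4)[OF fY] d c in auto)
      thus ?thesis unfolding sf_def adaptive_shift .
    qed
    have "adaptive ?e ?P n \<in> CPTP (a (Suc 0)) (a (Suc n))"
      by (rule adaptive_CPTP[of n ?e "\<lambda>i. a (Suc i)"]) (use e P in auto)
    note run = CPTP_D[OF CPTP_comp[OF P[OF zero_less_Suc] this]]
    let ?R = "\<lambda>X. adaptive ?e ?P n (P 0 X)"
    have S: "2 \<cdot>\<^sub>m A + 2 \<cdot>\<^sub>m B \<in> carrier_mat (b 0) (b 0)" using Ac Bc by simp
    note e0X = psd_carrier[OF e0(4)[OF X]]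
    have "Re (mtrace (T * ?R (e 0 X))) \<le> Re (mtrace (T * ?R (2 \<cdot>\<^sub>m A + 2 \<cdot>\<^sub>m B)))"
      by (rule mtrace_test_mono[OF Tc(1)])
        (use run(4)[OF AB(3)] linear_map_minus[OF run(1) S e0X] linear_mapD(1)[OF run(1)] S e0X in auto)
    also have "?R (2 \<cdot>\<^sub>m A + 2 \<cdot>\<^sub>m B) = 2 \<cdot>\<^sub>m ?R A + 2 \<cdot>\<^sub>m ?R B"
      using linear_mapD(2)[OF run(1) smult_carrier_mat[OF Ac] smult_carrier_mat[OF Bc]]
        linear_mapD(3)[OF run(1) Ac] linear_mapD(3)[OF run(1) Bc] by simp
    also have "Re (mtrace (T * \<dots>)) = 2 * Re (mtrace (T * ?R A)) + 2 * Re (mtrace (T * ?R B))"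
      using mtrace_test_add[OF Tc(3) smult_carrier_mat[OF linear_mapD(1)[OF run(1) Ac]]
          smult_carrier_mat[OF linear_mapD(1)[OF run(1) Bc]], of 2 2]
        mtrace_test_smult[OF Tc(3) linear_mapD(1)[OF run(1) Ac], of 2]
        mtrace_test_smult[OF Tc(3) linear_mapD(1)[OF run(1) Bc], of 2] by simp
    \<comment> \<open>The \<open>A\<close>-branch keeps the budget \<open>K\<close> and pays
      \<open>\<mu>\<close>; the \<open>B\<close>-branch continues with budget
      \<open>k = K - 1\<close>, pays \<open>4 \<mu> q\<close> and gains
      \<open>\<kappa>\<close>.\<close>
    also have "\<dots> \<le> 2 * (16 ^ n * ((\<mu> * c) * \<mu> ^ n * q ^ K * sf + (6 * w) * \<kappa> ^ K)) +
        2 * (16 ^ n * ((4 * (\<mu> * q) * c) * \<mu> ^ n * q ^ k * sf + (2 * \<kappa> * w) * \<kappa> ^ k))"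
    proof (intro add_mono mult_left_mono)
      show "Re (mtrace (T * ?R A)) \<le> 16 ^ n * ((\<mu> * c) * \<mu> ^ n * q ^ K * sf + (6 * w) * \<kappa> ^ K)"
        by (rule IH[OF AB(1) par(1) AB(4)]) (use AB(6) w in simp)
      have BW: "Re (mtrace B) \<le> 2 * \<kappa> * w"
        by (rule order_trans[OF AB(7)], rule mult_left_mono) (use w par in auto)
      show "Re (mtrace (T * ?R B)) \<le>
          16 ^ n * ((4 * (\<mu> * q) * c) * \<mu> ^ n * q ^ k * sf + (2 * \<kappa> * w) * \<kappa> ^ k)"
        by (rule IH[OF AB(2) _ AB(5) BW]) (use par in auto)
    qed auto
    \<comment> \<open>The coefficients are \<open>10 = 2 + 2 * 4\<close> for domination and
      \<open>16 = 2 * 6 + 2 * 2\<close> for the traces; rounding the first up to 16 gives the base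
      of the power.\<close>
    also have "\<dots> = 16 ^ n * (10 * (c * \<mu> ^ Suc n * q ^ K * sf) + 16 * (w * \<kappa> ^ K))"
      by (simp add: Suc algebra_simps)
    also have "\<dots> \<le> 16 ^ n * (16 * (c * \<mu> ^ Suc n * q ^ K * sf) + 16 * (w * \<kappa> ^ K))"
    proof (intro mult_left_mono add_mono mult_right_mono)
      show "0 \<le> c * \<mu> ^ Suc n * q ^ K * sf"
        using c par sf by (intro mult_nonneg_nonneg zero_le_power) auto
    qed (use w0 par in auto)
    also have "\<dots> = 16 ^ Suc n * (c * \<mu> ^ Suc n * q ^ K * sf + w * \<kappa> ^ K)"
      by (simp add: algebra_simps)
    finally show ?thesis unfolding sf_def adaptive_shift[of e] .
  qed
qed

section \<open>Powers of sequential strategies\<close>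

lemma seq_state_psd:
  assumes E: "E \<in> CPTP dC dG" and psi: "psd (r 0 * dC) \<psi>"
    and P: "\<And>j. j < i \<Longrightarrow> P j \<in> CPTP (r j * dG) (r (Suc j) * dC)"
  shows "psd (r i * dG) (seq_state dC dG E r \<psi> P i)"
    and "mtrace (seq_state dC dG E r \<psi> P i) = mtrace \<psi>"
proof -
  note I = CPTP_D[OF CPTP_id_tensor[OF E]]
  have "psd (r i * dG) (seq_state dC dG E r \<psi> P i) \<and> mtrace (seq_state dC dG E r \<psi> P i) = mtrace \<psi>"
    using P
  proof (induction i)
    case 0
    show ?case using I(4)[OF psi] I(3)[OF psd_carrier[OF psi]] by simp
  next
    case (Suc i)
    hence IH: "psd (r i * dG) (seq_state dC dG E r \<psi> P i)" "mtrace (seq_state dC dG E r \<psi> P i) = mtrace \<psi>"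
      by auto
    note Pi = CPTP_D[OF Suc.prems[of i]]
    have "psd (r (Suc i) * dC) (P i (seq_state dC dG E r \<psi> P i))" using Pi(4)[OF _ IH(1)] by simp
    moreover have "mtrace (P i (seq_state dC dG E r \<psi> P i)) = mtrace \<psi>"
      using Pi(3)[OF _ psd_carrier[OF IH(1)]] IH(2) by simp
    ultimately show ?case using I(4) I(3)[OF psd_carrier] by simp
  qed
  thus "psd (r i * dG) (seq_state dC dG E r \<psi> P i)"
    and "mtrace (seq_state dC dG E r \<psi> P i) = mtrace \<psi>" by auto
qed

text \<open>Independent copies all pass their tests with the m-th power of the single probability;
  the trace is real, so its real part may be taken before the power.\<close>

lemma Re_mtrace_kron_power:
  assumes "psd d T" "psd d X"
  shows "Re (mtrace (kron_power T m * kron_power X m)) = Re (mtrace (T * X)) ^ m"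
proof -
  note c = psd_carrier[OF assms(1)] psd_carrier[OF assms(2)]
  have "mtrace (kron_power T m * kron_power X m) = mtrace (T * X) ^ m"
    unfolding kron_power_mult[OF c] by (rule mtrace_kron_power) (use c in auto)
  also have "\<dots> = complex_of_real (Re (mtrace (T * X)) ^ m)"
  proof -
    have "mtrace (T * X) = complex_of_real (Re (mtrace (T * X)))"
      using psd_mtrace_mult(2)[OF assms] by (simp add: complex_eq_iff)
    thus ?thesis by (metis of_real_power)
  qed
  finally show ?thesis by simp
qed

text \<open>One step of \<open>adaptive\<close> is one simultaneous use by all m copies, so tensor
  powers of the two channels play the roles of \<open>e\<close> and \<open>f\<close>. Both runs
  start from the same Kronecker power, whence \<open>c = 1\<close> and \<open>w = 1\<close>. The
  parts of a split need not be Kronecker powers; the ends of the two complete runs are.\<close>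

lemma sequential_power_bound:
  assumes E: "E \<in> CPTP dC dG" and F: "F \<in> CPTP dC dG"
    and par: "0 \<le> \<mu>" "1 \<le> q" "0 < \<kappa>" "\<kappa> \<le> 1" "0 \<le> L" "\<mu> * q = L ^ m"
    and bound: "\<And>r X T. psd ((r * dC) ^ m) X \<Longrightarrow> T \<in> tests ((r * dG) ^ m) \<Longrightarrow>
      Re (mtrace (T * tensor_power (r * dC) (r * dG) (id_tensor r dC dG E) m X)) \<le>
      \<mu> * Re (mtrace (T * tensor_power (r * dC) (r * dG) (id_tensor r dC dG F) m X)) + \<kappa> * Re (mtrace X)"
    and dom: "cp_dominated dC dG L E F"
    and n: "0 < n" and psi: "\<psi> \<in> density (r 0 * dC)"
    and P: "\<And>j. j < n - 1 \<Longrightarrow> P j \<in> CPTP (r j * dG) (r (Suc j) * dC)"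
    and T: "T \<in> tests (r (n - 1) * dG)"
  shows "Re (mtrace (T * seq_state dC dG E r \<psi> P (n - 1))) ^ m \<le>
    16 ^ n * (\<mu> ^ n * q ^ K * Re (mtrace (T * seq_state dC dG F r \<psi> P (n - 1))) ^ m + \<kappa> ^ K)"
proof -
  \<comment> \<open>No update follows the last use: \<open>Q (n - 1)\<close> is the identity, and
    accordingly \<open>a n\<close> is the output space.\<close>
  define a where "a i = (if i < n then (r i * dC) ^ m else (r (n - 1) * dG) ^ m)" for i
  define b where "b i = (r i * dG) ^ m" for i
  define C where "C G i = tensor_power (r i * dC) (r i * dG) (id_tensor (r i) dC dG G) m" for G i
  define Q where "Q i = (if i < n - 1 then tensor_power (r i * dG) (r (Suc i) * dC) (P i) m else (\<lambda>X. X))" for i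
  have psi': "psd (r 0 * dC) \<psi>" "mtrace \<psi> = 1" using psi by (auto simp: density_def)
  have C: "C G i \<in> CPTP (a i) (b i)" if "i < n" "G \<in> CPTP dC dG" for G i
    using CPTP_tensor_power[OF CPTP_id_tensor[OF that(2)]] that(1) by (simp add: C_def a_def b_def)
  have Q: "Q i \<in> CPTP (b i) (a (Suc i))" if "i < n" for i
  proof (cases "i < n - 1")
    case True
    hence "Suc i < n" by simp
    thus ?thesis using CPTP_tensor_power[OF P[OF True]] True by (simp add: Q_def a_def b_def)
  next
    case False
    hence "i = n - 1" using that by simp
    thus ?thesis using False CPTP_id that by (simp add: Q_def a_def b_def)
  qed
  \<comment> \<open>Without splitting the copies remain independent, so both complete runs stay
    Kronecker powers.\<close>
  have run: "C G i (adaptive (C G) Q i (kron_power \<psi> m)) = kron_power (seq_state dC dG G r \<psi> P i) m"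
    if G: "G \<in> CPTP dC dG" and "i < n" for G i
    using that(2)
  proof (induction i)
    case 0
    show ?case
      using tensor_power_kron_power[OF id_tensor_linear psd_carrier[OF psi'(1)]] by (simp add: C_def)
  next
    case (Suc i)
    have s: "psd (r i * dG) (seq_state dC dG G r \<psi> P i)"
      by (rule seq_state_psd(1)[where r = r, OF G psi'(1)]) (use P Suc.prems in auto)
    have i: "i < n - 1" using Suc.prems by simp
    note Pi = CPTP_D[OF P[OF i]]
    have "Q i (kron_power (seq_state dC dG G r \<psi> P i) m) = kron_power (P i (seq_state dC dG G r \<psi> P i)) m"
      using tensor_power_kron_power[OF Pi(1) psd_carrier[OF s]] i by (simp add: Q_def)
    thus ?case
      using Suc tensor_power_kron_power[OF id_tensor_linear linear_mapD(1)[OF Pi(1) psd_carrier[OF s]]]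
      by (simp add: C_def)
  qed
  obtain k where k: "n = Suc k" using n by (cases n) auto
  have fin: "adaptive (C G) Q n (kron_power \<psi> m) = kron_power (seq_state dC dG G r \<psi> P (n - 1)) m"
    if "G \<in> CPTP dC dG" for G
    using run[OF that, of k] by (simp add: k Q_def)
  have s: "psd (r (n - 1) * dG) (seq_state dC dG G r \<psi> P (n - 1))" if "G \<in> CPTP dC dG" for G
    by (rule seq_state_psd(1)[where r = r, OF that psi'(1)]) (use P in auto)
  have a0: "a 0 = (r 0 * dC) ^ m" and an: "a n = (r (n - 1) * dG) ^ m" using n by (auto simp: a_def)
  have kp: "psd (a 0) (kron_power \<psi> m)" unfolding a0 by (rule psd_kron_power[OF psi'(1)])
  have "Re (mtrace (kron_power T m * adaptive (C E) Q n (kron_power \<psi> m))) \<le>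
      16 ^ n * (1 * \<mu> ^ n * q ^ K * Re (mtrace (kron_power T m * adaptive (C F) Q n (kron_power \<psi> m))) + 1 * \<kappa> ^ K)"
  proof (rule adaptive_bound[of \<mu> q \<kappa> n "C E" a b "C F" Q, OF par(1-4)])
    show "Re (mtrace (S * C E i X)) \<le> \<mu> * Re (mtrace (S * C F i X)) + \<kappa> * Re (mtrace X)"
      if "i < n" "psd (a i) X" "S \<in> tests (b i)" for i S X
      using bound[of "r i" X S] that by (simp add: C_def a_def b_def)
    show "psd (b i) (complex_of_real (\<mu> * q) \<cdot>\<^sub>m C F i X - C E i X)" if "i < n" "psd (a i) X" for i X
    proof -
      have "cp_dominated ((r i * dC) ^ m) ((r i * dG) ^ m) (L ^ m) (C E i) (C F i)"
        unfolding C_def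
        by (intro cp_dominated_tensor_power CPTP_id_tensor E F cp_dominated_id_tensor CPTP_D(1,2)[OF E]
            CPTP_D(1)[OF F] dom par)
      hence "cp_dominated (a i) (b i) (\<mu> * q) (C E i) (C F i)" using that by (simp add: par(6) a_def b_def)
      thus ?thesis
        by (rule cp_dominated_psd[OF CPTP_D(1)[OF C[OF that(1) E]] CPTP_D(1)[OF C[OF that(1) F]] _ that(2)])
    qed
    show "kron_power T m \<in> tests (a n)" unfolding an by (rule tests_kron_power[OF T])
    have "complex_of_real 1 \<cdot>\<^sub>m kron_power \<psi> m - kron_power \<psi> m = 0\<^sub>m (a 0) (a 0)"
      using psd_carrier[OF kp] by (intro eq_matI) auto
    thus "psd (a 0) (complex_of_real 1 \<cdot>\<^sub>m kron_power \<psi> m - kron_power \<psi> m)" by (simp add: psd_zero)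
    show "Re (mtrace (kron_power \<psi> m)) \<le> 1"
      using mtrace_kron_power[OF psd_carrier[OF psi'(1)]] psi'(2) by simp
  qed (use kp C E F Q in auto)
  thus ?thesis
    unfolding fin[OF E] fin[OF F] Re_mtrace_kron_power[OF testsD(1)[OF T] s[OF E]]
      Re_mtrace_kron_power[OF testsD(1)[OF T] s[OF F]] by simp
qed

section \<open>What the divergence and the coherent property supply\<close>

section \<open>Finite divergence implies domination\<close>

lemma psd_le_mtrace:
  assumes "psd d X"
  shows "psd d (complex_of_real (Re (mtrace X)) \<cdot>\<^sub>m 1\<^sub>m d - X)"
proof -
  obtain U l where U: "unitary d U" "\<forall>i<d. 0 \<le> l i"
      "X = U * mat_diag d (\<lambda>i. complex_of_real (l i)) * mat_adjoint U"
    using psd_diagonalisation[OF assms] by auto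
  have Uc: "U \<in> carrier_mat d d" and UU: "U * mat_adjoint U = 1\<^sub>m d" using U by (auto simp: unitary_def)
  let ?D = "mat_diag d (\<lambda>i. complex_of_real (l i))" and ?t = "\<Sum>i<d. l i"
  have "mtrace X = mtrace ?D" unfolding U(3) by (rule mtrace_unitary_conj[OF U(1) mat_diag_dim])
  also have "\<dots> = complex_of_real ?t" by (simp add: mtrace_def mat_diag_def)
  finally have t: "Re (mtrace X) = ?t" by simp
  have "psd d (mat_diag d (\<lambda>i. complex_of_real (?t - l i)))"
  proof (rule psd_diag)
    fix i assume "i < d"
    thus "0 \<le> ?t - l i" using member_le_sum[of i "{..<d}" l] U(2) by auto
  qed
  hence "psd d (U * mat_diag d (\<lambda>i. complex_of_real (?t - l i)) * mat_adjoint U)" by (rule psd_conj[OF _ Uc])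
  also have "mat_diag d (\<lambda>i. complex_of_real (?t - l i)) = complex_of_real ?t \<cdot>\<^sub>m 1\<^sub>m d - ?D"
    by (rule eq_matI) (auto simp: mat_diag_def)
  also have "U * (complex_of_real ?t \<cdot>\<^sub>m 1\<^sub>m d - ?D) * mat_adjoint U = complex_of_real ?t \<cdot>\<^sub>m 1\<^sub>m d - X"
    using linear_map_minus[OF linear_map_conj[OF Uc] smult_carrier_mat[OF one_carrier_mat] mat_diag_dim]
      linear_mapD(3)[OF linear_map_conj[OF Uc] one_carrier_mat] Uc UU U(3) by simp
  finally show ?thesis unfolding t .
qed

text \<open>The vector obtained from \<open>w\<close> by applying \<open>\<rho>\<close> twice lies
  in the support of \<open>\<rho>\<close>, hence in that of \<open>\<sigma>\<close>, and is
  orthogonal to \<open>w\<close>; its pairing with \<open>w\<close> is the squared norm of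
  \<open>\<rho> *\<^sub>v w\<close>.\<close>

lemma msupp_subset_kernel:
  assumes rho: "psd d \<rho>" and sigma: "psd d \<sigma>" and sub: "msupp \<rho> \<subseteq> msupp \<sigma>"
    and w: "w \<in> carrier_vec d" "\<sigma> *\<^sub>v w = 0\<^sub>v d"
  shows "\<rho> *\<^sub>v w = 0\<^sub>v d"
proof -
  note rc = psd_carrier[OF rho] and sc = psd_carrier[OF sigma]
  let ?v = "\<rho> *\<^sub>v w"
  have v: "?v \<in> carrier_vec d" using rc by (intro carrier_vecI) auto
  have rv: "\<rho> *\<^sub>v ?v \<in> carrier_vec d" using rc by (intro carrier_vecI) auto
  have "\<rho> *\<^sub>v ?v \<in> msupp \<rho>"
    unfolding msupp_def mat_kernel_def
  proof (safe, use rv rc in simp)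
    fix u assume u: "u \<in> carrier_vec (dim_col \<rho>)" "\<rho> *\<^sub>v u = 0\<^sub>v (dim_row \<rho>)"
    hence u': "u \<in> carrier_vec d" "\<rho> *\<^sub>v u = 0\<^sub>v d" using rc by auto
    have "(\<rho> *\<^sub>v ?v) \<bullet>c u = cnj ((\<rho> *\<^sub>v u) \<bullet>c ?v)"
      by (rule hermitian_cscalar[OF rc psd_hermitian[OF rho] v u'(1)])
    also have "\<dots> = 0" using v by (simp add: u'(2))
    finally show "(\<rho> *\<^sub>v ?v) \<bullet>c u = 0" .
  qed
  moreover have "w \<in> mat_kernel \<sigma>" using w sc by (auto simp: mat_kernel_def)
  ultimately have "(\<rho> *\<^sub>v ?v) \<bullet>c w = 0" using sub by (auto simp: msupp_def)
  hence "?v \<bullet>c ?v = 0"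
    using cscalar_adjoint[OF rc v w(1)] psd_hermitian[OF rho] by simp
  thus ?thesis using v by (simp add: conjugate_square_eq_0_vec)
qed

lemma msupp_subset_dominated:
  assumes rho: "psd d \<rho>" and sigma: "psd d \<sigma>" and sub: "msupp \<rho> \<subseteq> msupp \<sigma>"
  shows "\<exists>L. \<forall>c\<ge>L. psd d (complex_of_real c \<cdot>\<^sub>m \<sigma> - \<rho>)"
proof -
  note rc = psd_carrier[OF rho] and sc = psd_carrier[OF sigma]
  obtain U l where U: "unitary d U" "\<forall>i<d. 0 \<le> l i"
      "\<sigma> = U * mat_diag d (\<lambda>i. complex_of_real (l i)) * mat_adjoint U"
    using psd_diagonalisation[OF sigma] by auto
  have Uc: "U \<in> carrier_mat d d" and UU: "mat_adjoint U * U = 1\<^sub>m d" using U by (auto simp: unitary_def)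
  define D where "D f = mat_diag d (\<lambda>i. complex_of_real (f i))" for f
  have Dc: "D f \<in> carrier_mat d d" for f by (simp add: D_def)
  have Dd: "dim_row (D f) = d" "dim_col (D f) = d" for f by (simp_all add: D_def mat_diag_def)
  have Da: "mat_adjoint (D f) = D f" for f by (simp add: D_def mat_adjoint_diag)
  define p where "p i = (if l i = 0 then 0 else 1 :: real)" for i
  define R where "R = mat_adjoint U * \<rho> * U"
  have R: "psd d R" using psd_conj[OF rho mat_adjoint_carrier[OF Uc]] by (simp add: R_def)
  note Rc = psd_carrier[OF R]
  have R0: "R $$ (j, i) = 0" if ij: "j < d" "i < d" "l i = 0" for i j
  proof -
    have "\<sigma> * U = U * D l * (mat_adjoint U * U)"
      unfolding U(3) D_def[symmetric] using carrier_matD[OF Uc] by (simp only: mat_assoc Dd)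
    also have "\<dots> = U * D l" unfolding UU by (rule right_mult_one_mat[OF mult_carrier_mat[OF Uc Dc]])
    also have "\<dots> = mat d d (\<lambda>(k, i). U $$ (k, i) * complex_of_real (l i))"
      unfolding D_def by (rule mat_diag_mult_right[OF Uc])
    finally have sU: "\<sigma> * U = mat d d (\<lambda>(k, i). U $$ (k, i) * complex_of_real (l i))" .
    have cU: "col U i \<in> carrier_vec d" using Uc by (intro carrier_vecI) auto
    have "\<sigma> *\<^sub>v col U i = col (\<sigma> * U) i" by (rule col_mult2[OF sc Uc ij(2), symmetric])
    also have "\<dots> = 0\<^sub>v d" unfolding sU using ij by (intro eq_vecI) auto
    finally have "\<rho> *\<^sub>v col U i = 0\<^sub>v d" by (rule msupp_subset_kernel[OF rho sigma sub cU])
    hence "col (\<rho> * U) i = 0\<^sub>v d" using col_mult2[OF rc Uc ij(2)] by simp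
    moreover have "R = mat_adjoint U * (\<rho> * U)"
      unfolding R_def using carrier_matD[OF Uc] carrier_matD[OF rc] by (simp only: mat_assoc)
    ultimately show ?thesis using Uc rc ij by simp
  qed
  have RD: "R * D p = R"
  proof -
    have "R * D p = mat d d (\<lambda>(j, i). R $$ (j, i) * complex_of_real (p i))"
      unfolding D_def by (rule mat_diag_mult_right[OF Rc])
    also have "\<dots> = R" using Rc R0 by (intro eq_matI) (auto simp: p_def)
    finally show ?thesis .
  qed
  have DR: "D p * R = R"
    using arg_cong[OF RD, of mat_adjoint] mat_adjoint_mult[OF Rc Dc] psd_hermitian[OF R] Da by simp
  define t where "t = Re (mtrace R)"
  have t: "0 \<le> t" unfolding t_def by (rule psd_mtrace(1)[OF R])
  have "psd d (D p * (complex_of_real t \<cdot>\<^sub>m 1\<^sub>m d - R) * mat_adjoint (D p))"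
    unfolding t_def by (rule psd_conj[OF psd_le_mtrace[OF R] Dc])
  also have "D p * (complex_of_real t \<cdot>\<^sub>m 1\<^sub>m d - R) * mat_adjoint (D p) =
      complex_of_real t \<cdot>\<^sub>m (D p * 1\<^sub>m d * mat_adjoint (D p)) - D p * R * mat_adjoint (D p)"
    using linear_map_minus[OF linear_map_conj[OF Dc] smult_carrier_mat[OF one_carrier_mat] Rc]
      linear_mapD(3)[OF linear_map_conj[OF Dc] one_carrier_mat] by simp
  also have "D p * 1\<^sub>m d * mat_adjoint (D p) = D p"
    unfolding right_mult_one_mat[OF Dc] Da unfolding D_def mat_diag_diag
    by (rule eq_matI) (auto simp: mat_diag_def p_def)
  also have "D p * R * mat_adjoint (D p) = R" unfolding DR Da RD ..
  finally have tDR: "psd d (complex_of_real t \<cdot>\<^sub>m D p - R)" .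
  \<comment> \<open>The sum over the support exceeds each inverse eigenvalue and avoids a minimum
    over a possibly empty set.\<close>
  define L where "L = t * (\<Sum>i<d. if l i = 0 then 0 else 1 / l i)"
  have "psd d (complex_of_real c \<cdot>\<^sub>m \<sigma> - \<rho>)" if cL: "L \<le> c" for c
  proof -
    have "psd d (D (\<lambda>i. c * l i - t * p i))"
      unfolding D_def
    proof (rule psd_diag)
      fix i assume i: "i < d"
      show "0 \<le> c * l i - t * p i"
      proof (cases "l i = 0")
        case False
        hence li: "0 < l i" using U(2) i by force
        have "1 / l i \<le> (\<Sum>i<d. if l i = 0 then 0 else 1 / l i)"
          using member_le_sum[of i "{..<d}" "\<lambda>i. if l i = 0 then 0 else 1 / l i"] i U(2) False by auto
        hence "t * (1 / l i) \<le> c" using mult_left_mono[OF _ t] cL unfolding L_def by (meson order_trans)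
        thus ?thesis using li by (simp add: p_def field_simps)
      qed (simp add: p_def)
    qed
    moreover have "complex_of_real c \<cdot>\<^sub>m D l - R = D (\<lambda>i. c * l i - t * p i) + (complex_of_real t \<cdot>\<^sub>m D p - R)"
      using Rc by (intro eq_matI) (auto simp: D_def mat_diag_def algebra_simps)
    ultimately have "psd d (complex_of_real c \<cdot>\<^sub>m D l - R)" using psd_add[OF _ tDR] by simp
    hence "psd d (U * (complex_of_real c \<cdot>\<^sub>m D l - R) * mat_adjoint U)" by (rule psd_conj[OF _ Uc])
    also have "U * (complex_of_real c \<cdot>\<^sub>m D l - R) * mat_adjoint U =
        complex_of_real c \<cdot>\<^sub>m (U * D l * mat_adjoint U) - U * R * mat_adjoint U"
      using linear_map_minus[OF linear_map_conj[OF Uc] smult_carrier_mat[OF Dc] Rc]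
        linear_mapD(3)[OF linear_map_conj[OF Uc] Dc] by simp
    also have "U * D l * mat_adjoint U = \<sigma>" by (simp add: D_def U(3))
    also have "U * R * mat_adjoint U = \<rho>" unfolding R_def by (rule unitary_conj_conj[OF U(1) rc, symmetric])
    finally show ?thesis .
  qed
  thus ?thesis by blast
qed

section \<open>Test bounds\<close>

text \<open>Says that the hockey-stick divergence of order \<open>\<mu>\<close> between the outputs
  is at most \<open>\<kappa>\<close>. It is homogeneous in the input because the parts of a split
  are not normalised.\<close>

definition test_bound :: "nat \<Rightarrow> nat \<Rightarrow> (complex mat \<Rightarrow> complex mat) \<Rightarrow> (complex mat \<Rightarrow> complex mat) \<Rightarrow> real \<Rightarrow> real \<Rightarrow> bool"
  where "test_bound a b \<Phi> \<Psi> \<mu> \<kappa> \<longleftrightarrow> (\<forall>X T. psd a X \<longrightarrow> T \<in> tests b \<longrightarrow>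
    Re (mtrace (T * \<Phi> X)) \<le> \<mu> * Re (mtrace (T * \<Psi> X)) + \<kappa> * Re (mtrace X))"

lemma test_boundD:
  "test_bound a b \<Phi> \<Psi> \<mu> \<kappa> \<Longrightarrow> psd a X \<Longrightarrow> T \<in> tests b \<Longrightarrow>
    Re (mtrace (T * \<Phi> X)) \<le> \<mu> * Re (mtrace (T * \<Psi> X)) + \<kappa> * Re (mtrace X)"
  by (simp add: test_bound_def)

lemma tests_unitary_conj:
  assumes V: "unitary d V" and T: "T \<in> tests d"
  shows "V * T * mat_adjoint V \<in> tests d"
proof -
  note Vc = unitary_carrier[OF V] and T' = testsD[OF T]
  have "V * 1\<^sub>m d * mat_adjoint V = 1\<^sub>m d" using V Vc by (simp add: unitary_def)
  hence "V * (1\<^sub>m d - T) * mat_adjoint V = 1\<^sub>m d - V * T * mat_adjoint V"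
    using linear_map_minus[OF linear_map_conj[OF Vc] one_carrier_mat T'(3)] by simp
  thus ?thesis
    using psd_conj[OF T'(1) Vc] psd_conj[OF T'(2) Vc] by (simp add: tests_def)
qed

text \<open>A change of coordinates on inputs and outputs preserves traces and tests; this
  transports test bounds across the regrouping.\<close>

lemma test_bound_unitary_conj:
  assumes U: "unitary a U" and V: "unitary b V"
    and \<Phi>: "linear_map a b \<Phi>" and \<Psi>: "linear_map a b \<Psi>"
    and eq: "\<And>X. X \<in> carrier_mat a a \<Longrightarrow> V * \<Phi> X * mat_adjoint V = \<Phi>' (U * X * mat_adjoint U)"
      "\<And>X. X \<in> carrier_mat a a \<Longrightarrow> V * \<Psi> X * mat_adjoint V = \<Psi>' (U * X * mat_adjoint U)"
    and bound: "test_bound a b \<Phi>' \<Psi>' \<mu> \<kappa>"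
  shows "test_bound a b \<Phi> \<Psi> \<mu> \<kappa>"
  unfolding test_bound_def
proof (intro allI impI)
  fix X T assume X: "psd a X" and T: "T \<in> tests b"
  note Xc = psd_carrier[OF X] and Tc = testsD(3)[OF T] and Vc = unitary_carrier[OF V]
  note T' = tests_unitary_conj[OF V T]
  have tr: "mtrace ((V * T * mat_adjoint V) * (V * Y * mat_adjoint V)) = mtrace (T * Y)"
    if Y: "Y \<in> carrier_mat b b" for Y
    using mtrace_conj_test[OF Vc Y testsD(3)[OF T']] unitary_conj_diag[OF V Tc] by simp
  show "Re (mtrace (T * \<Phi> X)) \<le> \<mu> * Re (mtrace (T * \<Psi> X)) + \<kappa> * Re (mtrace X)"
    using test_boundD[OF bound psd_conj[OF X unitary_carrier[OF U]] T']
    unfolding eq(1)[OF Xc, symmetric] eq(2)[OF Xc, symmetric] tr[OF linear_mapD(1)[OF \<Phi> Xc]]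
      tr[OF linear_mapD(1)[OF \<Psi> Xc]] mtrace_unitary_conj[OF U Xc] .
qed

lemma test_bound_densityI:
  assumes \<Phi>: "linear_map a b \<Phi>" and \<Psi>: "linear_map a b \<Psi>"
    and bound: "\<And>\<psi> T. \<psi> \<in> density a \<Longrightarrow> T \<in> tests b \<Longrightarrow>
      Re (mtrace (T * \<Phi> \<psi>)) \<le> \<mu> * Re (mtrace (T * \<Psi> \<psi>)) + \<kappa>"
  shows "test_bound a b \<Phi> \<Psi> \<mu> \<kappa>"
  unfolding test_bound_def
proof (intro allI impI)
  fix X T assume X: "psd a X" and T: "T \<in> tests b"
  note Xc = psd_carrier[OF X] and Tc = testsD(3)[OF T]
  let ?t = "Re (mtrace X)"
  have scale: "Re (mtrace (T * \<Theta> (complex_of_real c \<cdot>\<^sub>m Y))) = c * Re (mtrace (T * \<Theta> Y))"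
    if "linear_map a b \<Theta>" "Y \<in> carrier_mat a a" for \<Theta> c Y
    using linear_mapD(3)[OF that] mtrace_test_smult[OF Tc linear_mapD(1)[OF that]] by simp
  show "Re (mtrace (T * \<Phi> X)) \<le> \<mu> * Re (mtrace (T * \<Psi> X)) + \<kappa> * ?t"
  proof (cases "?t = 0")
    case True
    hence "X = 0\<^sub>m a a" by (rule psd_mtrace_eq_0[OF X])
    hence X0: "X = complex_of_real 0 \<cdot>\<^sub>m X" by (intro eq_matI) auto
    have "Re (mtrace (T * \<Phi> X)) = 0" "Re (mtrace (T * \<Psi> X)) = 0"
      using scale[OF \<Phi> Xc, of 0] scale[OF \<Psi> Xc, of 0] unfolding X0[symmetric] by auto
    thus ?thesis by (simp add: True)
  next
    case False
    hence t: "0 < ?t" using psd_mtrace(1)[OF X] by simp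
    define \<psi> where "\<psi> = complex_of_real (1 / ?t) \<cdot>\<^sub>m X"
    have "mtrace X = complex_of_real ?t" using psd_mtrace(2)[OF X] by (simp add: complex_eq_iff)
    hence "mtrace \<psi> = complex_of_real (1 / ?t) * complex_of_real ?t"
      unfolding \<psi>_def using mtrace_smult[OF Xc] by simp
    also have "\<dots> = 1" using t by (simp add: of_real_mult[symmetric] del: of_real_mult of_real_divide)
    finally have "\<psi> \<in> density a"
      using psd_smult[OF X, of "1 / ?t"] t by (simp add: density_def \<psi>_def)
    from bound[OF this T]
    have "(1 / ?t) * Re (mtrace (T * \<Phi> X)) \<le> \<mu> * ((1 / ?t) * Re (mtrace (T * \<Psi> X))) + \<kappa>"
      unfolding \<psi>_def scale[OF \<Phi> Xc] scale[OF \<Psi> Xc] .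
    thus ?thesis using t by (simp add: field_simps)
  qed
qed

text \<open>Regrouping turns the m references of dimension \<open>a\<close> into one of dimension
  \<open>a ^ m\<close>, the dimension of the joint input, and such a reference is as good as any.
  Regrouping back gives references of dimension \<open>q\<close>. This is where the identity factor
  of the channels enters.\<close>

lemma test_bound_tensor_power_reference:
  assumes N: "linear_map a b N" and M: "linear_map a b M"
    and bound: "test_bound ((a * a) ^ m) ((a * b) ^ m) (tensor_power (a * a) (a * b) (id_tensor a a b N) m)
      (tensor_power (a * a) (a * b) (id_tensor a a b M) m) \<mu> \<kappa>"
  shows "test_bound ((q * a) ^ m) ((q * b) ^ m) (tensor_power (q * a) (q * b) (id_tensor q a b N) m)
      (tensor_power (q * a) (q * b) (id_tensor q a b M) m) \<mu> \<kappa>"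
proof -
  let ?t = "\<lambda>q \<Phi>. tensor_power (q * a) (q * b) (id_tensor q a b \<Phi>) m"
  let ?i = "\<lambda>q \<Phi>. id_tensor q (a ^ m) (b ^ m) (tensor_power a b \<Phi> m)"
  have lt: "linear_map ((q * a) ^ m) ((q * b) ^ m) (?t q \<Phi>)" for q \<Phi>
    by (rule linear_map_tensor_power)
  have li: "linear_map ((q * a) ^ m) ((q * b) ^ m) (?i (q ^ m) \<Phi>)" for q \<Phi>
    using id_tensor_linear[of "q ^ m" "a ^ m" "b ^ m"] by (simp add: power_mult_distrib)
  \<comment> \<open>The regrouping identity read backwards, with the inverse permutations.\<close>
  have inv: "mat_adjoint (regroup a b m) * ?i (a ^ m) \<Phi> Y * mat_adjoint (mat_adjoint (regroup a b m)) =
      ?t a \<Phi> (mat_adjoint (regroup a a m) * Y * mat_adjoint (mat_adjoint (regroup a a m)))"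
    if \<Phi>: "linear_map a b \<Phi>" and Y: "Y \<in> carrier_mat ((a * a) ^ m) ((a * a) ^ m)" for \<Phi> Y
  proof -
    let ?X = "mat_adjoint (regroup a a m) * Y * regroup a a m"
    note R = unitary_regroup[of a a m] and R' = unitary_regroup[of a b m]
    have X: "?X \<in> carrier_mat ((a * a) ^ m) ((a * a) ^ m)"
      using unitary_carrier[OF R] Y by (intro carrier_matI) auto
    have "regroup a a m * ?X * mat_adjoint (regroup a a m) = Y"
      by (rule unitary_conj_conj[OF R Y, symmetric])
    hence "?i (a ^ m) \<Phi> Y = regroup a b m * ?t a \<Phi> ?X * mat_adjoint (regroup a b m)"
      using regroup_tensor_power[OF \<Phi> X] by simp
    thus ?thesis using unitary_conj_diag[OF R' linear_mapD(1)[OF lt X]] by simp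
  qed
  have "test_bound ((a * a) ^ m) ((a * b) ^ m) (?i (a ^ m) N) (?i (a ^ m) M) \<mu> \<kappa>"
    by (rule test_bound_unitary_conj[OF unitary_adjoint[OF unitary_regroup] unitary_adjoint[OF unitary_regroup]
          li li inv[OF N] inv[OF M] bound])
  hence tb: "test_bound (a ^ m * a ^ m) (a ^ m * b ^ m) (?i (a ^ m) N) (?i (a ^ m) M) \<mu> \<kappa>"
    by (simp add: power_mult_distrib)
  have "test_bound (r * a ^ m) (r * b ^ m) (?i r N) (?i r M) \<mu> \<kappa>" for r
    unfolding test_bound_def
  proof (intro allI impI)
    fix X T assume X: "psd (r * a ^ m) X" and T: "T \<in> tests (r * b ^ m)"
    show "Re (mtrace (T * ?i r N X)) \<le> \<mu> * Re (mtrace (T * ?i r M X)) + \<kappa> * Re (mtrace X)"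
      by (rule id_tensor_bound[OF linear_map_tensor_power linear_map_tensor_power _ X T])
        (rule test_boundD[OF tb psd_rank1])
  qed
  hence tbq: "test_bound ((q * a) ^ m) ((q * b) ^ m) (?i (q ^ m) N) (?i (q ^ m) M) \<mu> \<kappa>"
    by (simp add: power_mult_distrib)
  show ?thesis
    by (rule test_bound_unitary_conj[OF unitary_regroup unitary_regroup lt lt
          regroup_tensor_power[OF N] regroup_tensor_power[OF M] tbq])
qed

lemma tensor_map_cong:
  assumes "\<And>X. X \<in> carrier_mat a a \<Longrightarrow> \<Phi> X = \<Phi>' X"
  shows "tensor_map a b a' b' \<Phi> \<Psi> = tensor_map a b a' b' \<Phi>' \<Psi>"
  unfolding tensor_map_def
  by (intro ext arg_cong[of _ _ "mat (b * b') (b * b')"]) (auto simp: assms)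

lemma tensor_power_cong:
  assumes "\<And>X. X \<in> carrier_mat a a \<Longrightarrow> \<Phi> X = \<Phi>' X"
  shows "tensor_power a b \<Phi> n = tensor_power a b \<Phi>' n"
proof (induction n)
  case (Suc n)
  show ?case
    unfolding tensor_power.simps Suc by (rule tensor_map_cong) (rule assms)
qed simp

lemma tensor_power_id_tensor_assoc:
  assumes "linear_map a b \<Phi>"
  shows "tensor_power (r * (s * a)) (r * (s * b)) (id_tensor r (s * a) (s * b) (id_tensor s a b \<Phi>)) m =
    tensor_power (r * s * a) (r * s * b) (id_tensor (r * s) a b \<Phi>) m"
  unfolding mult.assoc
  by (rule tensor_power_cong) (rule id_tensor_assoc[OF assms], simp add: mult.assoc)

lemma tensor_power_one:
  assumes "linear_map a b \<Phi>" "X \<in> carrier_mat a a"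
  shows "tensor_power a b \<Phi> 1 X = \<Phi> X"
  using tensor_map_kron[OF assms(1) linear_map_id assms(2) one_carrier_mat, of 1]
  unfolding kron_one_right by simp

lemma mtrace_max_entangled: "mtrace (rank1 (max_entangled a)) = of_nat a"
proof -
  have "mtrace (rank1 (max_entangled a)) = (\<Sum>k<a * a. if k div a = k mod a then 1 else 0)"
    by (auto simp: mtrace_def rank1_def max_entangled_def intro!: sum.cong)
  also have "\<dots> = (\<Sum>i<a. \<Sum>j<a. if i = j then 1 else 0)" by (rule sum_div_mod)
  finally show ?thesis by simp
qed

text \<open>The first term of the supremum suffices. The normalised maximally entangled state is an
  admissible input thanks to the identity factor, its finite relative entropy forces inclusion of
  supports, and domination of these two outputs is, up to normalisation, domination of the Choi
  matrices.\<close>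

lemma channel_div_reg_finite_dominated:
  assumes a: "0 < a" and N: "N \<in> CPTP a b" and M: "M \<in> CPTP a b"
    and fin: "channel_div_reg (a * a) (a * b) (id_tensor a a b N) (id_tensor a a b M) < \<infinity>"
  shows "\<exists>L. \<forall>c\<ge>L. cp_dominated a b c N M"
proof -
  let ?E = "\<lambda>\<Phi>. id_tensor a a b \<Phi>" and ?J = "rank1 (max_entangled a)"
  note N' = CPTP_D[OF N] and M' = CPTP_D[OF M]
  note E = CPTP_D[OF CPTP_id_tensor[OF N, of a]] and F = CPTP_D[OF CPTP_id_tensor[OF M, of a]]
  define \<psi> where "\<psi> = complex_of_real (1 / real a) \<cdot>\<^sub>m ?J"
  have Jpsd: "psd (a * a) ?J" by (rule psd_rank1[OF max_entangled_carrier])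
  note Jc = psd_carrier[OF Jpsd]
  have psi: "psd (a * a) \<psi>" unfolding \<psi>_def by (rule psd_smult[OF Jpsd]) simp
  have "mtrace \<psi> = 1" using a mtrace_smult[OF Jc] by (simp add: \<psi>_def mtrace_max_entangled)
  hence dens: "\<psi> \<in> density ((a * a) ^ 1)" using psi by (simp add: density_def)
  let ?t = "\<lambda>\<Phi>. tensor_power (a * a) (a * b) (?E \<Phi>) 1"
  have "ereal (1 / real 1) * channel_div ((a * a) ^ 1) (?t N) (?t M) \<le>
      channel_div_reg (a * a) (a * b) (?E N) (?E M)"
    unfolding channel_div_reg_def by (rule SUP_upper) simp
  moreover have "ereal (1 / real 1) * x = x" for x by (simp add: one_ereal_def[symmetric])
  ultimately have "channel_div ((a * a) ^ 1) (?t N) (?t M) \<le>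
      channel_div_reg (a * a) (a * b) (?E N) (?E M)" by metis
  hence "channel_div ((a * a) ^ 1) (?t N) (?t M) < \<infinity>" using fin by (rule le_less_trans)
  moreover have "rel_entropy (?t N \<psi>) (?t M \<psi>) \<le> channel_div ((a * a) ^ 1) (?t N) (?t M)"
    unfolding channel_div_def by (rule SUP_upper[OF dens])
  ultimately have "rel_entropy (?t N \<psi>) (?t M \<psi>) \<noteq> \<infinity>" by auto
  hence sub: "msupp (?E N \<psi>) \<subseteq> msupp (?E M \<psi>)"
    unfolding tensor_power_one[OF E(1) psd_carrier[OF psi]] tensor_power_one[OF F(1) psd_carrier[OF psi]]
      rel_entropy_def by (auto split: if_splits)
  obtain L where L: "\<And>c. L \<le> c \<Longrightarrow> psd (a * b) (complex_of_real c \<cdot>\<^sub>m ?E M \<psi> - ?E N \<psi>)"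
    using msupp_subset_dominated[OF E(4)[OF psi] F(4)[OF psi] sub] by blast
  have "cp_dominated a b c N M" if c: "L \<le> c" for c
    unfolding cp_dominated_def
  proof (rule choi_completely_positive[OF linear_map_combination[OF N'(1) M'(1)]])
    let ?D = "\<lambda>X. complex_of_real c \<cdot>\<^sub>m M X - N X"
    have EN: "?E N \<psi> = complex_of_real (1 / real a) \<cdot>\<^sub>m ?E N ?J" and EM: "?E M \<psi> = complex_of_real (1 / real a) \<cdot>\<^sub>m ?E M ?J"
      unfolding \<psi>_def by (rule linear_mapD(3)[OF E(1) Jc], rule linear_mapD(3)[OF F(1) Jc])
    note cN = linear_mapD(1)[OF E(1) Jc] and cM = linear_mapD(1)[OF F(1) Jc]
    have "?E ?D ?J = complex_of_real c \<cdot>\<^sub>m ?E M ?J - ?E N ?J"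
    proof (rule linear_map_kron_eqI[OF id_tensor_linear linear_map_combination[OF id_tensor_linear id_tensor_linear] _ Jc])
      fix X Y :: "complex mat" assume XY: "X \<in> carrier_mat a a" "Y \<in> carrier_mat a a"
      show "?E ?D (kron X Y) = complex_of_real c \<cdot>\<^sub>m ?E M (kron X Y) - ?E N (kron X Y)"
        unfolding id_tensor_kron[OF linear_map_combination[OF N'(1) M'(1)] XY] id_tensor_kron[OF N'(1) XY]
          id_tensor_kron[OF M'(1) XY] kron_smult_right[symmetric]
        by (rule kron_minus_right[OF XY(1) smult_carrier_mat[OF linear_mapD(1)[OF M'(1) XY(2)]]
              linear_mapD(1)[OF N'(1) XY(2)]])
    qed
    also have "\<dots> = complex_of_real (real a) \<cdot>\<^sub>m (complex_of_real c \<cdot>\<^sub>m ?E M \<psi> - ?E N \<psi>)"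
      unfolding EN EM using cN cM a by (intro eq_matI) (auto simp: field_simps)
    finally show "psd (a * b) (?E ?D ?J)" using psd_smult[OF L[OF c], of "real a"] by simp
  qed
  thus ?thesis by blast
qed

section \<open>From coherent to sequential strategies\<close>

lemma type_I_error_eq:
  assumes T: "T \<in> tests d" and rho: "psd d \<rho>" "mtrace \<rho> = 1"
  shows "type_I_error (\<rho>, \<sigma>, T) = 1 - Re (mtrace (T * \<rho>))"
proof -
  note Tc = testsD(3)[OF T] and rc = psd_carrier[OF rho(1)]
  have "(1\<^sub>m (dim_row T) - T) * \<rho> = \<rho> - T * \<rho>"
    using minus_mult_distrib_mat[OF one_carrier_mat Tc rc] Tc rc by simp
  thus ?thesis
    using mtrace_minus[OF rc, of "T * \<rho>"] Tc rc rho(2) by (simp add: type_I_error_def)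
qed

text \<open>Arithmetic of exponents: \<open>l\<close> is the level of the test bound,
  \<open>l'\<close> the Type-II rate, \<open>H\<close> the additional exponent of a
  \<open>B\<close>-step per copy, \<open>\<epsilon>\<close> the fraction of such steps, and
  \<open>g\<close> a rate achieved by both kinds of histories. The condition
  \<open>8 \<le> g * real m\<close> ensures that \<open>16 ^ n\<close>, which is
  \<open>2 powr (4 * real n)\<close>, costs at most half of \<open>g\<close> after the m-th
  root.\<close>

lemma exponent_bound:
  fixes p \<beta> l l' H c g \<epsilon> :: real and m n K :: nat
  assumes p: "0 \<le> p" and \<beta>: "0 \<le> \<beta>" "\<beta> \<le> 2 powr (- (real n * l'))"
    and H: "0 \<le> H" and c: "0 < c" and m: "0 < m" "8 \<le> g * real m"
    and g: "g \<le> (l' - l) / 2" "g \<le> c * \<epsilon>" and \<epsilon>: "H * \<epsilon> \<le> (l' - l) / 2"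
    and K: "\<epsilon> * real n \<le> real K" "real K \<le> \<epsilon> * real n + 1"
    and le: "p ^ m \<le> 16 ^ n * ((2 powr (real m * l)) ^ n * (2 powr (real m * H)) ^ K * \<beta> ^ m +
      (2 powr (- (c * real m))) ^ K)"
  shows "p \<le> 2 powr (1 + H - real n * g / 2)"
proof -
  let ?x = "real m * (H - real n * g)"
  have pw: "(2 powr x) ^ k = 2 powr (x * real k)" for x :: real and k
    by (simp add: powr_power mult.commute)
  have HK: "H * real K \<le> real n * ((l' - l) / 2) + H"
  proof -
    have "H * real K \<le> H * (\<epsilon> * real n + 1)" by (rule mult_left_mono[OF K(2) H])
    also have "\<dots> = real n * (H * \<epsilon>) + H" by (simp add: algebra_simps)
    also have "\<dots> \<le> real n * ((l' - l) / 2) + H" using mult_left_mono[OF \<epsilon>, of "real n"] by simp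
    finally show ?thesis .
  qed
  have ng: "real n * g \<le> real n * ((l' - l) / 2)" by (rule mult_left_mono[OF g(1)]) simp
  have "(2 powr (real m * l)) ^ n * (2 powr (real m * H)) ^ K * \<beta> ^ m \<le>
      (2 powr (real m * l)) ^ n * (2 powr (real m * H)) ^ K * (2 powr (- (real n * l'))) ^ m"
    by (intro mult_left_mono power_mono \<beta>) auto
  also have "\<dots> = 2 powr (real m * (real n * l + H * real K - real n * l'))"
    unfolding pw by (simp add: powr_add[symmetric] algebra_simps)
  also have "\<dots> \<le> 2 powr ?x"
  proof (intro powr_mono mult_left_mono)
    have "real n * l' - real n * l = real n * ((l' - l) / 2) + real n * ((l' - l) / 2)" by (simp add: field_simps)
    thus "real n * l + H * real K - real n * l' \<le> H - real n * g"
      using HK ng by linarith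
  qed auto
  finally have 1: "(2 powr (real m * l)) ^ n * (2 powr (real m * H)) ^ K * \<beta> ^ m \<le> 2 powr ?x" .
  have "real n * g \<le> c * (\<epsilon> * real n)"
    using mult_left_mono[OF g(2), of "real n"] by (simp add: algebra_simps)
  also have "\<dots> \<le> c * real K" by (rule mult_left_mono[OF K(1)]) (use c in simp)
  finally have cK: "real n * g \<le> c * real K" .
  have "(2 powr (- (c * real m))) ^ K = 2 powr (real m * (- (c * real K)))"
    unfolding pw by (simp add: algebra_simps)
  also have "\<dots> \<le> 2 powr ?x"
    by (intro powr_mono mult_left_mono) (use cK H in auto)
  finally have 2: "(2 powr (- (c * real m))) ^ K \<le> 2 powr ?x" .
  have "p ^ m \<le> 16 ^ n * (2 powr ?x + 2 powr ?x)"
    using le add_mono[OF 1 2] by (meson mult_left_mono order_trans zero_le_power zero_le_numeral)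
  also have "(16 :: real) ^ n = 2 powr (4 * real n)"
  proof -
    have "(16 :: real) ^ n = (2 powr 4) ^ n" by simp
    thus ?thesis unfolding pw .
  qed
  also have "2 powr (4 * real n) * (2 powr ?x + 2 powr ?x) = 2 powr (4 * real n + 1 + ?x)"
    by (simp add: powr_add)
  also have "\<dots> \<le> 2 powr (real m * (1 + H - real n * g / 2))"
  proof (intro powr_mono)
    have "real n * 8 \<le> real n * (g * real m)" by (rule mult_left_mono[OF m(2)]) simp
    moreover have "1 \<le> real m" using m(1) by simp
    ultimately show "4 * real n + 1 + ?x \<le> real m * (1 + H - real n * g / 2)"
      by (simp add: algebra_simps)
  qed auto
  also have "\<dots> = (2 powr (1 + H - real n * g / 2)) ^ m" unfolding pw by (simp add: mult.commute)
  finally have "p ^ m \<le> (2 powr (1 + H - real n * g / 2)) ^ m" .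
  thus ?thesis using m(1) by (intro power_le_imp_le_base[of p "m - 1"]) simp_all
qed

lemma eventually_real_ge: "\<forall>\<^sub>F k in sequentially. x \<le> real k"
  using filterlim_real_sequentially by (simp add: filterlim_at_top)

text \<open>A maximiser up to a factor 2 exists without any compactness argument. The point
  \<open>x0\<close> serves when the supremum is 0 and guarantees a nonnegative value.\<close>

lemma near_maximiser:
  fixes f :: "'a \<Rightarrow> real"
  assumes "\<And>x. x \<in> S \<Longrightarrow> f x \<le> C" and x0: "x0 \<in> S" "0 \<le> f x0"
  shows "\<exists>x\<in>S. 0 \<le> f x \<and> (\<forall>y\<in>S. f y \<le> 2 * f x)"
proof -
  let ?M = "Sup (f ` S)"
  have bdd: "bdd_above (f ` S)" using assms(1) by (intro bdd_aboveI[of _ C]) auto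
  have le: "y \<in> S \<Longrightarrow> f y \<le> ?M" for y by (rule cSup_upper[OF _ bdd]) simp
  show ?thesis
  proof (cases "0 < ?M")
    case True
    hence "?M / 2 < ?M" by simp
    then obtain x where x: "x \<in> S" "?M / 2 < f x"
      using less_cSup_iff[OF _ bdd, of "?M / 2"] x0(1) by auto
    have "f y \<le> 2 * f x" if "y \<in> S" for y using le[OF that] x(2) by simp
    thus ?thesis using x True by (intro bexI[of _ x]) auto
  next
    case False
    hence "f y \<le> 2 * f x0" if "y \<in> S" for y using le[OF that] x0(2) by simp
    thus ?thesis using x0 by blast
  qed
qed

lemma density_nonempty:
  assumes "0 < d"
  shows "complex_of_real (1 / real d) \<cdot>\<^sub>m 1\<^sub>m d \<in> density d"
  using psd_smult[OF psd_one, of "1 / real d" d] assms mtrace_smult[OF one_carrier_mat, of "complex_of_real (1 / real d)" d]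
  by (simp add: density_def mtrace_one)

lemma tests_zero: "0\<^sub>m d d \<in> tests d"
proof -
  have "1\<^sub>m d - 0\<^sub>m d d = (1\<^sub>m d :: complex mat)" by (rule eq_matI) auto
  thus ?thesis by (simp add: tests_def psd_one psd_zero)
qed

text \<open>A nonnegative value of the functional means that \<open>2 powr (real n * l)\<close>
  times the Type-II error is at most 1, so the Type-II exponent is at least \<open>l\<close> and the
  strong converse property applies to the near-optimal strategies. The bound on their success
  probability then bounds the value of every strategy, the factor 2 coming from
  near-optimality.\<close>

lemma coherent_test_bound:
  assumes E: "E \<in> CPTP dC dG" and F: "F \<in> CPTP dC dG" and dC: "0 < dC"
    and esc: "exp_strong_converse coherent_strategies dC dG E F"
    and l: "channel_div_reg dC dG E F < ereal l"
  shows "\<exists>c>0. \<exists>m. strict_mono m \<and> (\<forall>\<^sub>F k in sequentially.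
    test_bound (dC ^ m k) (dG ^ m k) (tensor_power dC dG E (m k)) (tensor_power dC dG F (m k))
      (2 powr (real (m k) * l)) (2 * 2 powr (- c * real (m k))))"
proof -
  let ?E = "tensor_power dC dG E" and ?F = "tensor_power dC dG F"
  note E' = CPTP_D[OF CPTP_tensor_power[OF E]] and F' = CPTP_D[OF CPTP_tensor_power[OF F]]
  define S where "S n = density (dC ^ n) \<times> tests (dG ^ n)" for n
  define v where "v n = (\<lambda>(\<psi>, T). Re (mtrace (T * ?E n \<psi>)) - 2 powr (real n * l) * Re (mtrace (T * ?F n \<psi>)))" for n
  have SD: "psd (dC ^ n) \<psi>" "mtrace \<psi> = 1" "T \<in> tests (dG ^ n)" if "(\<psi>, T) \<in> S n" for n \<psi> T
    using that by (auto simp: S_def density_def)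
  have succ: "Re (mtrace (T * ?E n \<psi>)) \<le> 1" "0 \<le> Re (mtrace (T * ?F n \<psi>))" if "(\<psi>, T) \<in> S n" for n \<psi> T
    using mtrace_test_le[OF SD(3)[OF that] E'(4)[OF SD(1)[OF that]]] E'(3)[OF psd_carrier[OF SD(1)[OF that]]]
      SD(2)[OF that] psd_mtrace_mult(1)[OF testsD(1)[OF SD(3)[OF that]] F'(4)[OF SD(1)[OF that]]] by auto
  have v1: "v n x \<le> 1" if "x \<in> S n" for n x
  proof -
    obtain \<psi> T where x: "x = (\<psi>, T)" by (cases x)
    have "0 \<le> 2 powr (real n * l) * Re (mtrace (T * ?F n \<psi>))"
      using succ(2) that unfolding x by (intro mult_nonneg_nonneg) auto
    thus ?thesis using succ(1)[OF that[unfolded x]] unfolding x by (simp add: v_def)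
  qed
  have "\<exists>x\<in>S n. 0 \<le> v n x \<and> (\<forall>y\<in>S n. v n y \<le> 2 * v n x)" for n
  proof (rule near_maximiser[OF v1])
    \<comment> \<open>With the zero test the functional is 0, which provides the nonnegative
      starting point.\<close>
    let ?\<psi> = "complex_of_real (1 / real (dC ^ n)) \<cdot>\<^sub>m 1\<^sub>m (dC ^ n)" and ?T = "0\<^sub>m (dG ^ n) (dG ^ n)"
    show x0: "(?\<psi>, ?T) \<in> S n"
      using density_nonempty[of "dC ^ n"] tests_zero dC by (simp add: S_def)
    have "mtrace (?T * X) = 0" if "X \<in> carrier_mat (dG ^ n) (dG ^ n)" for X
      using left_mult_zero_mat[OF that] by (simp add: mtrace_def)
    thus "0 \<le> v n (?\<psi>, ?T)"
      using psd_carrier[OF E'(4)[OF SD(1)[OF x0]]] psd_carrier[OF F'(4)[OF SD(1)[OF x0]]] by (simp add: v_def)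
  qed
  then obtain x where x: "\<And>n. x n \<in> S n" "\<And>n. 0 \<le> v n (x n)" "\<And>n y. y \<in> S n \<Longrightarrow> v n y \<le> 2 * v n (x n)"
    by metis
  define s where "s n = (?E n (fst (x n)), ?F n (fst (x n)), snd (x n))" for n
  have xS: "(fst (x n), snd (x n)) \<in> S n" for n using x(1)[of n] by simp
  have s: "s n \<in> coherent_strategies dC dG E F n" for n
    using xS[of n] unfolding s_def coherent_strategies_def S_def by blast
  have vx: "v n (x n) = Re (mtrace (snd (x n) * ?E n (fst (x n)))) - 2 powr (real n * l) * type_II_error (s n)" for n
    by (simp add: v_def s_def type_II_error_def split_beta)
  have tI: "1 - type_I_error (s n) = Re (mtrace (snd (x n) * ?E n (fst (x n))))" for n
  proof -
    have "mtrace (?E n (fst (x n))) = 1" using E'(3)[OF psd_carrier[OF SD(1)[OF xS]]] SD(2)[OF xS] by simp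
    thus ?thesis unfolding s_def using type_I_error_eq[OF SD(3)[OF xS] E'(4)[OF SD(1)[OF xS]]] by simp
  qed
  have rate: "ereal l \<le> ereal (1 / real n) * neg_log2 (type_II_error (s n))" if n: "1 \<le> n" for n
  proof (cases "type_II_error (s n) \<le> 0")
    case True
    thus ?thesis using n by (simp add: neg_log2_def)
  next
    case False
    hence pos: "0 < type_II_error (s n)" by simp
    have "2 powr (real n * l) * type_II_error (s n) \<le> 1"
      using x(2)[of n] vx[of n] succ(1)[OF xS[of n]] by simp
    hence "log 2 (2 powr (real n * l) * type_II_error (s n)) \<le> log 2 1" using pos by (intro log_le_cancel_iff[THEN iffD2]) auto
    hence "real n * l + log 2 (type_II_error (s n)) \<le> 0" using pos by (simp add: log_mult log_powr)
    hence "l \<le> 1 / real n * (- log 2 (type_II_error (s n)))" using n by (simp add: field_simps)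
    thus ?thesis using False by (simp add: neg_log2_def)
  qed
  have "ereal l \<le> liminf (\<lambda>n. ereal (1 / real n) * neg_log2 (type_II_error (s n)))"
    by (rule Liminf_bounded) (use rate in \<open>auto intro: eventually_sequentiallyI[of 1]\<close>)
  hence "channel_div_reg dC dG E F < liminf (\<lambda>n. ereal (1 / real n) * neg_log2 (type_II_error (s n)))"
    using l by (rule less_le_trans[rotated])
  then obtain c m where cm: "0 < c" "strict_mono m"
      "\<forall>\<^sub>F k in sequentially. 1 - type_I_error (s (m k)) \<le> 2 powr (- c * real (m k))"
    using esc s unfolding exp_strong_converse_def by blast
  have "test_bound (dC ^ n) (dG ^ n) (?E n) (?F n) (2 powr (real n * l)) (2 * 2 powr (- c * real n))"
    if n: "1 - type_I_error (s n) \<le> 2 powr (- c * real n)" for n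
  proof (rule test_bound_densityI[OF E'(1) F'(1)])
    fix \<psi> T assume "\<psi> \<in> density (dC ^ n)" "T \<in> tests (dG ^ n)"
    hence "v n (\<psi>, T) \<le> 2 * v n (x n)" by (intro x(3)) (simp add: S_def)
    also have "v n (x n) \<le> 2 powr (- c * real n)"
    proof -
      have "0 \<le> 2 powr (real n * l) * type_II_error (s n)"
        using succ(2)[OF xS[of n]] by (intro mult_nonneg_nonneg) (auto simp: s_def type_II_error_def)
      thus ?thesis using n unfolding vx tI by simp
    qed
    finally show "Re (mtrace (T * ?E n \<psi>)) \<le>
        2 powr (real n * l) * Re (mtrace (T * ?F n \<psi>)) + 2 * 2 powr (- c * real n)"
      by (simp add: v_def)
  qed
  thus ?thesis using cm by (intro exI[of _ c] conjI exI[of _ m]) (auto elim: eventually_mono)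
qed

lemma coherent_imp_sequential:
  assumes dA: "0 < dA" and N: "N \<in> CPTP dA dB" and M: "M \<in> CPTP dA dB"
    and esc: "exp_strong_converse coherent_strategies (dA * dA) (dA * dB)
      (id_tensor dA dA dB N) (id_tensor dA dA dB M)"
  shows "exp_strong_converse sequential_strategies (dA * dA) (dA * dB)
      (id_tensor dA dA dB N) (id_tensor dA dA dB M)"
  unfolding exp_strong_converse_def
proof (intro allI impI)
  let ?C = "dA * dA" and ?G = "dA * dB" and ?E = "id_tensor dA dA dB N" and ?F = "id_tensor dA dA dB M"
  let ?d = "channel_div_reg ?C ?G ?E ?F"
  fix s
  assume s: "\<forall>n\<ge>1. s n \<in> sequential_strategies ?C ?G ?E ?F n"
    and lim: "?d < liminf (\<lambda>n. ereal (1 / real n) * neg_log2 (type_II_error (s n)))"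
  note E = CPTP_id_tensor[OF N, of dA] and F = CPTP_id_tensor[OF M, of dA]
  \<comment> \<open>Half of the gap between \<open>l\<close> and \<open>l'\<close> will pay for the
    \<open>B\<close>-steps, the other half remains as decay.\<close>
  obtain l' where l': "?d < ereal l'" "ereal l' < liminf (\<lambda>n. ereal (1 / real n) * neg_log2 (type_II_error (s n)))"
    using ereal_dense2[OF lim] by blast
  obtain l where l: "?d < ereal l" "l < l'" using ereal_dense2[OF l'(1)] by auto
  have "?d < \<infinity>" using l'(1) by (metis less_ereal.simps(4) less_trans ereal_infty_less(1))
  then obtain L0 where L0: "\<And>c. L0 \<le> c \<Longrightarrow> cp_dominated dA dB c N M"
    using channel_div_reg_finite_dominated[OF dA N M] by blast
  \<comment> \<open>The maximum with \<open>2 powr l\<close> makes \<open>H\<close> nonnegative,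
    that is \<open>1 \<le> q\<close>.\<close>
  define L where "L = max L0 (2 powr l)"
  define H where "H = log 2 L - l"
  have Ll: "2 powr l \<le> L" by (simp add: L_def)
  have Lpos: "0 < L" by (rule less_le_trans[OF _ Ll]) simp
  have H: "0 \<le> H"
  proof -
    have "log 2 (2 powr l) \<le> log 2 L" using Ll Lpos by (intro log_le_cancel_iff[THEN iffD2]) auto
    thus ?thesis by (simp add: H_def)
  qed
  have LH: "L = 2 powr (l + H)" using Lpos by (simp add: H_def)
  have dom: "cp_dominated ?C ?G L ?E ?F"
    by (intro cp_dominated_id_tensor CPTP_D(1,2)[OF N] CPTP_D(1)[OF M] L0) (simp add: L_def)
  obtain c m where c: "0 < c" and m: "strict_mono m"
      "\<forall>\<^sub>F k in sequentially. test_bound (?C ^ m k) (?G ^ m k) (tensor_power ?C ?G ?E (m k))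
        (tensor_power ?C ?G ?F (m k)) (2 powr (real (m k) * l)) (2 * 2 powr (- c * real (m k)))"
    using coherent_test_bound[OF E F _ esc l(1)] dA by auto
  \<comment> \<open>Halving the rate absorbs the factor 2 of the coherent bound as soon as
    \<open>1 \<le> c' * real M0\<close>.\<close>
  define c' where "c' = c / 2"
  \<comment> \<open>\<open>H + 1\<close> in place of \<open>H\<close> keeps the denominator
    positive.\<close>
  define \<epsilon> where "\<epsilon> = (l' - l) / (2 * (H + 1))"
  define g where "g = min ((l' - l) / 2) (c' * \<epsilon>)"
  have c': "0 < c'" using c by (simp add: c'_def)
  have \<epsilon>: "0 < \<epsilon>" using l(2) H by (simp add: \<epsilon>_def)
  have "0 < g" using l(2) c' \<epsilon> by (simp add: g_def)
  hence g: "0 < g" "g \<le> (l' - l) / 2" "g \<le> c' * \<epsilon>"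
    unfolding g_def by (simp_all only: min.cobounded1 min.cobounded2)
  have H\<epsilon>: "H * \<epsilon> \<le> (l' - l) / 2"
  proof -
    have "H * \<epsilon> \<le> (H + 1) * \<epsilon>" using \<epsilon> by (intro mult_right_mono) auto
    also have "\<dots> = (l' - l) / 2" using H by (simp add: \<epsilon>_def field_simps)
    finally show ?thesis .
  qed
  have "\<forall>\<^sub>F k in sequentially. max (8 / g) (1 / c') \<le> real k" by (rule eventually_real_ge)
  with m(2) have "\<forall>\<^sub>F k in sequentially. test_bound (?C ^ m k) (?G ^ m k) (tensor_power ?C ?G ?E (m k))
        (tensor_power ?C ?G ?F (m k)) (2 powr (real (m k) * l)) (2 * 2 powr (- c * real (m k))) \<and>
        max (8 / g) (1 / c') \<le> real k"
    by (rule eventually_conj)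
  \<comment> \<open>A single member of the subsequence is fixed from here on;
    \<open>k \<le> m k\<close> transfers the lower bound on \<open>k\<close> to
    \<open>M0\<close>.\<close>
  then obtain k where k: "test_bound (?C ^ m k) (?G ^ m k) (tensor_power ?C ?G ?E (m k))
        (tensor_power ?C ?G ?F (m k)) (2 powr (real (m k) * l)) (2 * 2 powr (- c * real (m k)))"
      "max (8 / g) (1 / c') \<le> real k"
    by (auto dest!: eventually_happens)
  define M0 where "M0 = m k"
  have "k \<le> M0" unfolding M0_def by (rule strict_mono_imp_increasing[OF m(1)])
  hence M0: "8 / g \<le> real M0" "1 / c' \<le> real M0" using k(2) by auto
  have M0': "8 \<le> g * real M0" "1 \<le> c' * real M0"
    using M0 g(1) c' by (auto simp: field_simps)
  have M0pos: "0 < M0" using M0'(2) by (cases M0) auto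
  define \<mu> where "\<mu> = 2 powr (real M0 * l)"
  define \<kappa> where "\<kappa> = 2 powr (- (c' * real M0))"
  define q where "q = 2 powr (real M0 * H)"
  have \<kappa>2: "2 * 2 powr (- c * real M0) \<le> \<kappa>"
  proof -
    have "2 * 2 powr (- c * real M0) = 2 powr (1 - c * real M0)" by (simp add: powr_diff powr_minus field_simps)
    also have "\<dots> \<le> \<kappa>" unfolding \<kappa>_def using M0'(2) by (intro powr_mono) (auto simp: c'_def)
    finally show ?thesis .
  qed
  have \<kappa>1: "\<kappa> \<le> 1" unfolding \<kappa>_def using M0'(2) powr_mono[of "- (c' * real M0)" 0 2] by simp
  have q1: "1 \<le> q" unfolding q_def using H by (intro ge_one_powr_ge_zero) auto
  have \<mu>q: "\<mu> * q = L ^ M0"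
    unfolding \<mu>_def q_def LH by (simp add: powr_add[symmetric] powr_power algebra_simps)
  \<comment> \<open>The reference has dimension \<open>r * dA\<close>: the memory of the strategy
    together with the identity factor of the channel.\<close>
  have bound: "Re (mtrace (T * tensor_power (r * ?C) (r * ?G) (id_tensor r ?C ?G ?E) M0 X)) \<le>
      \<mu> * Re (mtrace (T * tensor_power (r * ?C) (r * ?G) (id_tensor r ?C ?G ?F) M0 X)) + \<kappa> * Re (mtrace X)"
    if X: "psd ((r * ?C) ^ M0) X" and T: "T \<in> tests ((r * ?G) ^ M0)" for r X T
  proof -
    have "test_bound ((r * dA * dA) ^ M0) ((r * dA * dB) ^ M0)
        (tensor_power (r * dA * dA) (r * dA * dB) (id_tensor (r * dA) dA dB N) M0)
        (tensor_power (r * dA * dA) (r * dA * dB) (id_tensor (r * dA) dA dB M) M0) \<mu> (2 * 2 powr (- c * real M0))"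
      unfolding \<mu>_def M0_def
      by (rule test_bound_tensor_power_reference[OF CPTP_D(1)[OF N] CPTP_D(1)[OF M] k(1)])
    from test_boundD[OF this, of X T] X T
    have "Re (mtrace (T * tensor_power (r * ?C) (r * ?G) (id_tensor r ?C ?G ?E) M0 X)) \<le>
      \<mu> * Re (mtrace (T * tensor_power (r * ?C) (r * ?G) (id_tensor r ?C ?G ?F) M0 X)) +
      (2 * 2 powr (- c * real M0)) * Re (mtrace X)"
      unfolding tensor_power_id_tensor_assoc[OF CPTP_D(1)[OF N]] tensor_power_id_tensor_assoc[OF CPTP_D(1)[OF M]]
      by (simp only: mult.assoc)
    also have "(2 * 2 powr (- c * real M0)) * Re (mtrace X) \<le> \<kappa> * Re (mtrace X)"
      by (rule mult_right_mono[OF \<kappa>2 psd_mtrace(1)[OF X]])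
    finally show ?thesis by simp
  qed
  have decay: "1 - type_I_error (s n) \<le> 2 powr (1 + H - real n * g / 2)"
    if n: "1 \<le> n" and rate: "ereal l' < ereal (1 / real n) * neg_log2 (type_II_error (s n))" for n
  proof -
    obtain r \<psi> P T where st: "s n = (seq_state ?C ?G ?E r \<psi> P (n - 1), seq_state ?C ?G ?F r \<psi> P (n - 1), T)"
        "\<psi> \<in> density (r 0 * ?C)" "\<And>i. i < n - 1 \<Longrightarrow> P i \<in> CPTP (r i * ?G) (r (Suc i) * ?C)"
        "T \<in> tests (r (n - 1) * ?G)"
      using s n unfolding sequential_strategies_def by blast
    have psi: "psd (r 0 * ?C) \<psi>" "mtrace \<psi> = 1" using st(2) by (auto simp: density_def)
    note sE = seq_state_psd[where r = r and i = "n - 1" and P = P, OF E psi(1) st(3)]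
    note sF = seq_state_psd[where r = r and i = "n - 1" and P = P, OF F psi(1) st(3)]
    define p where "p = Re (mtrace (T * seq_state ?C ?G ?E r \<psi> P (n - 1)))"
    define \<beta> where "\<beta> = Re (mtrace (T * seq_state ?C ?G ?F r \<psi> P (n - 1)))"
    have p: "1 - type_I_error (s n) = p" "0 \<le> p"
      using type_I_error_eq[OF st(4) sE(1)] sE(2) psi(2) psd_mtrace_mult(1)[OF testsD(1)[OF st(4)] sE(1)]
      by (auto simp: st(1) p_def)
    have \<beta>: "type_II_error (s n) = \<beta>" "0 \<le> \<beta>"
      using psd_mtrace_mult(1)[OF testsD(1)[OF st(4)] sF(1)] by (auto simp: st(1) \<beta>_def type_II_error_def)
    have \<beta>2: "\<beta> \<le> 2 powr (- (real n * l'))"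
    proof (cases "\<beta> \<le> 0")
      case False
      hence "l' < 1 / real n * (- log 2 \<beta>)" using rate unfolding \<beta>(1) by (simp add: neg_log2_def)
      hence "log 2 \<beta> \<le> - (real n * l')" using n by (simp add: field_simps)
      hence "2 powr (log 2 \<beta>) \<le> 2 powr (- (real n * l'))" by (intro powr_mono) auto
      thus ?thesis using False by simp
    qed (use order_trans[OF _ powr_ge_zero] in auto)
    \<comment> \<open>The budget of \<open>B\<close>-steps: a fraction \<open>\<epsilon>\<close> of
      the uses, rounded up.\<close>
    define K where "K = nat \<lceil>\<epsilon> * real n\<rceil>"
    have K: "\<epsilon> * real n \<le> real K" "real K \<le> \<epsilon> * real n + 1"
      using \<epsilon> by (auto simp: K_def of_nat_nat intro!: ceiling_mono)
    have "p ^ M0 \<le> 16 ^ n * (\<mu> ^ n * q ^ K * \<beta> ^ M0 + \<kappa> ^ K)"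
      unfolding p_def \<beta>_def
      by (rule sequential_power_bound[OF E F _ q1 _ \<kappa>1 _ \<mu>q bound dom _ st(2,3,4)])
        (use n Lpos in \<open>auto simp: \<mu>_def \<kappa>_def\<close>)
    thus ?thesis
      unfolding p(1) \<mu>_def q_def \<kappa>_def
      by (rule exponent_bound[OF p(2) \<beta>(2) \<beta>2 H c' M0pos M0'(1) g(2,3) H\<epsilon> K])
  qed
  have "\<forall>\<^sub>F n in sequentially. ereal l' < ereal (1 / real n) * neg_log2 (type_II_error (s n))"
    by (rule less_LiminfD[OF l'(2)])
  \<comment> \<open>For such \<open>n\<close> the term \<open>n g / 4\<close> outweighs the constant
    \<open>1 + H\<close>, which leaves the rate \<open>g / 4\<close>.\<close>
  moreover have "\<forall>\<^sub>F n in sequentially. max 1 (4 * (1 + H) / g) \<le> real n"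
    by (rule eventually_real_ge)
  ultimately have "\<forall>\<^sub>F n in sequentially. 1 - type_I_error (s n) \<le> 2 powr (- (g / 4) * real n)"
  proof eventually_elim
    case (elim n)
    hence n: "1 \<le> n" "4 * (1 + H) \<le> g * real n" using g(1) by (auto simp: field_simps)
    have "1 - type_I_error (s n) \<le> 2 powr (1 + H - real n * g / 2)" by (rule decay[OF n(1) elim(1)])
    also have "\<dots> \<le> 2 powr (- (g / 4) * real n)" using n(2) by (intro powr_mono) (auto simp: algebra_simps)
    finally show ?case .
  qed
  thus "\<exists>c>0. \<exists>m. strict_mono m \<and>
      (\<forall>\<^sub>F k in sequentially. 1 - type_I_error (s (m k)) \<le> 2 powr (- c * real (m k)))"
    \<comment> \<open>The bound holds for all large \<open>n\<close>, so the identity serves as the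
      subsequence.\<close>
    using g(1) by (intro exI[of _ "g / 4"] conjI exI[of _ "\<lambda>k. k"]) (auto simp: strict_mono_def)
qed

section \<open>The direction from sequential to coherent strategies\<close>

section \<open>Coherent strategies as sequential strategies\<close>

text \<open>Products of individual factors: during the rotation below some of them have passed
  through the channel and others have not.\<close>

definition kron_list :: "complex mat list \<Rightarrow> complex mat" where
  "kron_list Xs = foldr kron Xs (1\<^sub>m 1)"

lemma kron_list_simps [simp]: "kron_list [] = 1\<^sub>m 1" "kron_list (X # Xs) = kron X (kron_list Xs)"
  by (simp_all add: kron_list_def)

lemma kron_list_append: "kron_list (Xs @ Ys) = kron (kron_list Xs) (kron_list Ys)"
  by (induction Xs) (simp_all only: append.simps kron_list_simps kron_one_left kron_assoc)

lemma kron_list_carrier: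
  "(\<And>X. X \<in> set Xs \<Longrightarrow> X \<in> carrier_mat d d) \<Longrightarrow> kron_list Xs \<in> carrier_mat (d ^ length Xs) (d ^ length Xs)"
  by (induction Xs) auto

lemma matrix_unit_kron_list:
  assumes "i < d ^ n" "j < d ^ n"
  shows "\<exists>Xs. length Xs = n \<and> set Xs \<subseteq> carrier_mat d d \<and> matrix_unit (d ^ n) i j = kron_list Xs"
  using assms
proof (induction n arbitrary: i j)
  case 0
  have "matrix_unit 1 0 0 = (1\<^sub>m 1 :: complex mat)" by (rule eq_matI) (auto simp: matrix_unit_def)
  thus ?case using 0 by (intro exI[of _ "[]"]) simp
next
  case (Suc n)
  hence ij: "i < d * d ^ n" "j < d * d ^ n" by auto
  obtain Xs where Xs: "length Xs = n" "set Xs \<subseteq> carrier_mat d d"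
      "matrix_unit (d ^ n) (i mod d ^ n) (j mod d ^ n) = kron_list Xs"
    using Suc.IH[OF mod_less_of_prod[OF ij(1)] mod_less_of_prod[OF ij(2)]] by blast
  have "matrix_unit (d * d ^ n) i j =
      kron (matrix_unit d (i div d ^ n) (j div d ^ n)) (matrix_unit (d ^ n) (i mod d ^ n) (j mod d ^ n))"
    using matrix_unit_kron[OF div_less_of_prod[OF ij(1)] div_less_of_prod[OF ij(2)]
        mod_less_of_prod[OF ij(1)] mod_less_of_prod[OF ij(2)]]
    unfolding div_mult_mod_eq .
  thus ?case
    using Xs by (intro exI[of _ "matrix_unit d (i div d ^ n) (j div d ^ n) # Xs"]) simp
qed

lemma linear_map_kron_list_eqI:
  assumes "linear_map (d ^ n) b \<Phi>" "linear_map (d ^ n) b \<Psi>"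
    and eq: "\<And>Xs. length Xs = n \<Longrightarrow> set Xs \<subseteq> carrier_mat d d \<Longrightarrow> \<Phi> (kron_list Xs) = \<Psi> (kron_list Xs)"
    and "X \<in> carrier_mat (d ^ n) (d ^ n)"
  shows "\<Phi> X = \<Psi> X"
proof (rule linear_map_eqI[OF assms(1,2) _ assms(4)])
  fix i j assume "i < d ^ n" "j < d ^ n"
  then obtain Xs where "length Xs = n" "set Xs \<subseteq> carrier_mat d d" "matrix_unit (d ^ n) i j = kron_list Xs"
    using matrix_unit_kron_list by blast
  thus "\<Phi> (matrix_unit (d ^ n) i j) = \<Psi> (matrix_unit (d ^ n) i j)" using eq by simp
qed

lemma tensor_power_kron_list:
  assumes "linear_map a b \<Phi>" "set Xs \<subseteq> carrier_mat a a"
  shows "tensor_power a b \<Phi> (length Xs) (kron_list Xs) = kron_list (map \<Phi> Xs)"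
  using assms(2)
proof (induction Xs)
  case (Cons X Xs)
  hence c: "X \<in> carrier_mat a a" "kron_list Xs \<in> carrier_mat (a ^ length Xs) (a ^ length Xs)"
    by (auto intro: kron_list_carrier)
  show ?case
    using tensor_map_kron[OF assms(1) linear_map_tensor_power c] Cons by simp
qed simp

lemma linear_map_seq_state:
  assumes P: "\<And>j. j < i \<Longrightarrow> linear_map (r j * dG) (r (Suc j) * dC) (P j)"
  shows "linear_map (r 0 * dC) (r i * dG) (\<lambda>\<psi>. seq_state dC dG E r \<psi> P i)"
  using P
proof (induction i)
  case 0
  show ?case by (simp add: id_tensor_linear)
next
  case (Suc i)
  have "linear_map (r 0 * dC) (r i * dG) (\<lambda>\<psi>. seq_state dC dG E r \<psi> P i)" by (rule Suc.IH) (use Suc.prems in auto)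
  from linear_map_comp[OF linear_map_comp[OF this Suc.prems[of i]] id_tensor_linear]
  show ?case by simp
qed

text \<open>At step \<open>i\<close> the memory consists of \<open>i\<close> outputs and of the
  \<open>n - 1 - i\<close> inputs that are neither used nor being fed to the channel.\<close>

definition rotation_memory :: "nat \<Rightarrow> nat \<Rightarrow> nat \<Rightarrow> nat \<Rightarrow> nat" where
  "rotation_memory dC dG n i = dG ^ i * dC ^ (n - 1 - i)"

text \<open>The flip moves the fresh output, which is the last factor, in front of the memory; as
  long as an input is left, the last factor is then the next input.\<close>

definition rotate_channel :: "nat \<Rightarrow> nat \<Rightarrow> nat \<Rightarrow> nat \<Rightarrow> complex mat \<Rightarrow> complex mat" where
  "rotate_channel dC dG n i X =
    swap_mat (rotation_memory dC dG n i) dG * X * mat_adjoint (swap_mat (rotation_memory dC dG n i) dG)"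

text \<open>The memory holds the systems not currently fed to the channel; after each use the output is moved
  to the front, so that the systems are processed from the last to the first.\<close>

lemma rotate_seq_state:
  assumes E: "linear_map dC dG E" and Xs: "length Xs = n" "set Xs \<subseteq> carrier_mat dC dC" and i: "i < n"
  shows "rotate_channel dC dG n i
      (seq_state dC dG E (rotation_memory dC dG n) (kron_list Xs) (rotate_channel dC dG n) i) =
    kron_list (map E (drop (n - 1 - i) Xs) @ take (n - 1 - i) Xs)"
  using i
proof (induction i)
  case 0
  hence n: "n = Suc (n - 1)" by simp
  let ?X = "Xs ! (n - 1)" and ?Y = "take (n - 1) Xs"
  have "Xs = take (Suc (n - 1)) Xs" using Xs n by simp
  also have "\<dots> = ?Y @ [?X]" by (rule take_Suc_conv_app_nth) (use Xs n in simp)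
  finally have XY: "Xs = ?Y @ [?X]" .
  have X: "?X \<in> carrier_mat dC dC" using Xs n by (metis nth_mem subsetD lessI)
  have lY: "length ?Y = n - 1" using Xs by simp
  have Y: "kron_list ?Y \<in> carrier_mat (rotation_memory dC dG n 0) (rotation_memory dC dG n 0)"
    using kron_list_carrier[of ?Y dC] Xs lY by (auto simp: rotation_memory_def dest: in_set_takeD)
  have "kron_list Xs = kron (kron_list ?Y) ?X"
    by (subst XY) (simp only: kron_list_append kron_list_simps kron_one_right)
  hence "seq_state dC dG E (rotation_memory dC dG n) (kron_list Xs) (rotate_channel dC dG n) 0 =
      kron (kron_list ?Y) (E ?X)"
    using id_tensor_kron[OF E Y X] by simp
  moreover have "drop (n - 1) Xs = [?X]"
  proof -
    have "?X # drop (Suc (n - 1)) Xs = drop (n - 1) Xs" by (rule Cons_nth_drop_Suc) (use Xs n in simp)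
    thus ?thesis using Xs n by simp
  qed
  ultimately show ?case
    using swap_mat_conj[OF Y linear_mapD(1)[OF E X]] by (simp add: rotate_channel_def)
next
  case (Suc i)
  \<comment> \<open>\<open>Xs ! k\<close> is the input consumed by this use, and the
    \<open>k\<close> inputs before it stay in the memory.\<close>
  define k where "k = n - 1 - Suc i"
  have k: "n - 1 - i = Suc k" "k < n" "n - Suc k = Suc i" using Suc.prems by (auto simp: k_def)
  let ?X = "Xs ! k" and ?Y = "map E (drop (Suc k) Xs) @ take k Xs"
  have X: "?X \<in> carrier_mat dC dC" using Xs k(2) by (metis nth_mem subsetD)
  have Y: "kron_list ?Y \<in> carrier_mat (rotation_memory dC dG n (Suc i)) (rotation_memory dC dG n (Suc i))"
  proof -
    have "kron_list (map E (drop (Suc k) Xs)) \<in> carrier_mat (dG ^ Suc i) (dG ^ Suc i)"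
      using kron_list_carrier[of "map E (drop (Suc k) Xs)" dG] linear_mapD(1)[OF E] Xs k
      by (auto dest: in_set_dropD)
    moreover have "kron_list (take k Xs) \<in> carrier_mat (dC ^ k) (dC ^ k)"
      using kron_list_carrier[of "take k Xs" dC] Xs k by (auto dest: in_set_takeD)
    ultimately show ?thesis
      unfolding kron_list_append rotation_memory_def k_def[symmetric] by (rule kron_carrier)
  qed
  have "rotate_channel dC dG n i
      (seq_state dC dG E (rotation_memory dC dG n) (kron_list Xs) (rotate_channel dC dG n) i) =
      kron_list (map E (drop (Suc k) Xs) @ take (Suc k) Xs)"
    using Suc k(1) by simp
  also have "take (Suc k) Xs = take k Xs @ [?X]" by (rule take_Suc_conv_app_nth) (use Xs k in simp)
  also have "kron_list (map E (drop (Suc k) Xs) @ take k Xs @ [?X]) = kron (kron_list ?Y) ?X"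
    by (simp only: append_assoc[symmetric] kron_list_append[of _ "[?X]"] kron_list_simps kron_one_right)
  finally have "seq_state dC dG E (rotation_memory dC dG n) (kron_list Xs) (rotate_channel dC dG n) (Suc i) =
      kron (kron_list ?Y) (E ?X)"
    using id_tensor_kron[OF E Y X] by simp
  moreover have "drop k Xs = ?X # drop (Suc k) Xs" by (rule Cons_nth_drop_Suc[symmetric]) (use Xs k in simp)
  moreover have "rotate_channel dC dG n (Suc i) (kron (kron_list ?Y) (E ?X)) = kron (E ?X) (kron_list ?Y)"
    unfolding rotate_channel_def by (rule swap_mat_conj[OF Y linear_mapD(1)[OF E X]])
  ultimately show ?case unfolding k_def[symmetric] by (simp del: seq_state.simps)
qed

text \<open>An update only factors the same total space anew: one output joins the memory and one
  input leaves it.\<close>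

lemma rotation_memory_Suc:
  assumes "i < n - 1"
  shows "rotation_memory dC dG n (Suc i) * dC = rotation_memory dC dG n i * dG"
proof -
  have "n - 1 - i = Suc (n - 1 - Suc i)" using assms by simp
  thus ?thesis by (simp add: rotation_memory_def mult_ac)
qed

lemma rotate_channel_CPTP:
  "rotate_channel dC dG n i \<in> CPTP (rotation_memory dC dG n i * dG) (rotation_memory dC dG n i * dG)"
  using CPTP_unitary_conj[OF unitary_swap_mat] by (simp add: rotate_channel_def[abs_def])

text \<open>After the last use one more rotation would restore the order of the outputs; since no
  update follows, it is absorbed into the test as \<open>T'\<close>. Equality of the states is
  verified on product operators, although \<open>\<psi>\<close> may be entangled.\<close>

lemma coherent_as_sequential:
  assumes E: "E \<in> CPTP dC dG" and F: "F \<in> CPTP dC dG" and dims: "0 < dC" "0 < dG" and n: "1 \<le> n"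
    and s: "s \<in> coherent_strategies dC dG E F n"
  shows "\<exists>s'\<in>sequential_strategies dC dG E F n.
    type_I_error s' = type_I_error s \<and> type_II_error s' = type_II_error s"
proof -
  obtain \<psi> T where st: "s = (tensor_power dC dG E n \<psi>, tensor_power dC dG F n \<psi>, T)"
      "\<psi> \<in> density (dC ^ n)" "T \<in> tests (dG ^ n)"
    using s by (auto simp: coherent_strategies_def)
  have psi: "psd (dC ^ n) \<psi>" "mtrace \<psi> = 1" using st(2) by (auto simp: density_def)
  let ?r = "rotation_memory dC dG n" and ?P = "rotate_channel dC dG n"
  let ?S = "swap_mat (?r (n - 1)) dG" and ?st = "\<lambda>G. seq_state dC dG G ?r \<psi> ?P (n - 1)"
  have r0: "?r 0 * dC = dC ^ n" using n by (cases n) (auto simp: rotation_memory_def)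
  have rn: "?r (n - 1) * dG = dG ^ n" using n by (cases n) (auto simp: rotation_memory_def)
  have P: "?P i \<in> CPTP (?r i * dG) (?r (Suc i) * dC)" if "i < n - 1" for i
    unfolding rotation_memory_Suc[OF that] by (rule rotate_channel_CPTP)
  have US: "unitary (dG ^ n) ?S" using unitary_swap_mat[of "?r (n - 1)" dG] unfolding rn .
  have fin: "?S * ?st G * mat_adjoint ?S = tensor_power dC dG G n \<psi>" if G: "G \<in> CPTP dC dG" for G
  proof (rule linear_map_kron_list_eqI[OF _ linear_map_tensor_power _ psd_carrier[OF psi(1)]])
    have "linear_map (dC ^ n) (dG ^ n) (\<lambda>\<psi>. seq_state dC dG G ?r \<psi> ?P (n - 1))"
      using linear_map_seq_state[of "n - 1" ?r dG dC ?P G] CPTP_D(1)[OF P] unfolding r0 rn by blast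
    from linear_map_comp[OF this linear_map_conj[OF unitary_carrier[OF US]]]
    show "linear_map (dC ^ n) (dG ^ n) (\<lambda>\<psi>. ?S * seq_state dC dG G ?r \<psi> ?P (n - 1) * mat_adjoint ?S)" .
    fix Xs :: "complex mat list" assume Xs: "length Xs = n" "set Xs \<subseteq> carrier_mat dC dC"
    have "n - 1 < n" using n by simp
    from rotate_seq_state[OF CPTP_D(1)[OF G] Xs this] tensor_power_kron_list[OF CPTP_D(1)[OF G] Xs(2)] Xs(1)
    show "?S * seq_state dC dG G ?r (kron_list Xs) ?P (n - 1) * mat_adjoint ?S = tensor_power dC dG G n (kron_list Xs)"
      by (simp add: rotate_channel_def)
  qed
  define T' where "T' = mat_adjoint ?S * T * ?S"
  have T': "T' \<in> tests (dG ^ n)"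
    using tests_unitary_conj[OF unitary_adjoint[OF US] st(3)] by (simp add: T'_def)
  have psi0: "psd (?r 0 * dC) \<psi>" using psi(1) by (simp add: r0)
  have state: "psd (dG ^ n) (?st G)" "mtrace (?st G) = 1" if "G \<in> CPTP dC dG" for G
    using seq_state_psd[where r = ?r and i = "n - 1" and P = ?P, OF that psi0 P]
    unfolding rn psi(2) by blast+
  have tr: "mtrace (T' * ?st G) = mtrace (T * tensor_power dC dG G n \<psi>)" if "G \<in> CPTP dC dG" for G
    unfolding fin[OF that, symmetric] T'_def
    by (rule mtrace_conj_test[OF unitary_carrier[OF US] psd_carrier[OF state(1)[OF that]] testsD(3)[OF st(3)], symmetric])
  have c: "psd (dG ^ n) (tensor_power dC dG E n \<psi>)" "mtrace (tensor_power dC dG E n \<psi>) = 1"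
    using CPTP_D(3,4)[OF CPTP_tensor_power[OF E]] psi psd_carrier[OF psi(1)] by auto
  have "(?st E, ?st F, T') \<in> sequential_strategies dC dG E F n"
    unfolding sequential_strategies_def
  proof (intro CollectI exI conjI)
    show "\<forall>i<n. 0 < ?r i" using dims by (simp add: rotation_memory_def)
    show "\<psi> \<in> density (?r 0 * dC)" using st(2) by (simp add: r0)
    show "\<forall>i<n - 1. ?P i \<in> CPTP (?r i * dG) (?r (Suc i) * dC)" using P by blast
    show "T' \<in> tests (?r (n - 1) * dG)" using T' by (simp only: rn)
  qed simp
  moreover have "type_I_error (?st E, ?st F, T') = type_I_error s"
    unfolding st(1) type_I_error_eq[OF T' state[OF E]] type_I_error_eq[OF st(3) c] tr[OF E] ..
  moreover have "type_II_error (?st E, ?st F, T') = type_II_error s"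
    unfolding st(1) type_II_error_def prod.case tr[OF F] ..
  ultimately show ?thesis by blast
qed

text \<open>Each coherent strategy is matched by a sequential one with the same two errors, so the
  property carries over with the same constant and subsequence.\<close>

lemma sequential_imp_coherent:
  assumes E: "E \<in> CPTP dC dG" and F: "F \<in> CPTP dC dG" and dims: "0 < dC" "0 < dG"
    and esc: "exp_strong_converse sequential_strategies dC dG E F"
  shows "exp_strong_converse coherent_strategies dC dG E F"
  unfolding exp_strong_converse_def
proof (intro allI impI)
  fix s
  assume s: "\<forall>n\<ge>1. s n \<in> coherent_strategies dC dG E F n"
    and lim: "channel_div_reg dC dG E F < liminf (\<lambda>n. ereal (1 / real n) * neg_log2 (type_II_error (s n)))"
  have "\<exists>s'. (1 \<le> n \<longrightarrow> s' \<in> sequential_strategies dC dG E F n) \<and>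
      type_I_error s' = type_I_error (s n) \<and> type_II_error s' = type_II_error (s n)" for n
  proof (cases "1 \<le> n")
    case True
    thus ?thesis using coherent_as_sequential[OF E F dims True] s by blast
  next
    case False
    thus ?thesis by (intro exI[of _ "s n"]) simp
  qed
  then obtain s' where s': "\<And>n. 1 \<le> n \<Longrightarrow> s' n \<in> sequential_strategies dC dG E F n"
      "\<And>n. type_I_error (s' n) = type_I_error (s n)" "\<And>n. type_II_error (s' n) = type_II_error (s n)"
    by metis
  have "channel_div_reg dC dG E F < liminf (\<lambda>n. ereal (1 / real n) * neg_log2 (type_II_error (s' n)))"
    using lim by (simp add: s'(3))
  from esc[unfolded exp_strong_converse_def, rule_format, OF s'(1) this]
  show "\<exists>c>0. \<exists>m. strict_mono m \<and>
      (\<forall>\<^sub>F k in sequentially. 1 - type_I_error (s (m k)) \<le> 2 powr (- c * real (m k)))"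
    unfolding s'(2) .
qed

theorem theorem23:
  fixes dA dB :: nat and N M :: "complex mat \<Rightarrow> complex mat"
  assumes "0 < dA" and "0 < dB"
    and "N \<in> CPTP dA dB" and "M \<in> CPTP dA dB"
  shows "exp_strong_converse coherent_strategies (dA * dA) (dA * dB)
           (id_tensor dA dA dB N) (id_tensor dA dA dB M) \<longleftrightarrow>
         exp_strong_converse sequential_strategies (dA * dA) (dA * dB)
           (id_tensor dA dA dB N) (id_tensor dA dA dB M)"
  using coherent_imp_sequential[OF assms(1,3,4)]
    sequential_imp_coherent[OF CPTP_id_tensor[OF assms(3)] CPTP_id_tensor[OF assms(4)]] assms(1,2)
  by auto

end
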